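(* Let $R$ be a commutative Noetherian ring with non-zero identity and $\mathfrak a$ an ideal of $R$. Let $M$ be an $R$-module (not necessarily finitely generated) such that $\dim M=\dim R$ is finite. Then $$\mathrm{Att}_R(H^{\dim M}_{\mathfrak a}(M))\subseteq\{\mathfrak p\in\mathrm{Ass}_R M\mid \mathrm{cd}(\mathfrak a,R/\mathfrak p)=\dim M\}.$$
   Context: $H^i_{\mathfrak a}(M)=\varinjlim_{n\ge 1}\mathrm{Ext}^i_R(R/\mathfrak a^n,M)$ is the $i$-th local cohomology module. $\mathrm{cd}(\mathfrak a,L)=\sup\{i\in\mathbb Z\mid H^i_{\mathfrak a}(L)\neq0\}$ (with $\sup\emptyset=-\infty$). $\dim M$ is the supremum of lengths of chains of prime ideals in $\mathrm{Supp}(M)$ if this supremum exists, and $\infty$ otherwise. A prime $\mathfrak p$ of $R$ is attached to an $R$-module $A$ if $\mathfrak p=\mathrm{Ann}_R(A/B)$ for some submodule $B$ of $A$ (equivalently $\mathfrak p=\mathrm{Ann}_R(A/\mathfrak pA)$); $\mathrm{Att}_R A$ is the set of attached primes of $A$. *)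

theory Defs
  imports
    "HOL-Algebra.Module"
    "HOL-Algebra.QuotRing"
    "HOL-Algebra.Ideal_Product"
    "HOL-Algebra.Ring_Divisibility"
    "HOL-Library.FSet"
    "HOL-Library.Extended_Real"
begin

section \<open>Modules\<close>

text \<open>The record of modules extends that of rings; the fields \<open>mult\<close> and \<open>one\<close> play no role
  in a module and are left \<open>undefined\<close> below.\<close>

definition ring_module :: "('r, 'c) ring_scheme \<Rightarrow> ('r, 'r) module"
  where "ring_module R = \<lparr>carrier = carrier R, monoid.mult = monoid.mult R, one = one R, zero = zero R,
    add = add R, smult = monoid.mult R\<rparr>"

definition quot_module :: "('r, 'm, 'd) module_scheme \<Rightarrow> 'm set \<Rightarrow> ('r, 'm set) module"
  where "quot_module M B = \<lparr>carrier = a_rcosets\<^bsub>M\<^esub> B, monoid.mult = undefined, one = undefined,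
    zero = B, add = set_add M, smult = (\<lambda>r X. \<Union>x\<in>X. B +>\<^bsub>M\<^esub> (r \<odot>\<^bsub>M\<^esub> x))\<rparr>"

text \<open>Homomorphisms are extensional functions, so that equality in the Hom module is equality
  on the carrier.\<close>

definition hom_module ::
  "('r, 'c) ring_scheme \<Rightarrow> ('r, 'm, 'd) module_scheme \<Rightarrow> ('r, 'n, 'e) module_scheme
     \<Rightarrow> ('r, 'm \<Rightarrow> 'n) module"
  where "hom_module R M N = \<lparr>
    carrier = {f \<in> carrier M \<rightarrow>\<^sub>E carrier N.
      (\<forall>x\<in>carrier M. \<forall>y\<in>carrier M. f (x \<oplus>\<^bsub>M\<^esub> y) = f x \<oplus>\<^bsub>N\<^esub> f y) \<and>
      (\<forall>r\<in>carrier R. \<forall>x\<in>carrier M. f (r \<odot>\<^bsub>M\<^esub> x) = r \<odot>\<^bsub>N\<^esub> f x)},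
    monoid.mult = undefined, one = undefined,
    zero = (\<lambda>x\<in>carrier M. \<zero>\<^bsub>N\<^esub>),
    add = (\<lambda>f g. \<lambda>x\<in>carrier M. f x \<oplus>\<^bsub>N\<^esub> g x),
    smult = (\<lambda>r f. \<lambda>x\<in>carrier M. r \<odot>\<^bsub>N\<^esub> f x)\<rparr>"

text \<open>The free module on a set \<open>B\<close>: functions of finite support contained in \<open>B\<close>.\<close>

definition free_module :: "('r, 'c) ring_scheme \<Rightarrow> 'b set \<Rightarrow> ('r, 'b \<Rightarrow> 'r) module"
  where "free_module R B = \<lparr>
    carrier = {h. range h \<subseteq> carrier R \<and> finite {b. h b \<noteq> \<zero>\<^bsub>R\<^esub>} \<and> {b. h b \<noteq> \<zero>\<^bsub>R\<^esub>} \<subseteq> B},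
    monoid.mult = undefined, one = undefined,
    zero = (\<lambda>b. \<zero>\<^bsub>R\<^esub>),
    add = (\<lambda>g h b. g b \<oplus>\<^bsub>R\<^esub> h b),
    smult = (\<lambda>r h b. r \<otimes>\<^bsub>R\<^esub> h b)\<rparr>"

definition lin_ext ::
  "('r, 'c) ring_scheme \<Rightarrow> ('r, 'n, 'e) module_scheme \<Rightarrow> ('b \<Rightarrow> 'n) \<Rightarrow> ('b \<Rightarrow> 'r) \<Rightarrow> 'n"
  where "lin_ext R N \<phi> h = (\<Oplus>\<^bsub>N\<^esub>b\<in>{b. h b \<noteq> \<zero>\<^bsub>R\<^esub>}. h b \<odot>\<^bsub>N\<^esub> \<phi> b)"

definition push_forward :: "('r, 'c) ring_scheme \<Rightarrow> ('b \<Rightarrow> 'b2) \<Rightarrow> ('b \<Rightarrow> 'r) \<Rightarrow> ('b2 \<Rightarrow> 'r)"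
  where "push_forward R g =
    lin_ext R (free_module R UNIV) (\<lambda>b c. if c = g b then \<one>\<^bsub>R\<^esub> else \<zero>\<^bsub>R\<^esub>)"

definition direct_limit ::
  "nat set \<Rightarrow> (nat \<Rightarrow> ('r, 'm, 'd) module_scheme) \<Rightarrow> (nat \<Rightarrow> nat \<Rightarrow> 'm \<Rightarrow> 'm)
     \<Rightarrow> ('r, (nat \<times> 'm) set) module"
  where "direct_limit I E t =
    (let rel = {((n, x), (m, y)). n \<in> I \<and> m \<in> I \<and> x \<in> carrier (E n) \<and> y \<in> carrier (E m) \<and>
           (\<exists>k\<in>I. n \<le> k \<and> m \<le> k \<and> t n k x = t m k y)}
     in \<lparr>carrier = (SIGMA n:I. carrier (E n)) // rel, monoid.mult = undefined, one = undefined,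
         zero = {(n, x). n \<in> I \<and> x \<in> carrier (E n) \<and> (\<exists>k\<in>I. n \<le> k \<and> t n k x = \<zero>\<^bsub>E k\<^esub>)},
         add = (\<lambda>X Y. \<Union>(n, x)\<in>X. \<Union>(m, y)\<in>Y.
           rel `` {(max n m, t n (max n m) x \<oplus>\<^bsub>E (max n m)\<^esub> t m (max n m) y)}),
         smult = (\<lambda>r X. \<Union>(n, x)\<in>X. rel `` {(n, r \<odot>\<^bsub>E n\<^esub> x)})\<rparr>)"

section \<open>Ext\<close>

text \<open>\<open>Ext\<close> is computed from the standard (functorial) free resolution
  \<open>\<dots> \<longrightarrow> F\<^sub>1 \<longrightarrow> F\<^sub>0 \<longrightarrow> N \<longrightarrow> 0\<close>, in which \<open>F\<^sub>0\<close> is free on the set \<open>N\<close>, \<open>F\<^sub>1\<close> is free on the set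
  \<open>ker (F\<^sub>0 \<longrightarrow> N)\<close>, and \<open>F\<^bsub>k+2\<^esub>\<close> is free on the set \<open>ker (F\<^bsub>k+1\<^esub> \<longrightarrow> F\<^sub>k)\<close>. To have all \<open>F\<^sub>k\<close> in one
  type, a basis element of \<open>F\<^sub>0\<close> is \<open>Gen x\<close> with \<open>x \<in> N\<close>, and a basis element of \<open>F\<^bsub>k+1\<^esub>\<close> is
  \<open>Syz G\<close>, where \<open>G\<close> is the graph, restricted to the support, of an element of \<open>F\<^sub>k\<close>.\<close>

datatype ('r, 'x) syz = is_Gen: Gen (gen: 'x) | Syz (graph: "(('r, 'x) syz \<times> 'r) fset")

definition encode :: "('r, 'c) ring_scheme \<Rightarrow> (('r, 'x) syz \<Rightarrow> 'r) \<Rightarrow> ('r, 'x) syz"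
  where "encode R h = Syz (Abs_fset {(b, h b) | b. h b \<noteq> \<zero>\<^bsub>R\<^esub>})"

definition decode :: "('r, 'c) ring_scheme \<Rightarrow> ('r, 'x) syz \<Rightarrow> ('r, 'x) syz \<Rightarrow> 'r"
  where "decode R s = (\<lambda>b. if \<exists>r. (b, r) \<in> fset (graph s) then THE r. (b, r) \<in> fset (graph s)
                           else \<zero>\<^bsub>R\<^esub>)"

definition res_aug ::
  "('r, 'c) ring_scheme \<Rightarrow> ('r, 'x, 'd) module_scheme \<Rightarrow> (('r, 'x) syz \<Rightarrow> 'r) \<Rightarrow> 'x"
  where "res_aug R N = lin_ext R N gen"

text \<open>The differential \<open>F\<^bsub>k+1\<^esub> \<longrightarrow> F\<^sub>k\<close>, given by the same formula for all \<open>k\<close>.\<close>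

definition res_diff ::
  "('r, 'c) ring_scheme \<Rightarrow> (('r, 'x) syz \<Rightarrow> 'r) \<Rightarrow> (('r, 'x) syz \<Rightarrow> 'r)"
  where "res_diff R = lin_ext R (free_module R UNIV) (decode R)"

primrec res_basis ::
  "('r, 'c) ring_scheme \<Rightarrow> ('r, 'x, 'd) module_scheme \<Rightarrow> nat \<Rightarrow> ('r, 'x) syz set"
  where
    "res_basis R N 0 = Gen ` carrier N"
  | "res_basis R N (Suc k) = encode R ` {h \<in> carrier (free_module R (res_basis R N k)).
       if k = 0 then res_aug R N h = \<zero>\<^bsub>N\<^esub> else res_diff R h = (\<lambda>b. \<zero>\<^bsub>R\<^esub>)}"

definition res ::
  "('r, 'c) ring_scheme \<Rightarrow> ('r, 'x, 'd) module_scheme \<Rightarrow> nat \<Rightarrow> ('r, ('r, 'x) syz \<Rightarrow> 'r) module"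
  where "res R N k = free_module R (res_basis R N k)"

text \<open>The chain map between standard resolutions induced by a homomorphism \<open>f\<close> of modules.\<close>

primrec res_basis_map ::
  "('r, 'c) ring_scheme \<Rightarrow> ('x \<Rightarrow> 'y) \<Rightarrow> nat \<Rightarrow> ('r, 'x) syz \<Rightarrow> ('r, 'y) syz"
  where
    "res_basis_map R f 0 = (\<lambda>s. Gen (f (gen s)))"
  | "res_basis_map R f (Suc k) =
       (\<lambda>s. encode R (push_forward R (res_basis_map R f k) (decode R s)))"

definition res_map ::
  "('r, 'c) ring_scheme \<Rightarrow> ('x \<Rightarrow> 'y) \<Rightarrow> nat \<Rightarrow> (('r, 'x) syz \<Rightarrow> 'r) \<Rightarrow> (('r, 'y) syz \<Rightarrow> 'r)"
  where "res_map R f k = push_forward R (res_basis_map R f k)"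

definition cochains ::
  "('r, 'c) ring_scheme \<Rightarrow> ('r, 'x, 'd) module_scheme \<Rightarrow> ('r, 'm, 'e) module_scheme \<Rightarrow> nat
     \<Rightarrow> ('r, (('r, 'x) syz \<Rightarrow> 'r) \<Rightarrow> 'm) module"
  where "cochains R N M k = hom_module R (res R N k) M"

definition coboundary_map ::
  "('r, 'c) ring_scheme \<Rightarrow> ('r, 'x, 'd) module_scheme \<Rightarrow> nat
     \<Rightarrow> ((('r, 'x) syz \<Rightarrow> 'r) \<Rightarrow> 'm) \<Rightarrow> ((('r, 'x) syz \<Rightarrow> 'r) \<Rightarrow> 'm)"
  where "coboundary_map R N k \<phi> = (\<lambda>h\<in>carrier (res R N (Suc k)). \<phi> (res_diff R h))"

definition cocycles ::
  "('r, 'c) ring_scheme \<Rightarrow> ('r, 'x, 'd) module_scheme \<Rightarrow> ('r, 'm, 'e) module_scheme \<Rightarrow> nat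
     \<Rightarrow> ((('r, 'x) syz \<Rightarrow> 'r) \<Rightarrow> 'm) set"
  where "cocycles R N M k = {\<phi> \<in> carrier (cochains R N M k).
    coboundary_map R N k \<phi> = \<zero>\<^bsub>cochains R N M (Suc k)\<^esub>}"

primrec coboundaries ::
  "('r, 'c) ring_scheme \<Rightarrow> ('r, 'x, 'd) module_scheme \<Rightarrow> ('r, 'm, 'e) module_scheme \<Rightarrow> nat
     \<Rightarrow> ((('r, 'x) syz \<Rightarrow> 'r) \<Rightarrow> 'm) set"
  where
    "coboundaries R N M 0 = {\<zero>\<^bsub>cochains R N M 0\<^esub>}"
  | "coboundaries R N M (Suc k) = coboundary_map R N k ` carrier (cochains R N M k)"

definition Ext ::
  "('r, 'c) ring_scheme \<Rightarrow> nat \<Rightarrow> ('r, 'x, 'd) module_scheme \<Rightarrow> ('r, 'm, 'e) module_scheme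
     \<Rightarrow> ('r, ((('r, 'x) syz \<Rightarrow> 'r) \<Rightarrow> 'm) set) module"
  where "Ext R i N M =
    quot_module (cochains R N M i\<lparr>carrier := cocycles R N M i\<rparr>) (coboundaries R N M i)"

text \<open>The map \<open>Ext\<^sup>i(N', M) \<longrightarrow> Ext\<^sup>i(N, M)\<close> induced by \<open>f : N \<longrightarrow> N'\<close>. It depends on \<open>N'\<close> only
  through \<open>f\<close> and the classes to which it is applied.\<close>

definition Ext_map ::
  "('r, 'c) ring_scheme \<Rightarrow> nat \<Rightarrow> ('x \<Rightarrow> 'y) \<Rightarrow> ('r, 'x, 'd) module_scheme
     \<Rightarrow> ('r, 'm, 'e) module_scheme
     \<Rightarrow> ((('r, 'y) syz \<Rightarrow> 'r) \<Rightarrow> 'm) set \<Rightarrow> ((('r, 'x) syz \<Rightarrow> 'r) \<Rightarrow> 'm) set"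
  where "Ext_map R i f N M X = (\<Union>\<phi>\<in>X. coboundaries R N M i
    +>\<^bsub>cochains R N M i\<^esub> (\<lambda>h\<in>carrier (res R N i). \<phi> (res_map R f i h)))"

section \<open>Local cohomology\<close>

text \<open>\<open>\<aa> [^]\<^bsub>ideals_set R\<^esub> n\<close> is the ideal power \<open>\<aa>\<^sup>n\<close>.\<close>

definition quot_power :: "('r, 'c) ring_scheme \<Rightarrow> 'r set \<Rightarrow> nat \<Rightarrow> ('r, 'r set) module"
  where "quot_power R \<aa> n = quot_module (ring_module R) (\<aa> [^]\<^bsub>ideals_set R\<^esub> n)"

text \<open>For \<open>n \<le> m\<close>, the projection \<open>R/\<aa>\<^sup>m \<longrightarrow> R/\<aa>\<^sup>n\<close> maps a coset \<open>X\<close> to \<open>\<aa>\<^sup>n + X\<close>.\<close>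

definition local_cohomology ::
  "('r, 'c) ring_scheme \<Rightarrow> 'r set \<Rightarrow> nat \<Rightarrow> ('r, 'm, 'd) module_scheme
     \<Rightarrow> ('r, (nat \<times> ((('r, 'r set) syz \<Rightarrow> 'r) \<Rightarrow> 'm) set) set) module"
  where "local_cohomology R \<aa> i M =
    direct_limit {1..}
      (\<lambda>n. Ext R i (quot_power R \<aa> n) M)
      (\<lambda>n m. Ext_map R i (\<lambda>X. (\<aa> [^]\<^bsub>ideals_set R\<^esub> n) <+>\<^bsub>R\<^esub> X) (quot_power R \<aa> m) M)"

text \<open>\<open>H\<^sup>i\<close> vanishes for negative \<open>i\<close>, so the supremum may be taken over \<open>i :: nat\<close>. In \<open>ereal\<close>
  the supremum of the empty set is \<open>-\<infinity>\<close>.\<close>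

definition cd :: "('r, 'c) ring_scheme \<Rightarrow> 'r set \<Rightarrow> ('r, 'm, 'd) module_scheme \<Rightarrow> ereal"
  where "cd R \<aa> L = Sup {ereal (real i) | i::nat.
    carrier (local_cohomology R \<aa> i L) \<noteq> {\<zero>\<^bsub>local_cohomology R \<aa> i L\<^esub>}}"

section \<open>Support and dimension\<close>

text \<open>The localization of \<open>M\<close> at a prime \<open>\<pp>\<close>, as an \<open>R\<close>-module.\<close>

definition loc_rel ::
  "('r, 'c) ring_scheme \<Rightarrow> ('r, 'm, 'd) module_scheme \<Rightarrow> 'r set \<Rightarrow> (('m \<times> 'r) \<times> ('m \<times> 'r)) set"
  where "loc_rel R M \<pp> = {((x, s), (y, t)).
    x \<in> carrier M \<and> y \<in> carrier M \<and> s \<in> carrier R - \<pp> \<and> t \<in> carrier R - \<pp> \<and>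
    (\<exists>u\<in>carrier R - \<pp>. u \<odot>\<^bsub>M\<^esub> (t \<odot>\<^bsub>M\<^esub> x) = u \<odot>\<^bsub>M\<^esub> (s \<odot>\<^bsub>M\<^esub> y))}"

definition localization ::
  "('r, 'c) ring_scheme \<Rightarrow> ('r, 'm, 'd) module_scheme \<Rightarrow> 'r set \<Rightarrow> ('r, ('m \<times> 'r) set) module"
  where "localization R M \<pp> = \<lparr>
    carrier = (carrier M \<times> (carrier R - \<pp>)) // loc_rel R M \<pp>,
    monoid.mult = undefined, one = undefined,
    zero = loc_rel R M \<pp> `` {(\<zero>\<^bsub>M\<^esub>, \<one>\<^bsub>R\<^esub>)},
    add = (\<lambda>X Y. \<Union>(x, s)\<in>X. \<Union>(y, t)\<in>Y.
      loc_rel R M \<pp> `` {(t \<odot>\<^bsub>M\<^esub> x \<oplus>\<^bsub>M\<^esub> s \<odot>\<^bsub>M\<^esub> y, s \<otimes>\<^bsub>R\<^esub> t)}),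
    smult = (\<lambda>r X. \<Union>(x, s)\<in>X. loc_rel R M \<pp> `` {(r \<odot>\<^bsub>M\<^esub> x, s)})\<rparr>"

definition Supp :: "('r, 'c) ring_scheme \<Rightarrow> ('r, 'm, 'd) module_scheme \<Rightarrow> 'r set set"
  where "Supp R M = {\<pp>. primeideal \<pp> R \<and>
    carrier (localization R M \<pp>) \<noteq> {\<zero>\<^bsub>localization R M \<pp>\<^esub>}}"

definition chain_dim :: "'a set set \<Rightarrow> ereal"
  where "chain_dim S = Sup {ereal (real n) | n.
    \<exists>P. (\<forall>i\<le>n. P i \<in> S) \<and> (\<forall>i<n. P i \<subset> P (Suc i))}"

definition module_dim :: "('r, 'c) ring_scheme \<Rightarrow> ('r, 'm, 'd) module_scheme \<Rightarrow> ereal"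
  where "module_dim R M = chain_dim (Supp R M)"

definition krull_dim :: "('r, 'c) ring_scheme \<Rightarrow> ereal"
  where "krull_dim R = chain_dim {\<pp>. primeideal \<pp> R}"

section \<open>Associated and attached primes\<close>

definition annihilator :: "('r, 'c) ring_scheme \<Rightarrow> ('r, 'm, 'd) module_scheme \<Rightarrow> 'r set"
  where "annihilator R M = {r \<in> carrier R. \<forall>x\<in>carrier M. r \<odot>\<^bsub>M\<^esub> x = \<zero>\<^bsub>M\<^esub>}"

definition Ass :: "('r, 'c) ring_scheme \<Rightarrow> ('r, 'm, 'd) module_scheme \<Rightarrow> 'r set set"
  where "Ass R M = {\<pp>. primeideal \<pp> R \<and>
    (\<exists>x\<in>carrier M. \<pp> = {r \<in> carrier R. r \<odot>\<^bsub>M\<^esub> x = \<zero>\<^bsub>M\<^esub>})}"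

definition Att :: "('r, 'c) ring_scheme \<Rightarrow> ('r, 'm, 'd) module_scheme \<Rightarrow> 'r set set"
  where "Att R A = {\<pp>. primeideal \<pp> R \<and>
    (\<exists>B. submodule B R A \<and> \<pp> = annihilator R (quot_module A B))}"

end

theory Submission
  imports Defs
begin

text \<open>Write \<open>H\<^sup>i(N)\<close> for \<open>H\<^sup>i\<^sub>\<aa>(N)\<close> and let \<open>d = dim R\<close>. The proof rests on four properties of local cohomology.

\<^item> Vanishing (\<open>vanishing_above_coheight\<close>): if no chain of primes of length \<open>i\<close> starts at \<open>q\<close>, then
  \<open>H\<^sup>i(R/q) = 0\<close>. Induct on \<open>i\<close>. If some \<open>r \<in> \<aa>\<close> is not in \<open>q\<close>, it is a nonzerodivisor on \<open>R/q\<close>;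
  by induction \<open>H\<^bsup>i-1\<^esup>(R/(q + rR)) = 0\<close>, so \<open>r\<close> acts injectively on \<open>H\<^sup>i(R/q)\<close>, where it also acts
  nilpotently on each element. If \<open>\<aa> \<subseteq> q\<close>, then \<open>H\<^sup>i\<close> of the \<open>\<aa>\<close>-torsion module \<open>R/q\<close> vanishes for
  \<open>i > 0\<close> (\<open>vanishing_torsion\<close>).
\<^item> Reduction to primes (\<open>vanishing_of_primes\<close>): \<open>H\<^sup>i(N) = 0\<close> if \<open>H\<^sup>i(R/q) = 0\<close> for all primes \<open>q\<close> that
  contain the annihilator of an element of \<open>N\<close>. For cyclic \<open>N\<close> this is Noetherian induction on the
  annihilator, and for finitely generated \<open>N\<close> one filters by cyclic modules. Every class of
  \<open>H\<^sup>i(N)\<close> comes from a finitely generated submodule.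
\<^item> Right exactness in the top degree (\<open>local_cohomology_generated_by_multiples\<close>): as \<open>H\<^bsup>d+1\<^esup>\<close>
  vanishes on all modules, \<open>H\<^sup>d(M)/pH\<^sup>d(M) \<noteq> 0\<close> implies \<open>H\<^sup>d(M/pM) \<noteq> 0\<close>.
\<^item> A minimal prime that contains the annihilator of an element of \<open>M\<close> is associated to \<open>M\<close>
  (\<open>minimal_prime_associated\<close>).

Let \<open>p\<close> be attached to \<open>H\<^sup>d(M)\<close>. Then \<open>p\<close> annihilates a nonzero quotient of \<open>H\<^sup>d(M)\<close>, hence
\<open>H\<^sup>d(M/pM) \<noteq> 0\<close>. By the reduction to primes there are \<open>x \<in> M\<close> and a prime \<open>q \<supseteq> (pM : x) \<supseteq> p\<close> with
\<open>H\<^sup>d(R/q) \<noteq> 0\<close>. By vanishing, a chain of primes of length \<open>d\<close> starts at \<open>q\<close>. Since \<open>d = dim R\<close>, the prime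
\<open>q\<close> is minimal, so \<open>q = p\<close>. Now \<open>p\<close> contains the annihilator of \<open>x\<close>, hence is associated to \<open>M\<close>; and
\<open>H\<^sup>d(R/p) \<noteq> 0\<close> while \<open>H\<^sup>i(R/p) = 0\<close> for \<open>i > d\<close>, so \<open>cd(\<aa>, R/p) = d\<close>.

Both the torsion vanishing and the reduction to finitely generated modules come from
\<open>small_chain_maps\<close>: given \<open>n\<close>, \<open>k\<close> and a power of \<open>\<aa>\<close>, for suitable \<open>m\<close> the map \<open>R/\<aa>\<^sup>m \<longrightarrow> R/\<aa>\<^sup>n\<close> lifts to a chain map of
the standard resolutions whose image in degree \<open>k\<close> lies in a finitely generated free module that
depends only on \<open>n\<close> and \<open>k\<close>, and for \<open>k > 0\<close> in the product of this module with the given power. It is built degree by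
degree with the Artin-Rees property. By \<open>homotopic\<close> such chain maps may replace the functorial ones in
the direct limit that defines \<open>H\<^sup>i\<close>.

All cohomological arguments are about functions on the bases of the standard resolutions.
A class of \<open>H\<^sup>i(A/B)\<close>, for submodules \<open>B \<subseteq> A\<close> of \<open>M\<close>, is represented by a function into \<open>A\<close> that is a
cocycle modulo \<open>B\<close>; it vanishes if its pullback to some \<open>R/\<aa>\<^sup>m\<close> is a coboundary modulo \<open>B\<close>.
In this way the filtration argument never leaves the type of \<open>M\<close>, and lifting along \<open>A \<longrightarrow> A/B\<close> is a choice
of values. The predicate \<open>lc_vanishes\<close> records the vanishing in this form, and
\<open>local_cohomology_zero_iff\<close> relates it to the module \<open>local_cohomology R \<aa> i M\<close>.\<close>

section \<open>Linear maps, submodules and spans\<close>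

definition mod_hom ::
  "('r, 'c) ring_scheme \<Rightarrow> ('r, 'n, 'd) module_scheme \<Rightarrow> ('r, 'm, 'e) module_scheme \<Rightarrow> ('n \<Rightarrow> 'm) set"
  where "mod_hom R N M = {L \<in> carrier N \<rightarrow> carrier M.
     (\<forall>x\<in>carrier N. \<forall>y\<in>carrier N. L (x \<oplus>\<^bsub>N\<^esub> y) = L x \<oplus>\<^bsub>M\<^esub> L y) \<and>
     (\<forall>r\<in>carrier R. \<forall>x\<in>carrier N. L (r \<odot>\<^bsub>N\<^esub> x) = r \<odot>\<^bsub>M\<^esub> L x)}"

lemma mod_homI:
  assumes "\<And>x. x \<in> carrier N \<Longrightarrow> L x \<in> carrier M"
    and "\<And>x y. x \<in> carrier N \<Longrightarrow> y \<in> carrier N \<Longrightarrow> L (x \<oplus>\<^bsub>N\<^esub> y) = L x \<oplus>\<^bsub>M\<^esub> L y"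
    and "\<And>r x. r \<in> carrier R \<Longrightarrow> x \<in> carrier N \<Longrightarrow> L (r \<odot>\<^bsub>N\<^esub> x) = r \<odot>\<^bsub>M\<^esub> L x"
  shows "L \<in> mod_hom R N M"
  using assms by (auto simp: mod_hom_def)

lemma mod_homD:
  assumes "L \<in> mod_hom R N M"
  shows "x \<in> carrier N \<Longrightarrow> L x \<in> carrier M"
    and "x \<in> carrier N \<Longrightarrow> y \<in> carrier N \<Longrightarrow> L (x \<oplus>\<^bsub>N\<^esub> y) = L x \<oplus>\<^bsub>M\<^esub> L y"
    and "r \<in> carrier R \<Longrightarrow> x \<in> carrier N \<Longrightarrow> L (r \<odot>\<^bsub>N\<^esub> x) = r \<odot>\<^bsub>M\<^esub> L x"
  using assms by (auto simp: mod_hom_def)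

lemma (in module) neg_conv_smult: "x \<in> carrier M \<Longrightarrow> \<ominus>\<^bsub>M\<^esub> x = (\<ominus> \<one>) \<odot>\<^bsub>M\<^esub> x"
  by (simp add: smult_l_minus)

lemma mod_hom_zero:
  assumes "module R N" "module R M" "L \<in> mod_hom R N M"
  shows "L \<zero>\<^bsub>N\<^esub> = \<zero>\<^bsub>M\<^esub>"
proof -
  interpret N: module R N by fact
  interpret M: module R M by fact
  have "L (\<zero>\<^bsub>R\<^esub> \<odot>\<^bsub>N\<^esub> \<zero>\<^bsub>N\<^esub>) = \<zero>\<^bsub>R\<^esub> \<odot>\<^bsub>M\<^esub> L \<zero>\<^bsub>N\<^esub>"
    by (rule mod_homD(3)[OF assms(3)]) auto
  then show ?thesis using mod_homD(1)[OF assms(3), of "\<zero>\<^bsub>N\<^esub>"] by simp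
qed

lemma mod_hom_neg:
  assumes "module R N" "module R M" "L \<in> mod_hom R N M" "x \<in> carrier N"
  shows "L (\<ominus>\<^bsub>N\<^esub> x) = \<ominus>\<^bsub>M\<^esub> L x"
proof -
  interpret N: module R N by fact
  interpret M: module R M by fact
  show ?thesis
    using assms(4) mod_homD[OF assms(3)]
    by (simp add: N.neg_conv_smult M.neg_conv_smult)
qed

lemma mod_hom_minus:
  assumes "module R N" "module R M" "L \<in> mod_hom R N M" "x \<in> carrier N" "y \<in> carrier N"
  shows "L (x \<ominus>\<^bsub>N\<^esub> y) = L x \<ominus>\<^bsub>M\<^esub> L y"
proof -
  interpret N: module R N by fact
  show ?thesis
    using assms(4,5) mod_homD(2)[OF assms(3), of x "\<ominus>\<^bsub>N\<^esub> y"] mod_hom_neg[OF assms(1-3)]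
    by (simp add: a_minus_def)
qed

lemma mod_hom_cong:
  assumes "L \<in> mod_hom R N M" "\<And>x. x \<in> carrier N \<Longrightarrow> L x = L' x" "module R N"
  shows "L' \<in> mod_hom R N M"
proof -
  interpret N: module R N by fact
  show ?thesis
    using mod_homD[OF assms(1)] assms(2)
    by (intro mod_homI; metis N.M.a_closed N.smult_closed)
qed

lemma mod_hom_finsum:
  assumes "module R N" "module R M" "L \<in> mod_hom R N M" "f \<in> S \<rightarrow> carrier N"
  shows "L (\<Oplus>\<^bsub>N\<^esub>b\<in>S. f b) = (\<Oplus>\<^bsub>M\<^esub>b\<in>S. L (f b))"
proof (cases "finite S")
  case True
  interpret N: module R N by fact
  interpret M: module R M by fact
  show ?thesis using True assms(4)
  proof (induction S rule: finite_induct)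
    case empty
    then show ?case by (simp add: mod_hom_zero[OF assms(1-3)])
  next
    case (insert x F)
    then have f: "f \<in> F \<rightarrow> carrier N" "f x \<in> carrier N" "(\<lambda>b. L (f b)) \<in> F \<rightarrow> carrier M" "L (f x) \<in> carrier M"
      using mod_homD(1)[OF assms(3)] by auto
    with insert show ?case
      by (simp add: mod_homD(2)[OF assms(3)])
  qed
next
  case False
  then show ?thesis
    by (simp add: finsum_def finprod_def mod_hom_zero[OF assms(1-3)])
qed

context module begin

lemma diff_add_left: "x \<in> carrier M \<Longrightarrow> y \<in> carrier M \<Longrightarrow> (x \<oplus>\<^bsub>M\<^esub> y) \<ominus>\<^bsub>M\<^esub> x = y"
  by (simp add: a_minus_def M.a_comm[of x y] M.a_assoc M.r_neg)

lemma diff_cancel_left: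
  assumes "p \<in> carrier M" "u \<in> carrier M" "v \<in> carrier M"
  shows "(p \<oplus>\<^bsub>M\<^esub> u) \<ominus>\<^bsub>M\<^esub> (p \<oplus>\<^bsub>M\<^esub> v) = u \<ominus>\<^bsub>M\<^esub> v"
proof -
  have "(p \<oplus>\<^bsub>M\<^esub> u) \<ominus>\<^bsub>M\<^esub> (p \<oplus>\<^bsub>M\<^esub> v) = ((p \<oplus>\<^bsub>M\<^esub> u) \<ominus>\<^bsub>M\<^esub> p) \<ominus>\<^bsub>M\<^esub> v"
    using assms by (simp add: a_minus_def M.minus_add M.a_assoc)
  then show ?thesis using assms by (simp add: diff_add_left)
qed

lemma minus_conv: "x \<in> carrier M \<Longrightarrow> y \<in> carrier M \<Longrightarrow> x = (x \<ominus>\<^bsub>M\<^esub> y) \<oplus>\<^bsub>M\<^esub> y"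
  by (simp add: a_minus_def M.a_assoc M.l_neg)

lemma diff_add_right: "x \<in> carrier M \<Longrightarrow> y \<in> carrier M \<Longrightarrow> (x \<oplus>\<^bsub>M\<^esub> y) \<ominus>\<^bsub>M\<^esub> y = x"
  by (simp add: a_minus_def M.a_assoc M.r_neg)

lemma diff_triangle:
  assumes "x \<in> carrier M" "y \<in> carrier M" "z \<in> carrier M"
  shows "(x \<ominus>\<^bsub>M\<^esub> y) \<oplus>\<^bsub>M\<^esub> (y \<ominus>\<^bsub>M\<^esub> z) = x \<ominus>\<^bsub>M\<^esub> z"
proof -
  have "(x \<ominus>\<^bsub>M\<^esub> y) \<oplus>\<^bsub>M\<^esub> (y \<ominus>\<^bsub>M\<^esub> z) = ((x \<ominus>\<^bsub>M\<^esub> y) \<oplus>\<^bsub>M\<^esub> y) \<ominus>\<^bsub>M\<^esub> z"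
    using assms by (simp add: a_minus_def M.a_assoc)
  then show ?thesis using assms minus_conv[of x y] by simp
qed

lemma diff_cancel:
  assumes "x \<in> carrier M" "y \<in> carrier M"
  shows "x \<ominus>\<^bsub>M\<^esub> (x \<ominus>\<^bsub>M\<^esub> y) = y"
  using assms by (simp add: a_minus_def M.minus_add M.minus_minus M.r_neg2)

lemma submodule_sub: "submodule A R M \<Longrightarrow> x \<in> A \<Longrightarrow> x \<in> carrier M"
  using submoduleE(1) by blast

lemma submodule_add: "submodule A R M \<Longrightarrow> x \<in> A \<Longrightarrow> y \<in> A \<Longrightarrow> x \<oplus>\<^bsub>M\<^esub> y \<in> A"
  using submoduleE(5) by blast

lemma submodule_smult: "submodule A R M \<Longrightarrow> r \<in> carrier R \<Longrightarrow> x \<in> A \<Longrightarrow> r \<odot>\<^bsub>M\<^esub> x \<in> A"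
  using submoduleE(4) by blast

lemma submodule_neg: "submodule A R M \<Longrightarrow> x \<in> A \<Longrightarrow> \<ominus>\<^bsub>M\<^esub> x \<in> A"
  using submoduleE(3) by blast

lemma submodule_zero: "submodule A R M \<Longrightarrow> \<zero>\<^bsub>M\<^esub> \<in> A"
  using submoduleE(2)[of A] submodule_add[of A] submodule_neg[of A] submodule_sub[of A]
  by (metis M.r_neg all_not_in_conv)

lemma submodule_minus: "submodule A R M \<Longrightarrow> x \<in> A \<Longrightarrow> y \<in> A \<Longrightarrow> x \<ominus>\<^bsub>M\<^esub> y \<in> A"
  by (simp add: a_minus_def submodule_add submodule_neg)

lemma submodule_diffD':
  assumes B: "submodule B R M" and "x \<ominus>\<^bsub>M\<^esub> y \<in> B" "x \<in> B" "y \<in> carrier M"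
  shows "y \<in> B"
  using submodule_minus[OF B assms(3,2)] diff_cancel[OF submodule_sub[OF B assms(3)] assms(4)] by simp

lemma submodule_diffD:
  assumes B: "submodule B R M" and "x \<ominus>\<^bsub>M\<^esub> y \<in> B" "y \<in> B" "x \<in> carrier M"
  shows "x \<in> B"
  using submodule_add[OF B assms(2,3)] minus_conv[of x y] assms(4) submodule_sub[OF B assms(3)] by simp

lemma submodule_finsum:
  assumes "submodule A R M" "f \<in> S \<rightarrow> A"
  shows "(\<Oplus>\<^bsub>M\<^esub>b\<in>S. f b) \<in> A"
proof (cases "finite S")
  case True
  then show ?thesis using assms(2)
  proof (induction S rule: finite_induct)
    case empty
    then show ?case by (simp add: submodule_zero[OF assms(1)])
  next
    case (insert x F)
    then have "f \<in> F \<rightarrow> carrier M" "f x \<in> carrier M" using submodule_sub[OF assms(1)] by auto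
    with insert show ?case by (auto intro: submodule_add[OF assms(1)])
  qed
next
  case False
  then show ?thesis by (simp add: finsum_def finprod_def submodule_zero[OF assms(1)])
qed

lemma submodule_test:
  assumes "A \<subseteq> carrier M" "\<zero>\<^bsub>M\<^esub> \<in> A" "\<And>x y. x \<in> A \<Longrightarrow> y \<in> A \<Longrightarrow> x \<oplus>\<^bsub>M\<^esub> y \<in> A"
    "\<And>r x. r \<in> carrier R \<Longrightarrow> x \<in> A \<Longrightarrow> r \<odot>\<^bsub>M\<^esub> x \<in> A"
  shows "submodule A R M"
proof (rule submoduleI)
  fix a assume a: "a \<in> A"
  then have "a \<in> carrier M" using assms(1) by blast
  then have "\<ominus>\<^bsub>M\<^esub> a = (\<ominus> \<one>) \<odot>\<^bsub>M\<^esub> a" by (rule neg_conv_smult)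
  then show "\<ominus>\<^bsub>M\<^esub> a \<in> A" using assms(4) a by simp
qed (use assms in auto)

lemma submodule_inter:
  assumes "submodule A R M" "submodule B R M"
  shows "submodule (A \<inter> B) R M"
  by (rule submodule_test)
    (use assms in \<open>auto intro: submodule_add submodule_zero submodule_smult submodule_sub\<close>)

lemma submodule_zero_set: "submodule {\<zero>\<^bsub>M\<^esub>} R M"
  by (rule submodule_test) auto

end

inductive_set mspan ::
  "('r, 'c) ring_scheme \<Rightarrow> ('r, 'm, 'd) module_scheme \<Rightarrow> 'm set \<Rightarrow> 'm set"
  for R and M and E where
  mspan_zero: "\<zero>\<^bsub>M\<^esub> \<in> mspan R M E"
| mspan_base: "x \<in> E \<Longrightarrow> x \<in> mspan R M E"
| mspan_add: "x \<in> mspan R M E \<Longrightarrow> y \<in> mspan R M E \<Longrightarrow> x \<oplus>\<^bsub>M\<^esub> y \<in> mspan R M E"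
| mspan_smult: "r \<in> carrier R \<Longrightarrow> x \<in> mspan R M E \<Longrightarrow> r \<odot>\<^bsub>M\<^esub> x \<in> mspan R M E"

lemma mspan_mono: "E \<subseteq> E' \<Longrightarrow> mspan R M E \<subseteq> mspan R M E'"
proof
  fix x assume sub: "E \<subseteq> E'" and "x \<in> mspan R M E"
  from this(2) show "x \<in> mspan R M E'"
    by (induction x rule: mspan.induct) (use sub in \<open>auto intro: mspan.intros\<close>)
qed

lemma mspan_subset_cong:
  assumes "zero M = zero M'" "add M = add M'" "smult M = smult M'" "x \<in> mspan R M E"
  shows "x \<in> mspan R M' E"
  using assms(4)
proof (induction x rule: mspan.induct)
  case mspan_zero
  show ?case unfolding assms(1) by (rule mspan.mspan_zero)
next
  case (mspan_add x y)
  then show ?case unfolding assms(2) by (intro mspan.mspan_add)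
next
  case (mspan_smult r x)
  then show ?case unfolding assms(3) by (intro mspan.mspan_smult)
qed (rule mspan.mspan_base)

context module begin

lemma mspan_least: "submodule A R M \<Longrightarrow> E \<subseteq> A \<Longrightarrow> mspan R M E \<subseteq> A"
proof
  fix x assume A: "submodule A R M" "E \<subseteq> A" and "x \<in> mspan R M E"
  from this(3) show "x \<in> A"
    by (induction x rule: mspan.induct)
      (use A in \<open>auto intro: submodule_zero submodule_add submodule_smult\<close>)
qed

lemma mspan_submodule:
  assumes "E \<subseteq> carrier M"
  shows "submodule (mspan R M E) R M"
proof (rule submodule_test)
  show "mspan R M E \<subseteq> carrier M" by (rule mspan_least[OF carrier_is_submodule assms])
qed (auto intro: mspan.intros)

lemma mspan_idem: "submodule A R M \<Longrightarrow> mspan R M A = A"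
  using mspan_least[of A A] by (auto intro: mspan_base)

text \<open>Elements of a span are split off one generator at a time; this is how finitely generated modules
are reduced to cyclic ones.\<close>

lemma mspan_insertD:
  assumes "y \<in> mspan R M (insert x E)" "insert x E \<subseteq> carrier M"
  shows "\<exists>r\<in>carrier R. \<exists>b\<in>mspan R M E. y = r \<odot>\<^bsub>M\<^esub> x \<oplus>\<^bsub>M\<^esub> b"
proof -
  have x: "x \<in> carrier M" using assms by auto
  have E: "submodule (mspan R M E) R M" by (rule mspan_submodule) (use assms in auto)
  note sub = submodule_sub[OF E]
  from assms(1) show ?thesis
  proof (induction y rule: mspan.induct)
    case mspan_zero
    show ?case using x by (intro bexI[of _ \<zero>] bexI[of _ "\<zero>\<^bsub>M\<^esub>"]) (auto intro: mspan.intros)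
  next
    case (mspan_base z)
    show ?case
    proof (cases "z = x")
      case True
      then show ?thesis using x by (intro bexI[of _ \<one>] bexI[of _ "\<zero>\<^bsub>M\<^esub>"]) (auto intro: mspan.intros)
    next
      case False
      then have "z \<in> E" using mspan_base by auto
      then show ?thesis using x assms
        by (intro bexI[of _ \<zero>] bexI[of _ z]) (auto intro: mspan.intros)
    qed
  next
    case (mspan_add u v)
    then obtain r b r' b' where *: "r \<in> carrier R" "b \<in> mspan R M E" "u = r \<odot>\<^bsub>M\<^esub> x \<oplus>\<^bsub>M\<^esub> b"
      "r' \<in> carrier R" "b' \<in> mspan R M E" "v = r' \<odot>\<^bsub>M\<^esub> x \<oplus>\<^bsub>M\<^esub> b'" by blast
    then have "u \<oplus>\<^bsub>M\<^esub> v = (r \<oplus> r') \<odot>\<^bsub>M\<^esub> x \<oplus>\<^bsub>M\<^esub> (b \<oplus>\<^bsub>M\<^esub> b')"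
      using x sub by (simp add: smult_l_distr M.a_ac)
    then show ?case using * by (metis R.a_closed mspan.mspan_add)
  next
    case (mspan_smult s u)
    then obtain r b where *: "r \<in> carrier R" "b \<in> mspan R M E" "u = r \<odot>\<^bsub>M\<^esub> x \<oplus>\<^bsub>M\<^esub> b" by blast
    then have "s \<odot>\<^bsub>M\<^esub> u = (s \<otimes> r) \<odot>\<^bsub>M\<^esub> x \<oplus>\<^bsub>M\<^esub> s \<odot>\<^bsub>M\<^esub> b"
      using x sub mspan_smult by (simp add: smult_r_distr smult_assoc1)
    then show ?case using * mspan_smult by (metis R.m_closed mspan.mspan_smult)
  qed
qed

end

lemma mod_hom_image_mspan:
  assumes "module R N" "module R M" "L \<in> mod_hom R N M" "E \<subseteq> carrier N"
  shows "L ` mspan R N E = mspan R M (L ` E)"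
proof -
  interpret N: module R N by fact
  interpret M: module R M by fact
  have sub: "x \<in> mspan R N E \<Longrightarrow> x \<in> carrier N" for x
    using N.submodule_sub[OF N.mspan_submodule[OF assms(4)]] .
  note L = mod_homD[OF assms(3)]
  show ?thesis
  proof (intro equalityI subsetI)
    fix y assume "y \<in> L ` mspan R N E"
    then obtain x where "x \<in> mspan R N E" "y = L x" by auto
    moreover have "L x \<in> mspan R M (L ` E)" if "x \<in> mspan R N E" for x using that
    proof (induction x rule: mspan.induct)
      case mspan_zero
      then show ?case by (simp add: mod_hom_zero[OF assms(1-3)] mspan.intros)
    qed (auto simp: L sub intro: mspan.intros)
    ultimately show "y \<in> mspan R M (L ` E)" by simp
  next
    fix y assume "y \<in> mspan R M (L ` E)"
    then show "y \<in> L ` mspan R N E"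
    proof (induction y rule: mspan.induct)
      case mspan_zero
      show ?case by (rule image_eqI[of _ _ "\<zero>\<^bsub>N\<^esub>"]) (auto simp: mod_hom_zero[OF assms(1-3)] intro: mspan.intros)
    next
      case (mspan_base x)
      then show ?case by (auto intro: mspan.intros)
    next
      case (mspan_add x y)
      then obtain a b where "a \<in> mspan R N E" "b \<in> mspan R N E" "x = L a" "y = L b" by auto
      then show ?case using sub by (intro image_eqI[of _ _ "a \<oplus>\<^bsub>N\<^esub> b"]) (auto simp: L intro: mspan.intros)
    next
      case (mspan_smult r x)
      then obtain a where "a \<in> mspan R N E" "x = L a" by auto
      then show ?case using sub mspan_smult by (intro image_eqI[of _ _ "r \<odot>\<^bsub>N\<^esub> a"]) (auto simp: L intro: mspan.intros)
    qed
  qed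
qed

section \<open>The ring as a module\<close>

lemma ring_module_simps [simp]:
  "carrier (ring_module R) = carrier R" "zero (ring_module R) = zero R"
  "add (ring_module R) = add R" "smult (ring_module R) = monoid.mult R"
  "a_inv (ring_module R) = a_inv R" "a_minus (ring_module R) = a_minus R"
  by (simp_all add: ring_module_def a_inv_def a_minus_def m_inv_def fun_eq_iff)

lemma (in cring) module_ring_module: "module R (ring_module R)"
proof (rule moduleI)
  show "cring R" by (rule is_cring)
  show "abelian_group (ring_module R)"
  proof (rule abelian_groupI)
    fix x assume "x \<in> carrier (ring_module R)"
    then show "\<exists>y\<in>carrier (ring_module R). y \<oplus>\<^bsub>ring_module R\<^esub> x = \<zero>\<^bsub>ring_module R\<^esub>"
      by (intro bexI[of _ "\<ominus> x"]) (simp_all add: l_neg)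
  qed (simp_all add: a_ac)
qed (auto simp: l_distr r_distr m_assoc)

lemma (in cring) ideal_iff_submodule: "ideal J R \<longleftrightarrow> submodule J R (ring_module R)"
proof
  interpret RM: module R "ring_module R" by (rule module_ring_module)
  { assume "ideal J R"
    then interpret J: ideal J R .
    show "submodule J R (ring_module R)"
      by (rule RM.submodule_test) (auto simp: J.I_l_closed) }
  { assume J: "submodule J R (ring_module R)"
    show "ideal J R"
    proof (rule idealI)
      show "ring R" by (rule ring_axioms)
      show "subgroup J (add_monoid R)"
        using RM.submodule_sub[OF J] RM.submodule_add[OF J] RM.submodule_zero[OF J] RM.submodule_neg[OF J]
        by (intro subgroup.intro) (auto simp: a_inv_def[symmetric])
    next
      fix a x assume *: "a \<in> J" "x \<in> carrier R"
      then show "x \<otimes> a \<in> J" using RM.submodule_smult[OF J, of x a] by simp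
      then show "a \<otimes> x \<in> J" using * RM.submodule_sub[OF J] m_comm by simp
    qed }
qed

section \<open>Free modules\<close>

lemma free_module_simps [simp]:
  "zero (free_module R B) = (\<lambda>b. \<zero>\<^bsub>R\<^esub>)"
  "add (free_module R B) = (\<lambda>g h b. g b \<oplus>\<^bsub>R\<^esub> h b)"
  "smult (free_module R B) = (\<lambda>r h b. r \<otimes>\<^bsub>R\<^esub> h b)"
  by (simp_all add: free_module_def)

definition delta :: "('r, 'c) ring_scheme \<Rightarrow> 'b \<Rightarrow> 'b \<Rightarrow> 'r"
  where "delta R b = (\<lambda>c. if c = b then \<one>\<^bsub>R\<^esub> else \<zero>\<^bsub>R\<^esub>)"

lemma free_carrier_iff:
  "h \<in> carrier (free_module R B) \<longleftrightarrow> (\<forall>b. h b \<in> carrier R) \<and> finite {b. h b \<noteq> \<zero>\<^bsub>R\<^esub>} \<and> (\<forall>b. h b \<noteq> \<zero>\<^bsub>R\<^esub> \<longrightarrow> b \<in> B)"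
  by (auto simp: free_module_def)

lemma free_carrier_mono:
  "B \<subseteq> B' \<Longrightarrow> h \<in> carrier (free_module R B) \<Longrightarrow> h \<in> carrier (free_module R B')"
  by (auto simp: free_carrier_iff)

lemma free_funcset_UNIV:
  "f \<in> S \<rightarrow> carrier (free_module R B) \<Longrightarrow> f \<in> S \<rightarrow> carrier (free_module R UNIV)"
  by (auto intro: free_carrier_mono[of B UNIV])

context cring begin

lemma module_free_module:
  fixes B :: "'z set"
  shows "module R (free_module R B)"
proof (rule moduleI)
  show "cring R" by (rule is_cring)
  have fin: "finite {b. g b \<oplus> h b \<noteq> \<zero>}" if "finite {b. g b \<noteq> \<zero>}" "finite {b. h b \<noteq> \<zero>}" for g h :: "'z \<Rightarrow> 'a"
    by (rule finite_subset[of _ "{b. g b \<noteq> \<zero>} \<union> {b. h b \<noteq> \<zero>}"]) (use that in auto)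
  show "abelian_group (free_module R B)"
  proof (rule abelian_groupI)
    fix x y assume xy: "x \<in> carrier (free_module R B)" "y \<in> carrier (free_module R B)"
    have "b \<in> B" if "x b \<oplus> y b \<noteq> \<zero>" for b
    proof (rule ccontr)
      assume "b \<notin> B"
      then have "x b = \<zero>" "y b = \<zero>" using xy by (auto simp: free_carrier_iff)
      then show False using that by simp
    qed
    then show "x \<oplus>\<^bsub>free_module R B\<^esub> y \<in> carrier (free_module R B)"
      using xy fin[of x y] by (simp add: free_carrier_iff)
  next
    fix x assume x: "x \<in> carrier (free_module R B)"
    have "finite {b. \<ominus> x b \<noteq> \<zero>}"
      by (rule finite_subset[of _ "{b. x b \<noteq> \<zero>}"]) (use x in \<open>auto simp: free_carrier_iff\<close>)
    then show "\<exists>y\<in>carrier (free_module R B). y \<oplus>\<^bsub>free_module R B\<^esub> x = \<zero>\<^bsub>free_module R B\<^esub>"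
      using x by (intro bexI[of _ "\<lambda>b. \<ominus> x b"]) (auto simp: free_carrier_iff l_neg)
  qed (auto simp: free_carrier_iff a_ac)
next
  fix a x assume a: "a \<in> carrier R" and x: "x \<in> carrier (free_module R B)"
  have "finite {b. a \<otimes> x b \<noteq> \<zero>}"
    by (rule finite_subset[of _ "{b. x b \<noteq> \<zero>}"]) (use x a in \<open>auto simp: free_carrier_iff\<close>)
  then show "a \<odot>\<^bsub>free_module R B\<^esub> x \<in> carrier (free_module R B)"
    using a x by (simp add: free_carrier_iff) (metis r_null)
qed (auto simp: free_carrier_iff l_distr r_distr m_assoc)

lemma free_neg [simp]:
  assumes "h \<in> carrier (free_module R B)"
  shows "\<ominus>\<^bsub>free_module R B\<^esub> h = (\<lambda>b. \<ominus> h b)"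
proof -
  interpret F: module R "free_module R B" by (rule module_free_module)
  show ?thesis using assms F.neg_conv_smult[of h]
    by (auto simp: fun_eq_iff free_carrier_iff l_minus)
qed

lemma free_minus [simp]:
  assumes "g \<in> carrier (free_module R B)" "h \<in> carrier (free_module R B)"
  shows "g \<ominus>\<^bsub>free_module R B\<^esub> h = (\<lambda>b. g b \<ominus> h b)"
  using assms by (simp add: a_minus_def)

lemma delta_carrier [simp]: "b \<in> B \<Longrightarrow> delta R b \<in> carrier (free_module R B)"
  by (auto simp: free_carrier_iff delta_def intro: finite_subset[of _ "{b}"])

lemma free_sub_module:
  assumes "E \<subseteq> B"
  shows "submodule (carrier (free_module R E)) R (free_module R B)"
proof -
  interpret F: module R "free_module R B" by (rule module_free_module)
  interpret E: module R "free_module R E" by (rule module_free_module)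
  show ?thesis
    by (rule F.submodule_test)
      (use assms E.M.a_closed E.smult_closed E.M.zero_closed in \<open>auto intro: free_carrier_mono\<close>)
qed

lemma eval_hom: "(\<lambda>h. h c) \<in> mod_hom R (free_module R B) (ring_module R)"
  by (auto intro!: mod_homI simp: free_carrier_iff)

end

section \<open>Linear extension\<close>

context module begin

lemma lin_ext_cong:
  assumes "h \<in> carrier (free_module R B)" "\<phi> \<in> B \<rightarrow> carrier M" "\<And>b. b \<in> B \<Longrightarrow> \<phi> b = \<psi> b"
  shows "lin_ext R M \<phi> h = lin_ext R M \<psi> h"
  unfolding lin_ext_def
  by (rule M.finsum_cong') (use assms in \<open>auto simp: free_carrier_iff Pi_def\<close>)

lemma lin_ext_superset:
  assumes "h \<in> carrier (free_module R B)" "\<phi> \<in> B \<rightarrow> carrier M"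
    and "finite S" "{b. h b \<noteq> \<zero>} \<subseteq> S" "S \<subseteq> B"
  shows "lin_ext R M \<phi> h = (\<Oplus>\<^bsub>M\<^esub>b\<in>S. h b \<odot>\<^bsub>M\<^esub> \<phi> b)"
  unfolding lin_ext_def
proof (rule M.add.finprod_mono_neutral_cong_left)
  show "h i \<odot>\<^bsub>M\<^esub> \<phi> i = \<zero>\<^bsub>M\<^esub>" if "i \<in> S - {b. h b \<noteq> \<zero>}" for i
    using assms that by (auto simp: Pi_def)
  show "(\<lambda>x. h x \<odot>\<^bsub>M\<^esub> \<phi> x) \<in> S \<rightarrow> carrier M"
    using assms by (auto simp: free_carrier_iff Pi_def)
qed (use assms in auto)

lemma lin_ext_submodule:
  assumes "h \<in> carrier (free_module R B)" "\<phi> \<in> B \<rightarrow> A" "submodule A R M"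
  shows "lin_ext R M \<phi> h \<in> A"
  unfolding lin_ext_def
  by (rule submodule_finsum[OF assms(3)])
    (use assms in \<open>auto simp: free_carrier_iff Pi_def intro!: submodule_smult[OF assms(3)]\<close>)

lemma lin_ext_closed [intro]:
  "h \<in> carrier (free_module R B) \<Longrightarrow> \<phi> \<in> B \<rightarrow> carrier M \<Longrightarrow> lin_ext R M \<phi> h \<in> carrier M"
  by (rule lin_ext_submodule[OF _ _ carrier_is_submodule])

lemma lin_ext_hom:
  assumes \<phi>: "\<phi> \<in> B \<rightarrow> carrier M"
  shows "lin_ext R M \<phi> \<in> mod_hom R (free_module R B) M"
proof (rule mod_homI)
  interpret F: module R "free_module R B" by (rule module_free_module)
  fix g assume g: "g \<in> carrier (free_module R B)"
  then have gR: "g b \<in> carrier R" for b by (simp add: free_carrier_iff)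
  show "lin_ext R M \<phi> g \<in> carrier M" using g \<phi> by (rule lin_ext_closed)
  { fix h assume h: "h \<in> carrier (free_module R B)"
    then have hR: "h b \<in> carrier R" for b by (simp add: free_carrier_iff)
    let ?S = "{b. g b \<noteq> \<zero>} \<union> {b. h b \<noteq> \<zero>}"
    have S: "finite ?S" "?S \<subseteq> B" using g h by (auto simp: free_carrier_iff)
    have fc: "\<phi> b \<in> carrier M" if "b \<in> ?S" for b using S(2) \<phi> that by auto
    have gh: "g \<oplus>\<^bsub>free_module R B\<^esub> h \<in> carrier (free_module R B)" using g h by (rule F.M.a_closed)
    have "lin_ext R M \<phi> (g \<oplus>\<^bsub>free_module R B\<^esub> h) = (\<Oplus>\<^bsub>M\<^esub>b\<in>?S. (g b \<oplus> h b) \<odot>\<^bsub>M\<^esub> \<phi> b)"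
      by (subst lin_ext_superset[OF gh \<phi> S(1) _ S(2)]) auto
    also have "\<dots> = (\<Oplus>\<^bsub>M\<^esub>b\<in>?S. g b \<odot>\<^bsub>M\<^esub> \<phi> b \<oplus>\<^bsub>M\<^esub> h b \<odot>\<^bsub>M\<^esub> \<phi> b)"
      by (rule M.finsum_cong') (use fc gR hR in \<open>auto simp: smult_l_distr Pi_def\<close>)
    also have "\<dots> = (\<Oplus>\<^bsub>M\<^esub>b\<in>?S. g b \<odot>\<^bsub>M\<^esub> \<phi> b) \<oplus>\<^bsub>M\<^esub> (\<Oplus>\<^bsub>M\<^esub>b\<in>?S. h b \<odot>\<^bsub>M\<^esub> \<phi> b)"
      by (rule M.finsum_addf) (use fc gR hR in \<open>auto simp: Pi_def\<close>)
    also have "\<dots> = lin_ext R M \<phi> g \<oplus>\<^bsub>M\<^esub> lin_ext R M \<phi> h"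
      using lin_ext_superset[OF g \<phi> S(1) _ S(2)] lin_ext_superset[OF h \<phi> S(1) _ S(2)] by auto
    finally show "lin_ext R M \<phi> (g \<oplus>\<^bsub>free_module R B\<^esub> h) = lin_ext R M \<phi> g \<oplus>\<^bsub>M\<^esub> lin_ext R M \<phi> h" . }
  { fix r assume r: "r \<in> carrier R"
    let ?S = "{b. g b \<noteq> \<zero>}"
    have S: "finite ?S" "?S \<subseteq> B" using g by (auto simp: free_carrier_iff)
    have fc: "\<phi> b \<in> carrier M" if "b \<in> ?S" for b using S(2) \<phi> that by auto
    have rg: "r \<odot>\<^bsub>free_module R B\<^esub> g \<in> carrier (free_module R B)" using r g by (rule F.smult_closed)
    have "lin_ext R M \<phi> (r \<odot>\<^bsub>free_module R B\<^esub> g) = (\<Oplus>\<^bsub>M\<^esub>b\<in>?S. (r \<otimes> g b) \<odot>\<^bsub>M\<^esub> \<phi> b)"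
      by (subst lin_ext_superset[OF rg \<phi> S(1) _ S(2)]) (use r in auto)
    also have "\<dots> = (\<Oplus>\<^bsub>M\<^esub>b\<in>?S. r \<odot>\<^bsub>M\<^esub> (g b \<odot>\<^bsub>M\<^esub> \<phi> b))"
      by (rule M.finsum_cong') (use fc gR r in \<open>auto simp: smult_assoc1 Pi_def\<close>)
    also have "\<dots> = r \<odot>\<^bsub>M\<^esub> lin_ext R M \<phi> g"
      unfolding lin_ext_def by (rule finsum_smult_ldistr[symmetric]) (use S fc r gR in \<open>auto simp: Pi_def\<close>)
    finally show "lin_ext R M \<phi> (r \<odot>\<^bsub>free_module R B\<^esub> g) = r \<odot>\<^bsub>M\<^esub> lin_ext R M \<phi> g" . }
qed

lemmas lin_ext_zero = mod_hom_zero[OF module_free_module module_axioms lin_ext_hom, simplified]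
lemmas lin_ext_minus = mod_hom_minus[OF module_free_module module_axioms lin_ext_hom]

lemma lin_ext_delta:
  assumes "b \<in> B" "\<phi> \<in> B \<rightarrow> carrier M"
  shows "lin_ext R M \<phi> (delta R b) = \<phi> b"
proof -
  have "lin_ext R M \<phi> (delta R b) = (\<Oplus>\<^bsub>M\<^esub>c\<in>{b}. delta R b c \<odot>\<^bsub>M\<^esub> \<phi> c)"
    by (rule lin_ext_superset[OF delta_carrier[OF assms(1)] assms(2)])
      (use assms in \<open>auto simp: delta_def split: if_splits\<close>)
  also have "\<dots> = \<phi> b" using assms by (simp add: delta_def Pi_def)
  finally show ?thesis .
qed

lemma lin_ext_fun_smult:
  assumes "h \<in> carrier (free_module R B)" "\<phi> \<in> B \<rightarrow> carrier M" "r \<in> carrier R"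
  shows "lin_ext R M (\<lambda>b. r \<odot>\<^bsub>M\<^esub> \<phi> b) h = r \<odot>\<^bsub>M\<^esub> lin_ext R M \<phi> h"
proof -
  have c: "h b \<in> carrier R" "h b \<noteq> \<zero> \<Longrightarrow> \<phi> b \<in> carrier M" for b using assms by (auto simp: free_carrier_iff)
  have "r \<odot>\<^bsub>M\<^esub> lin_ext R M \<phi> h = (\<Oplus>\<^bsub>M\<^esub>b\<in>{b. h b \<noteq> \<zero>}. r \<odot>\<^bsub>M\<^esub> (h b \<odot>\<^bsub>M\<^esub> \<phi> b))"
    unfolding lin_ext_def by (rule finsum_smult_ldistr) (use assms c in \<open>auto simp: free_carrier_iff\<close>)
  also have "\<dots> = (\<Oplus>\<^bsub>M\<^esub>b\<in>{b. h b \<noteq> \<zero>}. h b \<odot>\<^bsub>M\<^esub> (r \<odot>\<^bsub>M\<^esub> \<phi> b))"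
    by (rule M.finsum_cong') (use assms c in \<open>auto simp: smult_assoc1[symmetric] R.m_comm\<close>)
  finally show ?thesis by (simp add: lin_ext_def)
qed

lemma lin_ext_fun_add:
  assumes "h \<in> carrier (free_module R B)" "\<phi> \<in> B \<rightarrow> carrier M" "\<psi> \<in> B \<rightarrow> carrier M"
  shows "lin_ext R M (\<lambda>b. \<phi> b \<oplus>\<^bsub>M\<^esub> \<psi> b) h = lin_ext R M \<phi> h \<oplus>\<^bsub>M\<^esub> lin_ext R M \<psi> h"
proof -
  have c: "h b \<in> carrier R" "h b \<noteq> \<zero> \<Longrightarrow> \<phi> b \<in> carrier M" "h b \<noteq> \<zero> \<Longrightarrow> \<psi> b \<in> carrier M" for b
    using assms by (auto simp: free_carrier_iff)
  have "lin_ext R M (\<lambda>b. \<phi> b \<oplus>\<^bsub>M\<^esub> \<psi> b) h = (\<Oplus>\<^bsub>M\<^esub>b\<in>{b. h b \<noteq> \<zero>}. h b \<odot>\<^bsub>M\<^esub> \<phi> b \<oplus>\<^bsub>M\<^esub> h b \<odot>\<^bsub>M\<^esub> \<psi> b)"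
    unfolding lin_ext_def by (rule M.finsum_cong') (use c in \<open>auto simp: smult_r_distr\<close>)
  also have "\<dots> = lin_ext R M \<phi> h \<oplus>\<^bsub>M\<^esub> lin_ext R M \<psi> h"
    unfolding lin_ext_def by (rule M.finsum_addf) (use c in auto)
  finally show ?thesis .
qed

lemma lin_ext_fun_minus:
  assumes "h \<in> carrier (free_module R B)" "\<phi> \<in> B \<rightarrow> carrier M" "\<psi> \<in> B \<rightarrow> carrier M"
  shows "lin_ext R M (\<lambda>b. \<phi> b \<ominus>\<^bsub>M\<^esub> \<psi> b) h = lin_ext R M \<phi> h \<ominus>\<^bsub>M\<^esub> lin_ext R M \<psi> h"
proof -
  have c: "(\<lambda>b. (\<ominus> \<one>) \<odot>\<^bsub>M\<^esub> \<psi> b) \<in> B \<rightarrow> carrier M" "lin_ext R M \<psi> h \<in> carrier M"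
    using assms by auto
  have "lin_ext R M (\<lambda>b. \<phi> b \<ominus>\<^bsub>M\<^esub> \<psi> b) h = lin_ext R M (\<lambda>b. \<phi> b \<oplus>\<^bsub>M\<^esub> (\<ominus> \<one>) \<odot>\<^bsub>M\<^esub> \<psi> b) h"
    by (rule lin_ext_cong[OF assms(1)]) (use assms in \<open>auto simp: a_minus_def neg_conv_smult Pi_def\<close>)
  also have "\<dots> = lin_ext R M \<phi> h \<ominus>\<^bsub>M\<^esub> lin_ext R M \<psi> h"
    using lin_ext_fun_add[OF assms(1,2) c(1)] lin_ext_fun_smult[OF assms(1,3), of "\<ominus> \<one>"] c(2)
    by (simp add: a_minus_def neg_conv_smult)
  finally show ?thesis .
qed

text \<open>Most computations below are instances: for a differential, a chain map or an evaluation \<open>L\<close>, it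
suffices to know the values of \<open>L\<close> on the images of the basis.\<close>

lemma hom_lin_ext:
  assumes "module R N" "L \<in> mod_hom R N M" "\<phi> \<in> B \<rightarrow> carrier N" "h \<in> carrier (free_module R B)"
  shows "L (lin_ext R N \<phi> h) = lin_ext R M (\<lambda>b. L (\<phi> b)) h"
proof -
  interpret N: module R N by fact
  have c: "h b \<in> carrier R" "h b \<noteq> \<zero> \<Longrightarrow> \<phi> b \<in> carrier N" for b using assms by (auto simp: free_carrier_iff)
  have "L (lin_ext R N \<phi> h) = (\<Oplus>\<^bsub>M\<^esub>b\<in>{b. h b \<noteq> \<zero>}. L (h b \<odot>\<^bsub>N\<^esub> \<phi> b))"
    unfolding lin_ext_def by (rule mod_hom_finsum[OF assms(1) module_axioms assms(2)]) (use c in auto)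
  also have "\<dots> = lin_ext R M (\<lambda>b. L (\<phi> b)) h"
    unfolding lin_ext_def by (rule M.finsum_cong') (use c mod_homD[OF assms(2)] in auto)
  finally show ?thesis .
qed

end

context cring begin

lemma lin_ext_free_eval:
  assumes "g \<in> B \<rightarrow> carrier (free_module R C)" "h \<in> carrier (free_module R B)"
  shows "lin_ext R (free_module R C) g h c = lin_ext R (ring_module R) (\<lambda>b. g b c) h"
  using module.hom_lin_ext[OF module_ring_module module_free_module eval_hom assms] .

text \<open>Differentials and push-forwards are computed in the free module on a whole type. Comparing the
values at each basis element shows that the sum may equally be formed in a free module on a subset,
where the homomorphism lemmas apply.\<close>

lemma lin_ext_free_UNIV:
  assumes "g \<in> B \<rightarrow> carrier (free_module R C)" "h \<in> carrier (free_module R B)"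
  shows "lin_ext R (free_module R UNIV) g h = lin_ext R (free_module R C) g h"
proof
  fix c
  have "g \<in> B \<rightarrow> carrier (free_module R UNIV)" using assms(1) by (auto intro: free_carrier_mono[of C UNIV])
  then show "lin_ext R (free_module R UNIV) g h c = lin_ext R (free_module R C) g h c"
    by (simp add: lin_ext_free_eval[OF _ assms(2)] assms(1))
qed

lemma lin_ext_free_closed:
  assumes "g \<in> B \<rightarrow> carrier (free_module R C)" "h \<in> carrier (free_module R B)"
  shows "lin_ext R (free_module R UNIV) g h \<in> carrier (free_module R C)"
  unfolding lin_ext_free_UNIV[OF assms]
  using module.lin_ext_closed[OF module_free_module assms(2,1)] .

lemma lin_ext_free_hom:
  assumes "g \<in> B \<rightarrow> carrier (free_module R C)"
  shows "lin_ext R (free_module R UNIV) g \<in> mod_hom R (free_module R B) (free_module R C)"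
  by (rule mod_hom_cong[OF module.lin_ext_hom[OF module_free_module assms] _ module_free_module])
    (rule lin_ext_free_UNIV[OF assms, symmetric])

lemma lin_ext_delta_id:
  assumes "h \<in> carrier (free_module R B)"
  shows "lin_ext R (free_module R UNIV) (delta R) h = h"
proof
  interpret RM: module R "ring_module R" by (rule module_ring_module)
  fix c
  have hc: "h b \<in> carrier R" for b using assms by (simp add: free_carrier_iff)
  let ?S = "insert c {b. h b \<noteq> \<zero>}"
  have fin: "finite ?S" using assms by (simp add: free_carrier_iff)
  have h: "h \<in> carrier (free_module R UNIV)" using assms by (auto intro: free_carrier_mono)
  have d: "delta R \<in> UNIV \<rightarrow> carrier (free_module R UNIV)" by auto
  have "lin_ext R (free_module R UNIV) (delta R) h c = lin_ext R (ring_module R) (\<lambda>b. delta R b c) h"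
    by (rule lin_ext_free_eval[OF d h])
  also have "\<dots> = (\<Oplus>\<^bsub>ring_module R\<^esub>b\<in>?S. h b \<odot>\<^bsub>ring_module R\<^esub> delta R b c)"
    by (rule RM.lin_ext_superset[OF h]) (use fin in \<open>auto simp: delta_def\<close>)
  also have "\<dots> = (\<Oplus>\<^bsub>ring_module R\<^esub>b\<in>?S. if c = b then h b else \<zero>\<^bsub>ring_module R\<^esub>)"
    by (rule RM.M.finsum_cong') (use hc in \<open>auto simp: delta_def\<close>)
  also have "\<dots> = h c"
    by (rule RM.M.add.finprod_singleton[of c ?S, simplified]) (use fin hc in auto)
  finally show "lin_ext R (free_module R UNIV) (delta R) h c = h c" .
qed

lemma free_module_span:
  "carrier (free_module R B) = mspan R (free_module R UNIV) (delta R ` B)"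
proof -
  interpret F: module R "free_module R UNIV" by (rule module_free_module)
  show ?thesis
  proof
    show "mspan R (free_module R UNIV) (delta R ` B) \<subseteq> carrier (free_module R B)"
      by (rule F.mspan_least[OF free_sub_module]) auto
    show "carrier (free_module R B) \<subseteq> mspan R (free_module R UNIV) (delta R ` B)"
    proof
      fix h assume h: "h \<in> carrier (free_module R B)"
      have "lin_ext R (free_module R UNIV) (delta R) h \<in> mspan R (free_module R UNIV) (delta R ` B)"
        by (rule F.lin_ext_submodule[OF h]) (auto intro: mspan.intros F.mspan_submodule)
      then show "h \<in> mspan R (free_module R UNIV) (delta R ` B)" by (simp add: lin_ext_delta_id[OF h])
    qed
  qed
qed

end

context module begin

lemma hom_free_expand:
  assumes "L \<in> mod_hom R (free_module R B) M" "h \<in> carrier (free_module R B)"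
  shows "L h = lin_ext R M (\<lambda>b. L (delta R b)) h"
proof -
  have d: "delta R \<in> B \<rightarrow> carrier (free_module R B)" by auto
  show ?thesis
    using hom_lin_ext[OF module_free_module assms(1) d assms(2)]
      lin_ext_delta_id[OF assms(2)] lin_ext_free_UNIV[OF d assms(2)] by simp
qed

lemma lin_ext_comp:
  assumes "\<phi> \<in> C \<rightarrow> carrier M" "g \<in> B \<rightarrow> carrier (free_module R C)" "h \<in> carrier (free_module R B)"
  shows "lin_ext R M \<phi> (lin_ext R (free_module R UNIV) g h) = lin_ext R M (\<lambda>b. lin_ext R M \<phi> (g b)) h"
  unfolding lin_ext_free_UNIV[OF assms(2,3)]
  by (rule hom_lin_ext[OF module_free_module lin_ext_hom[OF assms(1)] assms(2,3)])

end

section \<open>Noetherian rings and the Artin-Rees property\<close>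

text \<open>The product \<open>JW\<close>. The set \<open>J\<close> of scalars may be arbitrary, so that \<open>J\<close> can also be a finite
generating set of an ideal.\<close>

definition imul :: "('r, 'c) ring_scheme \<Rightarrow> ('r, 'm, 'd) module_scheme \<Rightarrow> 'r set \<Rightarrow> 'm set \<Rightarrow> 'm set"
  where "imul R M J W = mspan R M {a \<odot>\<^bsub>M\<^esub> w | a w. a \<in> J \<and> w \<in> W}"

lemma imul_base: "a \<in> J \<Longrightarrow> w \<in> W \<Longrightarrow> a \<odot>\<^bsub>M\<^esub> w \<in> imul R M J W"
  unfolding imul_def by (rule mspan_base) blast

lemma imul_mono: "J \<subseteq> J' \<Longrightarrow> W \<subseteq> W' \<Longrightarrow> imul R M J W \<subseteq> imul R M J' W'"
  unfolding imul_def by (rule mspan_mono) blast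

context module begin

lemma imul_submodule: "J \<subseteq> carrier R \<Longrightarrow> W \<subseteq> carrier M \<Longrightarrow> submodule (imul R M J W) R M"
  unfolding imul_def by (rule mspan_submodule) auto

lemma imul_least:
  assumes "submodule A R M" "\<And>a w. a \<in> J \<Longrightarrow> w \<in> W \<Longrightarrow> a \<odot>\<^bsub>M\<^esub> w \<in> A"
  shows "imul R M J W \<subseteq> A"
  unfolding imul_def by (rule mspan_least[OF assms(1)]) (use assms(2) in auto)

lemma imul_subset:
  assumes "submodule A R M" "J \<subseteq> carrier R"
  shows "imul R M J A \<subseteq> A"
  by (rule imul_least[OF assms(1)]) (use assms submodule_smult in auto)

end

lemma mod_hom_image_imul:
  assumes "module R N" "module R M" "L \<in> mod_hom R N M" "W \<subseteq> carrier N" "J \<subseteq> carrier R"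
  shows "L ` imul R N J W = imul R M J (L ` W)"
proof -
  interpret N: module R N by fact
  have "L ` {a \<odot>\<^bsub>N\<^esub> w | a w. a \<in> J \<and> w \<in> W} = {a \<odot>\<^bsub>M\<^esub> w | a w. a \<in> J \<and> w \<in> L ` W}"
  proof (intro equalityI subsetI)
    fix x assume "x \<in> L ` {a \<odot>\<^bsub>N\<^esub> w | a w. a \<in> J \<and> w \<in> W}"
    then obtain a w where "a \<in> J" "w \<in> W" "x = L (a \<odot>\<^bsub>N\<^esub> w)" by auto
    moreover then have "x = a \<odot>\<^bsub>M\<^esub> L w" using mod_homD(3)[OF assms(3), of a w] assms(4,5) by auto
    ultimately show "x \<in> {a \<odot>\<^bsub>M\<^esub> w | a w. a \<in> J \<and> w \<in> L ` W}" by blast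
  next
    fix x assume "x \<in> {a \<odot>\<^bsub>M\<^esub> w | a w. a \<in> J \<and> w \<in> L ` W}"
    then obtain a w where aw: "a \<in> J" "w \<in> W" "x = a \<odot>\<^bsub>M\<^esub> L w" by blast
    then have "a \<in> carrier R" "w \<in> carrier N" using assms(4,5) by auto
    then have xL: "x = L (a \<odot>\<^bsub>N\<^esub> w)" using mod_homD(3)[OF assms(3), of a w] aw(3) by simp
    have "a \<odot>\<^bsub>N\<^esub> w \<in> {a \<odot>\<^bsub>N\<^esub> w | a w. a \<in> J \<and> w \<in> W}" using aw(1,2) by blast
    then show "x \<in> L ` {a \<odot>\<^bsub>N\<^esub> w | a w. a \<in> J \<and> w \<in> W}" unfolding xL by (rule imageI)
  qed
  moreover have "{a \<odot>\<^bsub>N\<^esub> w | a w. a \<in> J \<and> w \<in> W} \<subseteq> carrier N" using assms(4,5) by auto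
  ultimately show ?thesis
    unfolding imul_def by (simp only: mod_hom_image_mspan[OF assms(1-3)])
qed

subsection \<open>Powers of ideals\<close>

abbreviation ipow :: "('r, 'c) ring_scheme \<Rightarrow> 'r set \<Rightarrow> nat \<Rightarrow> 'r set"
  where "ipow R J n \<equiv> J [^]\<^bsub>ideals_set R\<^esub> n"

lemma ideals_set_simps [simp]:
  "one (ideals_set R) = carrier R" "monoid.mult (ideals_set R) = ideal_prod R"
  by (simp_all add: ideals_set_def)

lemma ipow_0 [simp]: "ipow R J 0 = carrier R"
  by (simp add: nat_pow_def ideals_set_def)

lemma ipow_Suc: "ipow R J (Suc n) = ideal_prod R (ipow R J n) J"
  by (simp add: nat_pow_def ideals_set_def)

context cring begin

lemma ipow_ideal: "ideal J R \<Longrightarrow> ideal (ipow R J n) R"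
  by (induction n) (auto simp: ipow_Suc oneideal ideal_prod_is_ideal)

lemma ipow_add: "ideal J R \<Longrightarrow> ipow R J (m + n) = ideal_prod R (ipow R J m) (ipow R J n)"
  using comm_monoid.axioms(1)[OF ideals_set_is_comm_monoid]
    monoid.nat_pow_mult[of "ideals_set R" J m n]
  by (simp add: ideals_set_def)

lemma ipow_pow: "ideal J R \<Longrightarrow> x \<in> J \<Longrightarrow> x [^] n \<in> ipow R J n"
proof (induction n)
  case 0
  then show ?case by (simp add: nat_pow_def ideals_set_def)
next
  case (Suc n)
  then show ?case unfolding ipow_Suc by (auto intro: ideal_prod.prod)
qed

lemma ipow_decreasing: "ideal J R \<Longrightarrow> m \<le> n \<Longrightarrow> ipow R J n \<subseteq> ipow R J m"
  using ipow_add[of J m "n - m"] ideal_prod_inter[OF ipow_ideal ipow_ideal, of J J m "n - m"] by auto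

lemma ipow_subset: "ideal J R \<Longrightarrow> 1 \<le> n \<Longrightarrow> ipow R J n \<subseteq> J"
  using ipow_decreasing[of J 1 n] ideal_prod_inter[of "carrier R" J] oneideal
  by auto

end

subsection \<open>Noetherian induction and finite generation\<close>

context noetherian_ring begin

lemma ideal_noetherian_induct [consumes 1, case_names step]:
  assumes "ideal I R"
    and step: "\<And>I. ideal I R \<Longrightarrow> (\<And>J. ideal J R \<Longrightarrow> I \<subset> J \<Longrightarrow> P J) \<Longrightarrow> P I"
  shows "P I"
proof (rule ccontr)
  assume "\<not> P I"
  let ?S = "{J. ideal J R \<and> \<not> P J}"
  have "\<exists>J\<in>?S. \<forall>X\<in>?S. J \<subseteq> X \<longrightarrow> X = J"
  proof (rule subset_Zorn_nonempty)
    show "?S \<noteq> {}" using \<open>\<not> P I\<close> assms(1) by auto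
    fix C assume C: "C \<noteq> {}" "subset.chain ?S C"
    then have "subset.chain {I. ideal I R} C" by (auto simp: pred_on.chain_def)
    then have "\<Union>C \<in> C" using ideal_chain_is_trivial C by blast
    then show "\<Union>C \<in> ?S" using C by (auto simp: pred_on.chain_def)
  qed
  then obtain J where "ideal J R" "\<not> P J" "\<And>X. ideal X R \<Longrightarrow> \<not> P X \<Longrightarrow> J \<subseteq> X \<Longrightarrow> X = J" by auto
  then show False using step by blast
qed

lemma maximal_ideal_in_family:
  assumes "I \<in> S" "\<And>J. J \<in> S \<Longrightarrow> ideal J R"
  obtains J where "J \<in> S" "\<And>X. X \<in> S \<Longrightarrow> J \<subseteq> X \<Longrightarrow> X = J"
proof -
  have "ideal I R \<Longrightarrow> I \<in> S \<Longrightarrow> \<exists>J\<in>S. \<forall>X\<in>S. J \<subseteq> X \<longrightarrow> X = J"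
  proof (induction rule: ideal_noetherian_induct)
    case (step I)
    show ?case
    proof (cases "\<exists>X\<in>S. I \<subset> X")
      case True
      then show ?thesis using step assms(2) by blast
    next
      case False
      then show ?thesis using step(3) by blast
    qed
  qed
  then show thesis using assms that by blast
qed

end

locale noetherian_cring = cring + noetherian_ring

context noetherian_cring begin

text \<open>Noetherian induction on \<open>I\<close>. If \<open>x \<in> J\<close> is not in \<open>I\<close>, then both \<open>(I : x)\<close> and \<open>I + xR\<close> are strictly
larger than \<open>I\<close>, the former because it contains the last power of \<open>x\<close> outside \<open>I\<close>. Each of them contains
a power of \<open>J\<close>, and \<open>(I : x) (I + xR) \<subseteq> I\<close>.\<close>

lemma power_subset_of_radical:
  assumes "ideal I R" "ideal J R" "\<And>x. x \<in> J \<Longrightarrow> \<exists>m::nat. x [^] m \<in> I"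
  shows "\<exists>c. ipow R J c \<subseteq> I"
  using assms(1,3)
proof (induction rule: ideal_noetherian_induct)
  case (step I)
  interpret RM: module R "ring_module R" by (rule module_ring_module)
  interpret I: ideal I R by fact
  have J: "x \<in> J \<Longrightarrow> x \<in> carrier R" for x using ideal.Icarr[OF assms(2)] .
  show ?case
  proof (cases "J \<subseteq> I")
    case True
    then show ?thesis using ipow_subset[OF assms(2), of 1] by (intro exI[of _ 1]) auto
  next
    case False
    then obtain x where x: "x \<in> J" "x \<notin> I" by auto
    then have xR: "x \<in> carrier R" using J by auto
    define m where "m = (LEAST m::nat. x [^] m \<in> I)"
    have m: "x [^] m \<in> I" unfolding m_def using step.prems[OF x(1)] by (rule LeastI_ex)
    have "m \<noteq> 0"
    proof
      assume "m = 0"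
      then have "\<one> \<in> I" using m by simp
      then show False using x I.one_imp_carrier xR by auto
    qed
    then obtain k where k: "m = Suc k" by (cases m) auto
    \<comment> \<open>the power of \<open>x\<close> just below the least one in \<open>I\<close> separates \<open>I\<close> from \<open>(I : x)\<close>\<close>
    have xk: "x [^] k \<notin> I" using not_less_Least[of k "\<lambda>m. x [^] m \<in> I"] k m_def by auto
    define I1 where "I1 = {r \<in> carrier R. r \<otimes> x \<in> I}"
    define I2 where "I2 = mspan R (ring_module R) (insert x I)"
    have sub: "insert x I \<subseteq> carrier (ring_module R)" using xR I.Icarr by auto
    have I1: "ideal I1 R"
      unfolding ideal_iff_submodule I1_def
      by (rule RM.submodule_test) (use xR in \<open>auto simp: l_distr m_assoc I.I_l_closed I.zero_closed\<close>)
    have I2: "ideal I2 R"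
      unfolding ideal_iff_submodule I2_def by (rule RM.mspan_submodule[OF sub])
    have "I \<subset> I1"
      using xk m k xR I.Icarr I.I_r_closed by (auto simp: I1_def)
    moreover have "I \<subset> I2" using x by (auto simp: I2_def intro: mspan_base)
    ultimately obtain c1 c2 where c: "ipow R J c1 \<subseteq> I1" "ipow R J c2 \<subseteq> I2"
      using step.IH[OF I1] step.IH[OF I2] step.prems by (metis psubsetE subsetD)
    have "ipow R J (c1 + c2) \<subseteq> I"
      unfolding ipow_add[OF assms(2)]
    proof
      fix y assume "y \<in> ideal_prod R (ipow R J c1) (ipow R J c2)"
      then show "y \<in> I"
      proof (induction y rule: ideal_prod.induct)
        case (prod u v)
        then have u: "u \<in> carrier R" "u \<otimes> x \<in> I" using c by (auto simp: I1_def)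
        from prod c obtain s i where s: "s \<in> carrier R" "i \<in> I" "v = s \<otimes> x \<oplus> i"
          using RM.mspan_insertD[OF _ sub, of v] RM.mspan_idem[of I] step.hyps
          by (auto simp: I2_def ideal_iff_submodule)
        have "u \<otimes> v = s \<otimes> (u \<otimes> x) \<oplus> u \<otimes> i"
          using u s xR I.Icarr by (simp add: r_distr m_ac)
        then show ?case using u s by (simp add: I.I_l_closed)
      qed auto
    qed
    then show ?thesis by blast
  qed
qed

end

locale noetherian_module = module R M + noetherian_ring R
  for R (structure) and M (structure)

sublocale noetherian_module \<subseteq> noetherian_cring R ..

context noetherian_module begin

text \<open>Induction on the number of generators, as in Hilbert's basis theorem: the coefficients at the new
generator \<open>x\<close> of the elements of \<open>A\<close> form an ideal. Elements of \<open>A\<close> whose coefficients generate this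
ideal reduce any element of \<open>A\<close> to one that lies in the span of the old generators.\<close>

lemma submodule_finitely_generated:
  assumes "finite E" "E \<subseteq> carrier M" "submodule A R M" "A \<subseteq> mspan R M E"
  shows "\<exists>E'. finite E' \<and> E' \<subseteq> A \<and> A = mspan R M E'"
  using assms
proof (induction E arbitrary: A rule: finite_induct)
  case empty
  have "mspan R M {} \<subseteq> {\<zero>\<^bsub>M\<^esub>}" by (rule mspan_least[OF submodule_zero_set]) auto
  moreover have "\<zero>\<^bsub>M\<^esub> \<in> A" using submodule_zero[OF empty(2)] .
  ultimately have "A = mspan R M {}" using empty by (auto intro: mspan.intros)
  then show ?case by blast
next
  case (insert x F)
  interpret RM: module R "ring_module R" by (rule module_ring_module)
  have F: "F \<subseteq> carrier M" and x: "x \<in> carrier M" using insert by auto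
  have SF: "submodule (mspan R M F) R M" by (rule mspan_submodule[OF F])
  note A = insert.prems(2)
  have Fc: "y \<in> mspan R M F \<Longrightarrow> y \<in> carrier M" for y using submodule_sub[OF SF] .
  have Ac: "y \<in> A \<Longrightarrow> y \<in> carrier M" for y using submodule_sub[OF A] .
  define coef where "coef B = {r \<in> carrier R. \<exists>y\<in>mspan R M F. r \<odot>\<^bsub>M\<^esub> x \<oplus>\<^bsub>M\<^esub> y \<in> B}" for B
  have coef_ideal: "ideal (coef B) R" if B: "submodule B R M" for B
    unfolding ideal_iff_submodule
  proof (rule RM.submodule_test)
    show "coef B \<subseteq> carrier (ring_module R)" by (auto simp: coef_def)
    show "\<zero>\<^bsub>ring_module R\<^esub> \<in> coef B"
      using submodule_zero[OF B] submodule_zero[OF SF] x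
      by (auto simp: coef_def intro!: bexI[of _ "\<zero>\<^bsub>M\<^esub>"])
  next
    fix r s assume "r \<in> coef B" "s \<in> coef B"
    then obtain y z where *: "r \<in> carrier R" "s \<in> carrier R" "y \<in> mspan R M F" "z \<in> mspan R M F"
      "r \<odot>\<^bsub>M\<^esub> x \<oplus>\<^bsub>M\<^esub> y \<in> B" "s \<odot>\<^bsub>M\<^esub> x \<oplus>\<^bsub>M\<^esub> z \<in> B" by (auto simp: coef_def)
    have "(r \<oplus> s) \<odot>\<^bsub>M\<^esub> x \<oplus>\<^bsub>M\<^esub> (y \<oplus>\<^bsub>M\<^esub> z) = (r \<odot>\<^bsub>M\<^esub> x \<oplus>\<^bsub>M\<^esub> y) \<oplus>\<^bsub>M\<^esub> (s \<odot>\<^bsub>M\<^esub> x \<oplus>\<^bsub>M\<^esub> z)"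
      using * x Fc by (simp add: smult_l_distr M.a_ac)
    then have "(r \<oplus> s) \<odot>\<^bsub>M\<^esub> x \<oplus>\<^bsub>M\<^esub> (y \<oplus>\<^bsub>M\<^esub> z) \<in> B" using submodule_add[OF B *(5,6)] by simp
    then show "r \<oplus>\<^bsub>ring_module R\<^esub> s \<in> coef B"
      using * by (auto simp: coef_def intro!: bexI[of _ "y \<oplus>\<^bsub>M\<^esub> z"] mspan_add)
  next
    fix t r assume t: "t \<in> carrier R" and "r \<in> coef B"
    then obtain y where *: "r \<in> carrier R" "y \<in> mspan R M F" "r \<odot>\<^bsub>M\<^esub> x \<oplus>\<^bsub>M\<^esub> y \<in> B" by (auto simp: coef_def)
    have "(t \<otimes> r) \<odot>\<^bsub>M\<^esub> x \<oplus>\<^bsub>M\<^esub> t \<odot>\<^bsub>M\<^esub> y = t \<odot>\<^bsub>M\<^esub> (r \<odot>\<^bsub>M\<^esub> x \<oplus>\<^bsub>M\<^esub> y)"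
      using * x t Fc by (simp add: smult_r_distr smult_assoc1)
    then have "(t \<otimes> r) \<odot>\<^bsub>M\<^esub> x \<oplus>\<^bsub>M\<^esub> t \<odot>\<^bsub>M\<^esub> y \<in> B" using submodule_smult[OF B t *(3)] by simp
    then show "t \<odot>\<^bsub>ring_module R\<^esub> r \<in> coef B"
      using * t by (auto simp: coef_def intro!: bexI[of _ "t \<odot>\<^bsub>M\<^esub> y"] mspan_smult)
  qed
  obtain G where G: "G \<subseteq> carrier R" "finite G" "coef A = Idl G"
    using finetely_gen[OF coef_ideal[OF A]] by blast
  have "G \<subseteq> coef A" using G genideal_self by auto
  then have "\<forall>g\<in>G. \<exists>y. y \<in> mspan R M F \<and> g \<odot>\<^bsub>M\<^esub> x \<oplus>\<^bsub>M\<^esub> y \<in> A" by (auto simp: coef_def)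
  then obtain y where y: "\<And>g. g \<in> G \<Longrightarrow> y g \<in> mspan R M F" "\<And>g. g \<in> G \<Longrightarrow> g \<odot>\<^bsub>M\<^esub> x \<oplus>\<^bsub>M\<^esub> y g \<in> A"
    by metis
  \<comment> \<open>realize the generators of the ideal of coefficients by elements of \<open>A\<close>\<close>
  define W where "W = (\<lambda>g. g \<odot>\<^bsub>M\<^esub> x \<oplus>\<^bsub>M\<^esub> y g) ` G"
  have W: "W \<subseteq> A" "W \<subseteq> carrier M" using y Ac by (auto simp: W_def)
  note SW = mspan_submodule[OF W(2)]
  obtain E' where E': "finite E'" "E' \<subseteq> A \<inter> mspan R M F" "A \<inter> mspan R M F = mspan R M E'"
    using insert.IH[OF F submodule_inter[OF A SF]] by auto
  have "G \<subseteq> coef (mspan R M W)"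
  proof
    fix g assume g: "g \<in> G"
    then have "g \<odot>\<^bsub>M\<^esub> x \<oplus>\<^bsub>M\<^esub> y g \<in> mspan R M W" by (auto simp: W_def intro: mspan_base)
    then show "g \<in> coef (mspan R M W)" using g G(1) y(1)[OF g] by (auto simp: coef_def)
  qed
  then have JW: "coef A \<subseteq> coef (mspan R M W)"
    unfolding G(3) by (rule genideal_minimal[OF coef_ideal[OF SW]])
  have "A = mspan R M (W \<union> E')"
  proof
    show "mspan R M (W \<union> E') \<subseteq> A" by (rule mspan_least[OF A]) (use W E' in auto)
    show "A \<subseteq> mspan R M (W \<union> E')"
    proof
      fix a assume a: "a \<in> A"
      then obtain r u where ru: "r \<in> carrier R" "u \<in> mspan R M F" "a = r \<odot>\<^bsub>M\<^esub> x \<oplus>\<^bsub>M\<^esub> u"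
        using mspan_insertD[of a x F] insert.prems by blast
      then have "r \<in> coef A" using a by (auto simp: coef_def)
      then obtain v where v: "v \<in> mspan R M F" "r \<odot>\<^bsub>M\<^esub> x \<oplus>\<^bsub>M\<^esub> v \<in> mspan R M W" using JW by (auto simp: coef_def)
      define w where "w = r \<odot>\<^bsub>M\<^esub> x \<oplus>\<^bsub>M\<^esub> v"
      have wA: "w \<in> A" using v(2) mspan_least[OF A W(1)] by (auto simp: w_def)
      have "a \<ominus>\<^bsub>M\<^esub> w = u \<ominus>\<^bsub>M\<^esub> v"
        unfolding ru(3) w_def using ru v x Fc
        by (simp add: diff_cancel_left)
      then have "a \<ominus>\<^bsub>M\<^esub> w \<in> mspan R M E'"
        using submodule_minus[OF A a wA] submodule_minus[OF SF ru(2) v(1)] E' by auto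
      moreover have "a = w \<oplus>\<^bsub>M\<^esub> (a \<ominus>\<^bsub>M\<^esub> w)" using a wA Ac
        by (simp add: a_minus_def M.a_lcomm M.r_neg)
      ultimately show "a \<in> mspan R M (W \<union> E')"
        using v(2) mspan_mono[of W "W \<union> E'" R M] mspan_mono[of E' "W \<union> E'" R M]
        by (metis (no_types, lifting) Un_upper1 Un_upper2 mspan_add subsetD w_def)
    qed
  qed
  then show ?case using E' W G by (intro exI[of _ "W \<union> E'"]) (auto simp: W_def)
qed

text \<open>The submodules \<open>(L : x\<^sup>k)\<close> of a finitely generated module increase with \<open>k\<close>. Their union is
finitely generated, hence equal to one of them.\<close>

lemma power_torsion_bounded:
  assumes "finite E" "E \<subseteq> carrier M" "submodule L R M" "x \<in> carrier R"
  shows "\<exists>m::nat. \<forall>y\<in>mspan R M E. \<forall>k::nat. x [^] k \<odot>\<^bsub>M\<^esub> y \<in> L \<longrightarrow> x [^] m \<odot>\<^bsub>M\<^esub> y \<in> L"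
proof -
  let ?F = "mspan R M E"
  have F: "submodule ?F R M" by (rule mspan_submodule) fact
  define U where "U = {y \<in> ?F. \<exists>k::nat. x [^] k \<odot>\<^bsub>M\<^esub> y \<in> L}"
  have up: "x [^] n \<odot>\<^bsub>M\<^esub> y \<in> L" if "x [^] k \<odot>\<^bsub>M\<^esub> y \<in> L" "k \<le> n" "y \<in> carrier M" for k n :: nat and y
  proof -
    have "x [^] n \<odot>\<^bsub>M\<^esub> y = x [^] (n - k) \<odot>\<^bsub>M\<^esub> (x [^] k \<odot>\<^bsub>M\<^esub> y)"
      using that assms(4) by (simp add: smult_assoc1[symmetric] R.nat_pow_mult)
    then show ?thesis using submodule_smult[OF assms(3)] that assms(4) by simp
  qed
  have Uc: "y \<in> U \<Longrightarrow> y \<in> carrier M" for y using submodule_sub[OF F] by (auto simp: U_def)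
  have U: "submodule U R M"
  proof (rule submodule_test)
    show "U \<subseteq> carrier M" using Uc by auto
    show "\<zero>\<^bsub>M\<^esub> \<in> U" using submodule_zero[OF assms(3)] assms(4) by (auto simp: U_def intro: mspan.intros)
  next
    fix y z assume yz: "y \<in> U" "z \<in> U"
    then obtain k l :: nat where "x [^] k \<odot>\<^bsub>M\<^esub> y \<in> L" "x [^] l \<odot>\<^bsub>M\<^esub> z \<in> L" by (auto simp: U_def)
    then have "x [^] (max k l) \<odot>\<^bsub>M\<^esub> y \<in> L" "x [^] (max k l) \<odot>\<^bsub>M\<^esub> z \<in> L"
      using up[of k y "max k l"] up[of l z "max k l"] yz Uc by auto
    then have "x [^] (max k l) \<odot>\<^bsub>M\<^esub> (y \<oplus>\<^bsub>M\<^esub> z) \<in> L"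
      using yz Uc assms(4) submodule_add[OF assms(3)] by (simp add: smult_r_distr)
    then show "y \<oplus>\<^bsub>M\<^esub> z \<in> U" using yz by (auto simp: U_def intro: mspan.intros)
  next
    fix r y assume ry: "r \<in> carrier R" "y \<in> U"
    then obtain k :: nat where k: "x [^] k \<odot>\<^bsub>M\<^esub> y \<in> L" by (auto simp: U_def)
    have "x [^] k \<odot>\<^bsub>M\<^esub> (r \<odot>\<^bsub>M\<^esub> y) = r \<odot>\<^bsub>M\<^esub> (x [^] k \<odot>\<^bsub>M\<^esub> y)"
      using ry Uc assms(4) by (simp add: smult_assoc1[symmetric] R.m_comm)
    then have "x [^] k \<odot>\<^bsub>M\<^esub> (r \<odot>\<^bsub>M\<^esub> y) \<in> L" using submodule_smult[OF assms(3) ry(1) k] by simp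
    then show "r \<odot>\<^bsub>M\<^esub> y \<in> U" using ry by (auto simp: U_def intro: mspan.intros)
  qed
  obtain G where G: "finite G" "G \<subseteq> U" "U = mspan R M G"
    using submodule_finitely_generated[OF assms(1,2) U] by (auto simp: U_def)
  have "\<forall>g\<in>G. \<exists>k::nat. x [^] k \<odot>\<^bsub>M\<^esub> g \<in> L" using G(2) by (auto simp: U_def)
  then obtain k :: "_ \<Rightarrow> nat" where k: "\<And>g. g \<in> G \<Longrightarrow> x [^] k g \<odot>\<^bsub>M\<^esub> g \<in> L" by metis
  define m where "m = Max (insert 0 (k ` G))"
  have m: "x [^] m \<odot>\<^bsub>M\<^esub> g \<in> L" if "g \<in> G" for g
    by (rule up[OF k[OF that]]) (use that G Uc in \<open>auto simp: m_def\<close>)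
  define V where "V = {y \<in> carrier M. x [^] m \<odot>\<^bsub>M\<^esub> y \<in> L}"
  have xm: "x [^] m \<in> carrier R" using assms(4) by simp
  have V: "submodule V R M"
  proof (rule submodule_test)
    fix r y assume ry: "r \<in> carrier R" "y \<in> V"
    have "x [^] m \<odot>\<^bsub>M\<^esub> (r \<odot>\<^bsub>M\<^esub> y) = r \<odot>\<^bsub>M\<^esub> (x [^] m \<odot>\<^bsub>M\<^esub> y)"
      using ry xm by (simp add: V_def smult_assoc1[symmetric] R.m_comm)
    then show "r \<odot>\<^bsub>M\<^esub> y \<in> V" using ry submodule_smult[OF assms(3)] by (auto simp: V_def)
  qed (use xm submodule_zero[OF assms(3)] in
      \<open>auto simp: V_def smult_r_distr intro: submodule_add[OF assms(3)]\<close>)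
  have "U \<subseteq> V" unfolding G(3) by (rule mspan_least[OF V]) (use m G Uc in \<open>auto simp: V_def\<close>)
  then have "x [^] m \<odot>\<^bsub>M\<^esub> y \<in> L" if "y \<in> ?F" "x [^] k \<odot>\<^bsub>M\<^esub> y \<in> L" for y and k :: nat
    using that by (auto simp: U_def V_def)
  then show ?thesis by blast
qed

text \<open>Krull's argument. Let \<open>F\<close> be the span of \<open>E\<close>, and choose \<open>L \<subseteq> F\<close> maximal with \<open>L \<inter> K = J\<^sup>cK\<close>.
For \<open>x \<in> J\<close> let \<open>(L : x\<^sup>m)\<close> be the largest of the submodules \<open>(L : x\<^sup>k)\<close>. Then \<open>L + x\<^sup>mF\<close> still meets \<open>K\<close>
in \<open>J\<^sup>cK\<close>, so \<open>x\<^sup>mF \<subseteq> L\<close> by maximality. Hence some \<open>J\<^sup>nF\<close> lies in \<open>L\<close>, and \<open>K \<inter> J\<^sup>nF \<subseteq> K \<inter> L = J\<^sup>cK\<close>.\<close>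

theorem weak_artin_rees:
  assumes "finite E" "E \<subseteq> carrier M" "submodule K R M" "K \<subseteq> mspan R M E" "ideal J R"
  shows "\<exists>n. K \<inter> imul R M (ipow R J n) (mspan R M E) \<subseteq> imul R M (ipow R J c) K"
proof -
  let ?F = "mspan R M E" and ?K' = "imul R M (ipow R J c) K"
  have F: "submodule ?F R M" by (rule mspan_submodule) fact
  have Kc: "K \<subseteq> carrier M" using submodule_sub[OF assms(3)] by auto
  have Jc: "ideal (ipow R J n) R" for n by (rule ipow_ideal[OF assms(5)])
  have Jn: "ipow R J n \<subseteq> carrier R" for n using ideal.Icarr[OF Jc] by auto
  have K': "submodule ?K' R M" by (rule imul_submodule[OF Jn Kc])
  have K'K: "?K' \<subseteq> K" by (rule imul_subset[OF assms(3) Jn])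
  define S where "S = {L. submodule L R M \<and> L \<subseteq> ?F \<and> L \<inter> K = ?K'}"
  have "\<exists>L\<in>S. \<forall>X\<in>S. L \<subseteq> X \<longrightarrow> X = L"
  proof (rule subset_Zorn_nonempty)
    have "?K' \<in> S" using K' K'K assms(4) by (auto simp: S_def)
    then show "S \<noteq> {}" by auto
    fix C assume C: "C \<noteq> {}" "subset.chain S C"
    have CS: "L \<in> C \<Longrightarrow> L \<in> S" for L using C by (auto simp: pred_on.chain_def)
    have tot: "L \<subseteq> L' \<or> L' \<subseteq> L" if "L \<in> C" "L' \<in> C" for L L' using C that by (auto simp: pred_on.chain_def)
    have CM: "L \<in> C \<Longrightarrow> submodule L R M" for L using CS by (auto simp: S_def)
    have "submodule (\<Union>C) R M"
    proof (rule submodule_test)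
      show "\<Union>C \<subseteq> carrier M" using CM submodule_sub by blast
      show "\<zero>\<^bsub>M\<^esub> \<in> \<Union>C" using C(1) CM submodule_zero by blast
    next
      fix x y assume "x \<in> \<Union>C" "y \<in> \<Union>C"
      then obtain L L' where L: "L \<in> C" "L' \<in> C" "x \<in> L" "y \<in> L'" by auto
      then obtain Q where "Q \<in> C" "x \<in> Q" "y \<in> Q" using tot[OF L(1,2)] by blast
      then show "x \<oplus>\<^bsub>M\<^esub> y \<in> \<Union>C" using CM submodule_add by blast
    next
      fix r x assume "r \<in> carrier R" "x \<in> \<Union>C"
      then show "r \<odot>\<^bsub>M\<^esub> x \<in> \<Union>C" using CM submodule_smult by blast
    qed
    moreover have "\<Union>C \<subseteq> ?F" using CS by (auto simp: S_def)
    moreover have "\<Union>C \<inter> K = ?K'"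
    proof -
      have "\<Union>C \<inter> K = (\<Union>L\<in>C. L \<inter> K)" by blast
      also have "\<dots> = (\<Union>L\<in>C. ?K')" using CS by (intro SUP_cong) (auto simp: S_def)
      finally show ?thesis using C(1) by auto
    qed
    ultimately show "\<Union>C \<in> S" by (simp add: S_def)
  qed
  then obtain L where LS: "L \<in> S" and Lmax: "\<And>X. X \<in> S \<Longrightarrow> L \<subseteq> X \<Longrightarrow> X = L" by blast
  have L: "submodule L R M" "L \<subseteq> ?F" "L \<inter> K = ?K'" using LS by (auto simp: S_def)
  define I where "I = {r \<in> carrier R. \<forall>y\<in>?F. r \<odot>\<^bsub>M\<^esub> y \<in> L}"
  have Fc: "y \<in> ?F \<Longrightarrow> y \<in> carrier M" for y using submodule_sub[OF F] .
  interpret RM: module R "ring_module R" by (rule module_ring_module)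
  have I: "ideal I R"
    unfolding ideal_iff_submodule
    by (rule RM.submodule_test)
      (use Fc in \<open>auto simp: I_def smult_l_distr smult_assoc1 submodule_zero[OF L(1)]
        intro: submodule_add[OF L(1)] submodule_smult[OF L(1)]\<close>)
  have "\<exists>m::nat. x [^] m \<in> I" if x: "x \<in> J" for x
  proof -
    have xR: "x \<in> carrier R" using ideal.Icarr[OF assms(5) x] .
    obtain m :: nat where m: "\<And>y k::nat. y \<in> ?F \<Longrightarrow> x [^] k \<odot>\<^bsub>M\<^esub> y \<in> L \<Longrightarrow> x [^] m \<odot>\<^bsub>M\<^esub> y \<in> L"
      using power_torsion_bounded[OF assms(1,2) L(1) xR] by blast
    have xm: "x [^] m \<in> carrier R" "x [^] c \<in> carrier R" using xR by auto
    define X where "X = {l \<oplus>\<^bsub>M\<^esub> x [^] m \<odot>\<^bsub>M\<^esub> y | l y. l \<in> L \<and> y \<in> ?F}"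
    have Lc: "l \<in> L \<Longrightarrow> l \<in> carrier M" for l using submodule_sub[OF L(1)] .
    have X: "submodule X R M"
    proof (rule submodule_test)
      show "X \<subseteq> carrier M" using Lc Fc xm by (auto simp: X_def)
      show "\<zero>\<^bsub>M\<^esub> \<in> X" unfolding X_def
        using submodule_zero[OF L(1)] submodule_zero[OF F] xm by (auto intro!: exI[of _ "\<zero>\<^bsub>M\<^esub>"])
    next
      fix u v assume "u \<in> X" "v \<in> X"
      then obtain l y l' y' where *: "l \<in> L" "l' \<in> L" "y \<in> ?F" "y' \<in> ?F"
        "u = l \<oplus>\<^bsub>M\<^esub> x [^] m \<odot>\<^bsub>M\<^esub> y" "v = l' \<oplus>\<^bsub>M\<^esub> x [^] m \<odot>\<^bsub>M\<^esub> y'" by (auto simp: X_def)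
      then have "u \<oplus>\<^bsub>M\<^esub> v = (l \<oplus>\<^bsub>M\<^esub> l') \<oplus>\<^bsub>M\<^esub> x [^] m \<odot>\<^bsub>M\<^esub> (y \<oplus>\<^bsub>M\<^esub> y')"
        using Lc Fc xm by (simp add: smult_r_distr M.a_ac)
      then show "u \<oplus>\<^bsub>M\<^esub> v \<in> X" unfolding X_def
        using * submodule_add[OF L(1)] submodule_add[OF F] by blast
    next
      fix r u assume r: "r \<in> carrier R" "u \<in> X"
      then obtain l y where *: "l \<in> L" "y \<in> ?F" "u = l \<oplus>\<^bsub>M\<^esub> x [^] m \<odot>\<^bsub>M\<^esub> y" by (auto simp: X_def)
      then have "r \<odot>\<^bsub>M\<^esub> u = r \<odot>\<^bsub>M\<^esub> l \<oplus>\<^bsub>M\<^esub> x [^] m \<odot>\<^bsub>M\<^esub> (r \<odot>\<^bsub>M\<^esub> y)"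
        using Lc Fc xm r by (simp add: smult_r_distr smult_assoc1[symmetric] R.m_comm)
      then show "r \<odot>\<^bsub>M\<^esub> u \<in> X" unfolding X_def
        using * submodule_smult[OF L(1) r(1)] submodule_smult[OF F r(1)] by blast
    qed
    have LX: "L \<subseteq> X"
    proof
      fix l assume "l \<in> L"
      then show "l \<in> X" unfolding X_def using Lc xm submodule_zero[OF F]
        by (intro CollectI exI[of _ l] exI[of _ "\<zero>\<^bsub>M\<^esub>"]) auto
    qed
    have "X \<subseteq> ?F" using L(2) submodule_add[OF F] submodule_smult[OF F xm(1)] by (auto simp: X_def)
    \<comment> \<open>\<open>x\<^sup>c\<close> moves \<open>z \<in> K\<close> into \<open>L\<close>, so \<open>y \<in> (L : x\<^bsup>c+m\<^esup>)\<close>, which is \<open>(L : x\<^sup>m)\<close>\<close>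
    moreover have "X \<inter> K \<subseteq> ?K'"
    proof
      fix z assume z: "z \<in> X \<inter> K"
      then obtain l y where *: "l \<in> L" "y \<in> ?F" "z = l \<oplus>\<^bsub>M\<^esub> x [^] m \<odot>\<^bsub>M\<^esub> y" by (auto simp: X_def)
      have zc: "z \<in> carrier M" using z Kc by auto
      have "x [^] c \<odot>\<^bsub>M\<^esub> z \<in> ?K'" using ipow_pow[OF assms(5) x] z by (auto intro: imul_base)
      then have zL: "x [^] c \<odot>\<^bsub>M\<^esub> z \<in> L" using L(3) by auto
      have "x [^] c \<odot>\<^bsub>M\<^esub> z = x [^] c \<odot>\<^bsub>M\<^esub> l \<oplus>\<^bsub>M\<^esub> x [^] (c + m) \<odot>\<^bsub>M\<^esub> y"
        unfolding * using * Lc Fc xm xR by (simp add: smult_r_distr smult_assoc1[symmetric] R.nat_pow_mult)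
      then have "x [^] (c + m) \<odot>\<^bsub>M\<^esub> y = x [^] c \<odot>\<^bsub>M\<^esub> z \<ominus>\<^bsub>M\<^esub> x [^] c \<odot>\<^bsub>M\<^esub> l"
        using * Lc Fc xm xR by (simp add: diff_add_left)
      then have "x [^] (c + m) \<odot>\<^bsub>M\<^esub> y \<in> L"
        using submodule_minus[OF L(1) zL submodule_smult[OF L(1) xm(2) *(1)]] by simp
      then have "x [^] m \<odot>\<^bsub>M\<^esub> y \<in> L" using m *(2) by blast
      then have "z \<in> L" unfolding * using submodule_add[OF L(1) *(1)] by simp
      then show "z \<in> ?K'" using z L(3) by auto
    qed
    ultimately have "X \<in> S" using X LX L(3) by (auto simp: S_def)
    then have "X = L" using Lmax LX by auto
    have "x [^] m \<odot>\<^bsub>M\<^esub> y \<in> L" if y: "y \<in> ?F" for y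
    proof -
      have "\<zero>\<^bsub>M\<^esub> \<oplus>\<^bsub>M\<^esub> x [^] m \<odot>\<^bsub>M\<^esub> y \<in> X" unfolding X_def using y submodule_zero[OF L(1)] by blast
      then show ?thesis using \<open>X = L\<close> y Fc xm by simp
    qed
    then show ?thesis using xm by (intro exI[of _ m]) (auto simp: I_def)
  qed
  then obtain n where n: "ipow R J n \<subseteq> I" using power_subset_of_radical[OF I assms(5)] by blast
  have "imul R M (ipow R J n) ?F \<subseteq> L"
    by (rule imul_least[OF L(1)]) (use n in \<open>auto simp: I_def\<close>)
  then show ?thesis using L(3) by blast
qed

end

section \<open>The standard resolution\<close>

text \<open>The kernel of the differential or, in degree 0, of the augmentation. Its elements are
the boundaries of the basis elements one degree higher, so the resolution is exact by
construction.\<close>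

definition cycles ::
  "('r, 'c) ring_scheme \<Rightarrow> ('r, 'x, 'd) module_scheme \<Rightarrow> nat \<Rightarrow> (('r, 'x) syz \<Rightarrow> 'r) set"
  where "cycles R N k = {h \<in> carrier (free_module R (res_basis R N k)).
       if k = 0 then res_aug R N h = \<zero>\<^bsub>N\<^esub> else res_diff R h = (\<lambda>b. \<zero>\<^bsub>R\<^esub>)}"

lemma res_basis_0: "res_basis R N 0 = Gen ` carrier N"
  and res_basis_Suc: "res_basis R N (Suc k) = encode R ` cycles R N k"
  by (auto simp: cycles_def)

declare res_basis.simps [simp del]

lemma decode_encode:
  assumes "h \<in> carrier (free_module R B)"
  shows "decode R (encode R h) = h"
proof -
  have "finite ((\<lambda>b. (b, h b)) ` {b. h b \<noteq> \<zero>\<^bsub>R\<^esub>})" using assms by (simp add: free_carrier_iff)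
  moreover have "(\<lambda>b. (b, h b)) ` {b. h b \<noteq> \<zero>\<^bsub>R\<^esub>} = {(b, h b) | b. h b \<noteq> \<zero>\<^bsub>R\<^esub>}" by auto
  ultimately have "finite {(b, h b) | b. h b \<noteq> \<zero>\<^bsub>R\<^esub>}" by simp
  then have *: "fset (graph (encode R h)) = {(b, h b) | b. h b \<noteq> \<zero>\<^bsub>R\<^esub>}"
    by (simp add: encode_def Abs_fset_inverse)
  show ?thesis
  proof
    fix b
    show "decode R (encode R h) b = h b"
      unfolding decode_def * by (cases "h b = \<zero>\<^bsub>R\<^esub>") auto
  qed
qed

lemma cycles_carrier: "h \<in> cycles R N k \<Longrightarrow> h \<in> carrier (free_module R (res_basis R N k))"
  by (simp add: cycles_def)

lemma encode_basis: "z \<in> cycles R N k \<Longrightarrow> encode R z \<in> res_basis R N (Suc k)"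
  by (simp add: res_basis_Suc)

lemma decode_cycles: "s \<in> res_basis R N (Suc k) \<Longrightarrow> decode R s \<in> cycles R N k"
  unfolding res_basis_Suc by (auto simp: decode_encode[OF cycles_carrier])

lemma decode_carrier: "s \<in> res_basis R N (Suc k) \<Longrightarrow> decode R s \<in> carrier (free_module R (res_basis R N k))"
  by (rule cycles_carrier[OF decode_cycles])

context cring begin

lemma res_diff_hom:
  "res_diff R \<in> mod_hom R (free_module R (res_basis R N (Suc k))) (free_module R (res_basis R N k))"
  unfolding res_diff_def by (rule lin_ext_free_hom) (auto simp: decode_carrier)

lemma res_diff_closed:
  "h \<in> carrier (free_module R (res_basis R N (Suc k))) \<Longrightarrow> res_diff R h \<in> carrier (free_module R (res_basis R N k))"
  using mod_homD(1)[OF res_diff_hom] .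

lemma res_aug_hom:
  assumes "module R N"
  shows "res_aug R N \<in> mod_hom R (free_module R (res_basis R N 0)) N"
  unfolding res_aug_def by (rule module.lin_ext_hom[OF assms]) (auto simp: res_basis_0)

lemma cycles_submodule:
  assumes "module R N"
  shows "submodule (cycles R N k) R (free_module R UNIV)"
proof -
  interpret F: module R "free_module R UNIV :: ('a, ('a, 'c) syz \<Rightarrow> 'a) module" by (rule module_free_module)
  interpret N: module R N by fact
  let ?B = "free_module R (res_basis R N k)"
  interpret B: module R ?B by (rule module_free_module)
  note B = free_sub_module[of "res_basis R N k" UNIV, simplified]
  show ?thesis
  proof (cases k)
    case 0
    note aug = mod_homD[OF res_aug_hom[OF assms], simplified]
      mod_hom_zero[OF module_free_module assms res_aug_hom[OF assms], simplified]
    show ?thesis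
      by (rule F.submodule_test)
        (use 0 aug F.submodule_add[OF B] F.submodule_zero[OF B] F.submodule_smult[OF B] in
          \<open>auto simp: cycles_def free_carrier_iff[of _ _ UNIV] intro: free_carrier_mono\<close>)
  next
    case (Suc j)
    note d = mod_homD[OF res_diff_hom[of N j], simplified]
      mod_hom_zero[OF module_free_module module_free_module res_diff_hom[of N j], simplified]
    show ?thesis
      by (rule F.submodule_test)
        (use Suc d F.submodule_add[OF B] F.submodule_zero[OF B] F.submodule_smult[OF B] in
          \<open>auto simp: cycles_def intro: free_carrier_mono[of _ UNIV]\<close>)
  qed
qed

lemma res_diff_delta: "s \<in> res_basis R N (Suc k) \<Longrightarrow> res_diff R (delta R s) = decode R s"
  unfolding res_diff_def
  by (rule module.lin_ext_delta[OF module_free_module, of _ "res_basis R N (Suc k)"])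
    (auto intro: free_carrier_mono[of _ UNIV] decode_carrier)

lemma res_diff_delta_encode: "z \<in> cycles R N k \<Longrightarrow> res_diff R (delta R (encode R z)) = z"
  using res_diff_delta[OF encode_basis] decode_encode[OF cycles_carrier] by metis

end

section \<open>Cochains and chain maps\<close>

text \<open>The coboundary of a cochain, on basis elements. A homomorphism from a free module is
given by arbitrary values on the basis, so functions on \<open>res_basis R N k\<close> serve as cochains.\<close>

definition dif ::
  "('r, 'c) ring_scheme \<Rightarrow> ('r, 'm, 'e) module_scheme \<Rightarrow> (('r, 'x) syz \<Rightarrow> 'm) \<Rightarrow> ('r, 'x) syz \<Rightarrow> 'm"
  where "dif R M \<phi> s = lin_ext R M \<phi> (decode R s)"

text \<open>Cocycles with values in \<open>A/B\<close>, represented by functions with values in \<open>A\<close>.\<close>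

definition cocyc ::
  "('r, 'c) ring_scheme \<Rightarrow> ('r, 'm, 'e) module_scheme \<Rightarrow> ('r, 'x, 'd) module_scheme
    \<Rightarrow> 'm set \<Rightarrow> 'm set \<Rightarrow> nat \<Rightarrow> (('r, 'x) syz \<Rightarrow> 'm) set"
  where "cocyc R M N A B k =
    {\<phi> \<in> res_basis R N k \<rightarrow> A. \<forall>s\<in>res_basis R N (Suc k). dif R M \<phi> s \<in> B}"

text \<open>Coboundaries with values in \<open>A/B\<close>. In degree 0 these are the functions that vanish modulo \<open>B\<close>.\<close>

primrec cobd ::
  "('r, 'c) ring_scheme \<Rightarrow> ('r, 'm, 'e) module_scheme \<Rightarrow> ('r, 'x, 'd) module_scheme
    \<Rightarrow> 'm set \<Rightarrow> 'm set \<Rightarrow> nat \<Rightarrow> (('r, 'x) syz \<Rightarrow> 'm) set"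
  where "cobd R M N A B 0 = {\<phi>. \<forall>s\<in>res_basis R N 0. \<phi> s \<in> B}"
  | "cobd R M N A B (Suc k) = {\<phi>. \<exists>\<psi>\<in>res_basis R N k \<rightarrow> A.
       \<forall>s\<in>res_basis R N (Suc k). \<phi> s \<ominus>\<^bsub>M\<^esub> dif R M \<psi> s \<in> B}"

text \<open>A chain map over \<open>F\<close> in the degrees up to \<open>K\<close>, given on the bases. Truncated chain maps are needed
because the small chain maps below are constructed one degree at a time.\<close>

definition chain_map ::
  "('r, 'c) ring_scheme \<Rightarrow> ('r, 'x, 'd) module_scheme \<Rightarrow> ('r, 'y, 'e) module_scheme \<Rightarrow> ('x \<Rightarrow> 'y)
    \<Rightarrow> nat \<Rightarrow> (nat \<Rightarrow> ('r, 'x) syz \<Rightarrow> ('r, 'y) syz \<Rightarrow> 'r) \<Rightarrow> bool"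
  where "chain_map R N N' F K f \<longleftrightarrow>
    (\<forall>k\<le>K. f k \<in> res_basis R N k \<rightarrow> carrier (free_module R (res_basis R N' k))) \<and>
    (\<forall>s\<in>res_basis R N 0. res_aug R N' (f 0 s) = F (gen s)) \<and>
    (\<forall>k<K. \<forall>s\<in>res_basis R N (Suc k).
       res_diff R (f (Suc k) s) = lin_ext R (free_module R UNIV) (f k) (decode R s))"

lemma chain_mapD:
  assumes "chain_map R N N' F K f"
  shows "k \<le> K \<Longrightarrow> f k \<in> res_basis R N k \<rightarrow> carrier (free_module R (res_basis R N' k))"
    and "s \<in> res_basis R N 0 \<Longrightarrow> res_aug R N' (f 0 s) = F (gen s)"
    and "k < K \<Longrightarrow> s \<in> res_basis R N (Suc k) \<Longrightarrow>
      res_diff R (f (Suc k) s) = lin_ext R (free_module R UNIV) (f k) (decode R s)"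
  using assms by (auto simp: chain_map_def)

lemma chain_map_cong:
  assumes "chain_map R N N' F K f" "\<And>x. x \<in> carrier N \<Longrightarrow> F x = F' x"
  shows "chain_map R N N' F' K f"
  using assms by (auto simp: chain_map_def res_basis_0)

context cring begin

lemma chain_map_diff:
  assumes "chain_map R N N' F K f" "k < K" "h \<in> carrier (free_module R (res_basis R N (Suc k)))"
  shows "res_diff R (lin_ext R (free_module R UNIV) (f (Suc k)) h)
    = lin_ext R (free_module R UNIV) (f k) (res_diff R h)"
proof -
  let ?F = "free_module R UNIV"
  let ?N = "\<lambda>k. free_module R (res_basis R N k)" and ?N' = "\<lambda>k. free_module R (res_basis R N' k)"
  note f = chain_mapD[OF assms(1)]
  have fS: "f (Suc k) \<in> res_basis R N (Suc k) \<rightarrow> carrier (?N' (Suc k))"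
    and fk: "f k \<in> res_basis R N k \<rightarrow> carrier (?N' k)" using f(1) assms(2) by auto
  have fkU: "f k \<in> res_basis R N k \<rightarrow> carrier ?F" using fk by (auto intro: free_carrier_mono[of _ UNIV])
  have dec: "decode R \<in> res_basis R N (Suc k) \<rightarrow> carrier (?N k)" by (auto simp: decode_carrier)
  have "res_diff R (lin_ext R ?F (f (Suc k)) h)
    = lin_ext R (?N' k) (\<lambda>s. res_diff R (f (Suc k) s)) h"
    unfolding lin_ext_free_UNIV[OF fS assms(3)]
    by (rule module.hom_lin_ext[OF module_free_module module_free_module res_diff_hom fS assms(3)])
  also have "\<dots> = lin_ext R (?N' k) (\<lambda>s. lin_ext R ?F (f k) (decode R s)) h"
    by (rule module.lin_ext_cong[OF module_free_module assms(3)])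
      (use f(3) assms(2) fS in \<open>auto intro!: res_diff_closed\<close>)
  also have "\<dots> = lin_ext R ?F (\<lambda>s. lin_ext R ?F (f k) (decode R s)) h"
    by (rule lin_ext_free_UNIV[symmetric, OF _ assms(3)])
      (use lin_ext_free_closed[OF fk] dec in auto)
  also have "\<dots> = lin_ext R ?F (f k) (res_diff R h)"
    unfolding res_diff_def
    by (rule module.lin_ext_comp[symmetric, OF module_free_module fkU dec assms(3)])
  finally show ?thesis .
qed

lemma chain_map_closed:
  assumes "chain_map R N N' F K f" "k \<le> K" "h \<in> carrier (free_module R (res_basis R N k))"
  shows "lin_ext R (free_module R UNIV) (f k) h \<in> carrier (free_module R (res_basis R N' k))"
  by (rule lin_ext_free_closed[OF chain_mapD(1)[OF assms(1,2)] assms(3)])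

text \<open>In positive degrees this is compatibility with the differentials; in degree 0 it holds because the
chain map covers the homomorphism \<open>F\<close>.\<close>

lemma chain_map_cycles:
  assumes "module R N" "module R N'" "F \<in> mod_hom R N N'" "chain_map R N N' F K f" "k \<le> K" "z \<in> cycles R N k"
  shows "lin_ext R (free_module R UNIV) (f k) z \<in> cycles R N' k"
proof (cases k)
  case 0
  interpret N': module R N' by fact
  let ?B = "free_module R (res_basis R N 0)" and ?B' = "free_module R (res_basis R N' 0)"
  have z: "z \<in> carrier ?B" "res_aug R N z = \<zero>\<^bsub>N\<^esub>" using assms(6) 0 by (auto simp: cycles_def)
  have f: "f 0 \<in> res_basis R N 0 \<rightarrow> carrier ?B'" using chain_mapD(1)[OF assms(4)] by auto
  have gen: "gen \<in> res_basis R N 0 \<rightarrow> carrier N" by (auto simp: res_basis_0)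
  have "res_aug R N' (lin_ext R (free_module R UNIV) (f 0) z) = lin_ext R N' (\<lambda>s. res_aug R N' (f 0 s)) z"
    unfolding lin_ext_free_UNIV[OF f z(1)]
    by (rule N'.hom_lin_ext[OF module_free_module res_aug_hom[OF assms(2)] f z(1)])
  also have "\<dots> = lin_ext R N' (\<lambda>s. F (gen s)) z"
    by (rule N'.lin_ext_cong[OF z(1)])
      (use chain_mapD(2)[OF assms(4)] f mod_homD(1)[OF res_aug_hom[OF assms(2)]] in auto)
  also have "\<dots> = F (res_aug R N z)"
    unfolding res_aug_def by (rule N'.hom_lin_ext[OF assms(1,3) gen z(1), symmetric])
  also have "\<dots> = \<zero>\<^bsub>N'\<^esub>" unfolding z(2) by (rule mod_hom_zero[OF assms(1,2,3)])
  finally show ?thesis using chain_map_closed[OF assms(4,5)] z 0 by (simp add: cycles_def)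
next
  case (Suc j)
  have z: "z \<in> carrier (free_module R (res_basis R N (Suc j)))" "res_diff R z = (\<lambda>b. \<zero>)"
    using assms(6) Suc by (auto simp: cycles_def)
  have fj: "f j \<in> res_basis R N j \<rightarrow> carrier (free_module R UNIV)"
    using chain_mapD(1)[OF assms(4), of j] assms(5) Suc by (auto intro: free_carrier_mono[of _ UNIV])
  have "res_diff R (lin_ext R (free_module R UNIV) (f (Suc j)) z) = (\<lambda>b. \<zero>)"
    using chain_map_diff[OF assms(4) _ z(1)] assms(5) Suc
      module.lin_ext_zero[OF module_free_module fj]
    by (simp add: z(2))
  then show ?thesis using chain_map_closed[OF assms(4,5), of z] z Suc by (simp add: cycles_def)
qed

text \<open>The homotopy that contracts a chain map over the zero homomorphism. It needs no choices, as a
cycle is the boundary of the basis element that encodes it.\<close>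

primrec contraction ::
  "(nat \<Rightarrow> ('a, 'x) syz \<Rightarrow> ('a, 'y) syz \<Rightarrow> 'a) \<Rightarrow> nat \<Rightarrow> ('a, 'x) syz \<Rightarrow> ('a, 'y) syz \<Rightarrow> 'a"
  where "contraction d 0 = (\<lambda>s. delta R (encode R (d 0 s)))"
  | "contraction d (Suc k) = (\<lambda>s. delta R (encode R
       (d (Suc k) s \<ominus>\<^bsub>free_module R UNIV\<^esub> lin_ext R (free_module R UNIV) (contraction d k) (decode R s))))"

text \<open>By induction the element that is encoded is a cycle, so that the identity \<open>\<partial>h + h\<partial> = d\<close> holds in
the next degree.\<close>

lemma contraction_works:
  fixes N :: "('a, 'x, 'd) module_scheme" and N' :: "('a, 'y, 'e) module_scheme"
  assumes N: "module R N" and N': "module R N'" and d: "chain_map R N N' (\<lambda>x. \<zero>\<^bsub>N'\<^esub>) K d" and k: "k \<le> K"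
  shows "s \<in> res_basis R N k \<Longrightarrow>
     contraction d k s \<in> carrier (free_module R (res_basis R N' (Suc k))) \<and>
     res_diff R (contraction d k s) = (case k of 0 \<Rightarrow> d 0 s | Suc j \<Rightarrow>
       d k s \<ominus>\<^bsub>free_module R UNIV\<^esub> lin_ext R (free_module R UNIV) (contraction d j) (decode R s))"
  using k
proof (induction k arbitrary: s rule: less_induct)
  case (less k)
  show ?case
  proof (cases k)
    case 0
    have "d 0 s \<in> cycles R N' 0"
      using chain_mapD(1)[OF d, of 0] chain_mapD(2)[OF d, of s] less.prems 0 by (auto simp: cycles_def)
    then show ?thesis using 0 by (auto simp: res_diff_delta_encode encode_basis)
  next
    case (Suc j)
    let ?F = "free_module R UNIV :: ('a, ('a, 'y) syz \<Rightarrow> 'a) module"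
    interpret F: module R ?F by (rule module_free_module)
    let ?N = "\<lambda>k. free_module R (res_basis R N k)" and ?N' = "\<lambda>k. free_module R (res_basis R N' k)"
    interpret N'j: module R "?N' j" by (rule module_free_module)
    let ?z = "decode R s" and ?c = "contraction d"
    have U: "h \<in> carrier (?N' k) \<Longrightarrow> h \<in> carrier ?F" for h k by (auto intro: free_carrier_mono[of _ UNIV])
    have jK: "j < K" "j \<le> K" "k \<le> K" using Suc less.prems by auto
    have z: "?z \<in> cycles R N j" "?z \<in> carrier (?N j)" using less.prems Suc by (auto simp: decode_cycles decode_carrier)
    have c: "?c i \<in> res_basis R N i \<rightarrow> carrier (?N' (Suc i))" if "i \<le> j" for i
      using less.IH[of i] that Suc jK by auto
    have dj: "d j \<in> res_basis R N j \<rightarrow> carrier (?N' j)" using chain_mapD(1)[OF d] jK by auto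
    have cz: "lin_ext R ?F (?c j) ?z \<in> carrier (?N' k)" unfolding Suc by (rule lin_ext_free_closed[OF c[OF order_refl] z(2)])
    have ds: "d k s \<in> carrier (?N' k)" using chain_mapD(1)[OF d] jK less.prems by auto
    have "res_diff R (lin_ext R ?F (?c j) ?z) = lin_ext R (?N' j) (\<lambda>b. res_diff R (?c j b)) ?z"
      unfolding lin_ext_free_UNIV[OF c[OF order_refl] z(2)]
      by (rule N'j.hom_lin_ext[OF module_free_module res_diff_hom c[OF order_refl] z(2)])
    also have "\<dots> = lin_ext R ?F (\<lambda>b. res_diff R (?c j b)) ?z"
      by (rule lin_ext_free_UNIV[symmetric, OF _ z(2)]) (use c[OF order_refl] res_diff_closed in auto)
    also have "\<dots> = lin_ext R ?F (d j) ?z"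
    proof (cases j)
      case 0
      show ?thesis
      proof (rule F.lin_ext_cong[OF z(2)])
        show "(\<lambda>b. res_diff R (?c j b)) \<in> res_basis R N j \<rightarrow> carrier ?F"
          using c[OF order_refl] res_diff_closed U by blast
        show "res_diff R (?c j b) = d j b" if "b \<in> res_basis R N j" for b
          using less.IH[OF _ that] Suc jK 0 by simp
      qed
    next
      case (Suc i)
      \<comment> \<open>the inner homotopy term vanishes because it is applied to the boundary of a cycle\<close>
      let ?e = "\<lambda>b. lin_ext R ?F (?c i) (decode R b)"
      have ci: "?c i \<in> res_basis R N i \<rightarrow> carrier ?F" by (rule free_funcset_UNIV[OF c]) (use Suc in simp)
      have dec: "decode R \<in> res_basis R N j \<rightarrow> carrier (?N i)" using Suc by (auto simp: decode_carrier)
      have e: "?e \<in> res_basis R N j \<rightarrow> carrier ?F" using F.lin_ext_closed[OF _ ci] dec by auto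
      have djU: "d j \<in> res_basis R N j \<rightarrow> carrier ?F" by (rule free_funcset_UNIV[OF dj])
      have ez: "lin_ext R ?F ?e ?z = (\<lambda>b. \<zero>)"
        using F.lin_ext_comp[OF ci dec z(2)] z(1) F.lin_ext_zero[OF ci] Suc
        by (simp add: cycles_def res_diff_def)
      have "lin_ext R ?F (\<lambda>b. res_diff R (?c j b)) ?z = lin_ext R ?F (\<lambda>b. d j b \<ominus>\<^bsub>?F\<^esub> ?e b) ?z"
      proof (rule F.lin_ext_cong[OF z(2)])
        show "(\<lambda>b. res_diff R (?c j b)) \<in> res_basis R N j \<rightarrow> carrier ?F"
          using c[OF order_refl] res_diff_closed U by blast
        show "res_diff R (?c j b) = d j b \<ominus>\<^bsub>?F\<^esub> ?e b" if "b \<in> res_basis R N j" for b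
          using less.IH[OF _ that] \<open>k = Suc j\<close> jK Suc by simp
      qed
      also have "\<dots> = lin_ext R ?F (d j) ?z \<ominus>\<^bsub>?F\<^esub> lin_ext R ?F ?e ?z"
        by (rule F.lin_ext_fun_minus[OF z(2) djU e])
      also have "\<dots> = lin_ext R ?F (d j) ?z"
        unfolding ez using F.lin_ext_closed[OF z(2) djU] F.M.zero_closed
        by (simp add: free_carrier_iff fun_eq_iff minus_eq)
      finally show ?thesis .
    qed
    also have "\<dots> = res_diff R (d k s)"
      using chain_mapD(3)[OF d jK(1)] less.prems Suc by auto
    finally have *: "res_diff R (lin_ext R ?F (?c j) ?z) = res_diff R (d k s)" .
    interpret N'k: module R "?N' k" by (rule module_free_module)
    have eq: "d k s \<ominus>\<^bsub>?F\<^esub> lin_ext R ?F (?c j) ?z = d k s \<ominus>\<^bsub>?N' k\<^esub> lin_ext R ?F (?c j) ?z"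
      using ds cz U by simp
    have dif: "d k s \<ominus>\<^bsub>?F\<^esub> lin_ext R ?F (?c j) ?z \<in> carrier (?N' k)"
      unfolding eq by (rule N'k.M.minus_closed[OF ds cz])
    have "res_diff R (d k s \<ominus>\<^bsub>?F\<^esub> lin_ext R ?F (?c j) ?z) = (\<lambda>b. \<zero>)"
    proof -
      have "res_diff R (d k s \<ominus>\<^bsub>?N' k\<^esub> lin_ext R ?F (?c j) ?z)
        = res_diff R (d k s) \<ominus>\<^bsub>?N' j\<^esub> res_diff R (lin_ext R ?F (?c j) ?z)"
        using mod_hom_minus[OF module_free_module module_free_module res_diff_hom[of N' j]] ds cz Suc by blast
      also have "\<dots> = \<zero>\<^bsub>?N' j\<^esub>"
        unfolding * using res_diff_closed[of "d k s" N' j] ds Suc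
        by (simp add: N'j.M.r_neg a_minus_def del: free_neg free_module_simps)
      finally show ?thesis unfolding eq by simp
    qed
    then have "d k s \<ominus>\<^bsub>?F\<^esub> lin_ext R ?F (?c j) ?z \<in> cycles R N' k"
      using dif Suc by (auto simp: cycles_def)
    then show ?thesis using Suc by (simp add: res_diff_delta_encode encode_basis del: free_minus)
  qed
qed

end

section \<open>Cohomology classes under chain maps\<close>

lemma (in cring) free_minus_UNIV:
  assumes "g \<in> carrier (free_module R B)" "h \<in> carrier (free_module R B)"
  shows "g \<ominus>\<^bsub>free_module R UNIV\<^esub> h = g \<ominus>\<^bsub>free_module R B\<^esub> h"
  using free_minus[OF assms]
    free_minus[OF free_carrier_mono[OF subset_UNIV assms(1)] free_carrier_mono[OF subset_UNIV assms(2)]]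
  by simp

context module begin

lemma dif_closed:
  assumes "\<phi> \<in> res_basis R N k \<rightarrow> A" "submodule A R M" "s \<in> res_basis R N (Suc k)"
  shows "dif R M \<phi> s \<in> A"
  unfolding dif_def by (rule lin_ext_submodule[OF decode_carrier[OF assms(3)] assms(1,2)])

lemma submodule_funcset: "submodule A R M \<Longrightarrow> \<phi> \<in> S \<rightarrow> A \<Longrightarrow> \<phi> \<in> S \<rightarrow> carrier M"
  using submodule_sub by blast

lemma lin_ext_dif:
  assumes "\<phi> \<in> res_basis R N k \<rightarrow> carrier M" "h \<in> carrier (free_module R (res_basis R N (Suc k)))"
  shows "lin_ext R M (dif R M \<phi>) h = lin_ext R M \<phi> (res_diff R h)"
proof -
  have "lin_ext R M (dif R M \<phi>) h = lin_ext R M (\<lambda>s. lin_ext R M \<phi> (decode R s)) h"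
    by (simp add: dif_def[abs_def])
  also have "\<dots> = lin_ext R M \<phi> (res_diff R h)"
    unfolding res_diff_def
    by (rule lin_ext_comp[symmetric, OF assms(1) _ assms(2)]) (auto simp: decode_carrier)
  finally show ?thesis .
qed

lemma cocyc_values: "\<phi> \<in> cocyc R M N A B k \<Longrightarrow> s \<in> res_basis R N k \<Longrightarrow> \<phi> s \<in> A"
  by (auto simp: cocyc_def)

lemma cocyc_carrier:
  "submodule A R M \<Longrightarrow> \<phi> \<in> cocyc R M N A B k \<Longrightarrow> \<phi> \<in> res_basis R N k \<rightarrow> carrier M"
  using submodule_sub by (auto simp: cocyc_def)

lemma cocyc_res_diff:
  assumes "submodule A R M" "submodule B R M" "\<phi> \<in> cocyc R M N A B k"
    "h \<in> carrier (free_module R (res_basis R N (Suc k)))"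
  shows "lin_ext R M \<phi> (res_diff R h) \<in> B"
proof -
  have \<phi>: "\<phi> \<in> res_basis R N k \<rightarrow> carrier M"
    using assms(3) submodule_sub[OF assms(1)] by (auto simp: cocyc_def)
  show ?thesis
    unfolding lin_ext_dif[OF \<phi> assms(4), symmetric]
    by (rule lin_ext_submodule[OF assms(4) _ assms(2)]) (use assms(3) in \<open>auto simp: cocyc_def\<close>)
qed

lemma cocyc_cycles:
  assumes "submodule A R M" "submodule B R M" "\<phi> \<in> cocyc R M N A B k" "z \<in> cycles R N k"
  shows "lin_ext R M \<phi> z \<in> B"
  using assms(3) encode_basis[OF assms(4)] decode_encode[OF cycles_carrier[OF assms(4)]]
  by (auto simp: cocyc_def dif_def)

text \<open>With the contraction \<open>h\<close> of \<open>d\<close>, we have \<open>\<phi> d = \<phi> \<partial> h + \<phi> h \<partial>\<close>. The first term vanishes modulo \<open>B\<close>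
since \<open>\<phi>\<close> is a cocycle, and the second one is the coboundary of \<open>\<phi> h\<close>.\<close>

lemma null_homotopic:
  assumes N: "module R N" and N': "module R N'" and d: "chain_map R N N' (\<lambda>x. \<zero>\<^bsub>N'\<^esub>) K d" and k: "k \<le> K"
    and A: "submodule A R M" and B: "submodule B R M" and \<phi>: "\<phi> \<in> cocyc R M N' A B k"
  shows "(\<lambda>s. lin_ext R M \<phi> (d k s)) \<in> cobd R M N A B k"
proof -
  have \<phi>A: "\<phi> \<in> res_basis R N' k \<rightarrow> A" using \<phi> by (auto simp: cocyc_def)
  have \<phi>M: "\<phi> \<in> res_basis R N' k \<rightarrow> carrier M" by (rule submodule_funcset[OF A \<phi>A])
  note c = contraction_works[OF N N' d]
  show ?thesis
  proof (cases k)
    case 0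
    show ?thesis
      using cocyc_res_diff[OF A B \<phi>] c[OF k] 0 by fastforce
  next
    case (Suc j)
    define \<psi> where "\<psi> = (\<lambda>b. lin_ext R M \<phi> (contraction d j b))"
    have cj: "contraction d j \<in> res_basis R N j \<rightarrow> carrier (free_module R (res_basis R N' k))"
      using c[of j] k Suc by auto
    have "\<psi> \<in> res_basis R N j \<rightarrow> A"
      using lin_ext_submodule[OF _ \<phi>A A] cj by (auto simp: \<psi>_def)
    moreover have "lin_ext R M \<phi> (d k s) \<ominus>\<^bsub>M\<^esub> dif R M \<psi> s \<in> B" if s: "s \<in> res_basis R N k" for s
    proof -
      let ?e = "lin_ext R (free_module R UNIV) (contraction d j) (decode R s)"
      let ?F = "free_module R UNIV" and ?B = "free_module R (res_basis R N' k)"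
      have s': "decode R s \<in> carrier (free_module R (res_basis R N j))"
        using s Suc by (simp add: decode_carrier)
      have ds: "d k s \<in> carrier ?B" using chain_mapD(1)[OF d k] s by auto
      have e: "?e \<in> carrier ?B" by (rule lin_ext_free_closed[OF cj s'])
      have "dif R M \<psi> s = lin_ext R M \<phi> ?e"
        unfolding dif_def \<psi>_def by (rule lin_ext_comp[symmetric, OF \<phi>M cj s'])
      then have "lin_ext R M \<phi> (d k s) \<ominus>\<^bsub>M\<^esub> dif R M \<psi> s = lin_ext R M \<phi> (d k s \<ominus>\<^bsub>?B\<^esub> ?e)"
        using lin_ext_minus[OF \<phi>M ds e] by simp
      also have "d k s \<ominus>\<^bsub>?B\<^esub> ?e = d k s \<ominus>\<^bsub>?F\<^esub> ?e"
        by (rule free_minus_UNIV[OF ds e, symmetric])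
      also have "\<dots> = res_diff R (contraction d k s)" using c[OF k s] Suc by simp
      finally have eq: "lin_ext R M \<phi> (d k s) \<ominus>\<^bsub>M\<^esub> dif R M \<psi> s
        = lin_ext R M \<phi> (res_diff R (contraction d k s))" .
      show ?thesis unfolding eq by (rule cocyc_res_diff[OF A B \<phi>]) (use c[OF k s] in blast)
    qed
    ultimately show ?thesis using Suc by auto
  qed
qed

end

context cring begin

lemma chain_map_minus:
  fixes N :: "('a, 'x, 'd) module_scheme" and N' :: "('a, 'y, 'e) module_scheme"
  assumes N': "module R N'" and f: "chain_map R N N' F K f" and g: "chain_map R N N' G K g"
  shows "chain_map R N N' (\<lambda>x. F x \<ominus>\<^bsub>N'\<^esub> G x) K (\<lambda>k s. f k s \<ominus>\<^bsub>free_module R UNIV\<^esub> g k s)"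
proof -
  let ?F = "free_module R UNIV :: ('a, ('a, 'y) syz \<Rightarrow> 'a) module"
  interpret F: module R ?F by (rule module_free_module)
  let ?B = "\<lambda>k. free_module R (res_basis R N' k)"
  interpret B: module R "?B k" for k by (rule module_free_module)
  have U: "h \<in> carrier ?F" if "h \<in> carrier (?B k)" for h k using that by (auto intro: free_carrier_mono)
  have eq: "h \<ominus>\<^bsub>?F\<^esub> h' = h \<ominus>\<^bsub>?B k\<^esub> h'" if "h \<in> carrier (?B k)" "h' \<in> carrier (?B k)" for h h' k
    using that U[OF that(1)] U[OF that(2)] by simp
  note f1 = chain_mapD(1)[OF f] and g1 = chain_mapD(1)[OF g]
  show ?thesis
    unfolding chain_map_def
  proof (intro conjI allI impI ballI)
    fix k assume k: "k \<le> K"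
    show "(\<lambda>s. f k s \<ominus>\<^bsub>?F\<^esub> g k s) \<in> res_basis R N k \<rightarrow> carrier (?B k)"
    proof
      fix s assume s: "s \<in> res_basis R N k"
      then have "f k s \<in> carrier (?B k)" "g k s \<in> carrier (?B k)" using f1[OF k] g1[OF k] by auto
      then show "f k s \<ominus>\<^bsub>?F\<^esub> g k s \<in> carrier (?B k)" using eq[of "f k s" k] B.M.minus_closed by simp
    qed
  next
    fix s assume s: "s \<in> res_basis R N 0"
    then have c: "f 0 s \<in> carrier (?B 0)" "g 0 s \<in> carrier (?B 0)" using f1[of 0] g1[of 0] by auto
    show "res_aug R N' (f 0 s \<ominus>\<^bsub>?F\<^esub> g 0 s) = F (gen s) \<ominus>\<^bsub>N'\<^esub> G (gen s)"
      using mod_hom_minus[OF module_free_module N' res_aug_hom[OF N'] c] eq[OF c]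
        chain_mapD(2)[OF f s] chain_mapD(2)[OF g s] by simp
  next
    fix k s assume k: "k < K" and s: "s \<in> res_basis R N (Suc k)"
    then have c: "f (Suc k) s \<in> carrier (?B (Suc k))" "g (Suc k) s \<in> carrier (?B (Suc k))"
      using f1[of "Suc k"] g1[of "Suc k"] by auto
    have fk: "f k \<in> res_basis R N k \<rightarrow> carrier (?B k)" "g k \<in> res_basis R N k \<rightarrow> carrier (?B k)"
      using f1[of k] g1[of k] k by auto
    note z = decode_carrier[OF s]
    have "res_diff R (f (Suc k) s \<ominus>\<^bsub>?F\<^esub> g (Suc k) s) = res_diff R (f (Suc k) s) \<ominus>\<^bsub>?B k\<^esub> res_diff R (g (Suc k) s)"
      using mod_hom_minus[OF module_free_module module_free_module res_diff_hom c] eq[OF c] by simp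
    also have "\<dots> = res_diff R (f (Suc k) s) \<ominus>\<^bsub>?F\<^esub> res_diff R (g (Suc k) s)"
      using eq[OF res_diff_closed[OF c(1)] res_diff_closed[OF c(2)]] by simp
    also have "\<dots> = lin_ext R ?F (f k) (decode R s) \<ominus>\<^bsub>?F\<^esub> lin_ext R ?F (g k) (decode R s)"
      using chain_mapD(3)[OF f k s] chain_mapD(3)[OF g k s] by simp
    also have "\<dots> = lin_ext R ?F (\<lambda>s. f k s \<ominus>\<^bsub>?F\<^esub> g k s) (decode R s)"
      by (rule F.lin_ext_fun_minus[symmetric, OF z free_funcset_UNIV[OF fk(1)] free_funcset_UNIV[OF fk(2)]])
    finally show "res_diff R (f (Suc k) s \<ominus>\<^bsub>?F\<^esub> g (Suc k) s)
      = lin_ext R ?F (\<lambda>s. f k s \<ominus>\<^bsub>?F\<^esub> g k s) (decode R s)" .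
  qed
qed

end

context module begin

text \<open>The difference of two chain maps over \<open>F\<close> is a chain map over zero.\<close>

lemma homotopic:
  assumes N: "module R N" and N': "module R N'" and F: "F \<in> mod_hom R N N'"
    and f: "chain_map R N N' F K f" and g: "chain_map R N N' F K g" and k: "k \<le> K"
    and A: "submodule A R M" and B: "submodule B R M" and \<phi>: "\<phi> \<in> cocyc R M N' A B k"
  shows "(\<lambda>s. lin_ext R M \<phi> (f k s) \<ominus>\<^bsub>M\<^esub> lin_ext R M \<phi> (g k s)) \<in> cobd R M N A B k"
proof -
  interpret N': module R N' by fact
  have d: "chain_map R N N' (\<lambda>x. \<zero>\<^bsub>N'\<^esub>) K (\<lambda>k s. f k s \<ominus>\<^bsub>free_module R UNIV\<^esub> g k s)"
    by (rule chain_map_cong[OF chain_map_minus[OF N' f g]])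
      (use mod_homD(1)[OF F] in \<open>simp add: a_minus_def N'.M.r_neg\<close>)
  have \<phi>M: "\<phi> \<in> res_basis R N' k \<rightarrow> carrier M"
    using \<phi> submodule_sub[OF A] by (auto simp: cocyc_def)
  have *: "lin_ext R M \<phi> (f k s \<ominus>\<^bsub>free_module R UNIV\<^esub> g k s) = lin_ext R M \<phi> (f k s) \<ominus>\<^bsub>M\<^esub> lin_ext R M \<phi> (g k s)"
    if "s \<in> res_basis R N k" for s
  proof -
    have c: "f k s \<in> carrier (free_module R (res_basis R N' k))" "g k s \<in> carrier (free_module R (res_basis R N' k))"
      using chain_mapD(1)[OF f k] chain_mapD(1)[OF g k] that by auto
    have "f k s \<ominus>\<^bsub>free_module R UNIV\<^esub> g k s = f k s \<ominus>\<^bsub>free_module R (res_basis R N' k)\<^esub> g k s"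
      by (rule free_minus_UNIV[OF c])
    then show ?thesis using lin_ext_minus[OF \<phi>M c] by simp
  qed
  have "(\<lambda>s. lin_ext R M \<phi> (f k s \<ominus>\<^bsub>free_module R UNIV\<^esub> g k s)) \<in> cobd R M N A B k"
    by (rule null_homotopic[OF N N' d k A B \<phi>])
  then show ?thesis by (cases k) (use * in auto)
qed

subsection \<open>Operations on coboundaries\<close>

lemma cobd_cong:
  assumes "\<phi> \<in> cobd R M N A B k" "\<And>s. s \<in> res_basis R N k \<Longrightarrow> \<phi> s = \<phi>' s"
  shows "\<phi>' \<in> cobd R M N A B k"
  using assms by (cases k) auto

lemma cobd_mono:
  assumes "\<phi> \<in> cobd R M N A B k" "A \<subseteq> A'" "B \<subseteq> B'"
  shows "\<phi> \<in> cobd R M N A' B' k"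
proof (cases k)
  case 0
  then show ?thesis using assms by auto
next
  case (Suc j)
  then obtain \<psi> where \<psi>: "\<psi> \<in> res_basis R N j \<rightarrow> A"
    "\<And>s. s \<in> res_basis R N k \<Longrightarrow> \<phi> s \<ominus>\<^bsub>M\<^esub> dif R M \<psi> s \<in> B" using assms(1) by auto
  then have "\<psi> \<in> res_basis R N j \<rightarrow> A'" "\<forall>s\<in>res_basis R N k. \<phi> s \<ominus>\<^bsub>M\<^esub> dif R M \<psi> s \<in> B'"
    using assms(2,3) by auto
  then show ?thesis using Suc by auto
qed

lemma cobd_add:
  assumes A: "submodule A R M" and B: "submodule B R M"
    and "\<phi> \<in> res_basis R N k \<rightarrow> carrier M" "\<phi>' \<in> res_basis R N k \<rightarrow> carrier M"
    and "\<phi> \<in> cobd R M N A B k" "\<phi>' \<in> cobd R M N A B k"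
  shows "(\<lambda>s. \<phi> s \<oplus>\<^bsub>M\<^esub> \<phi>' s) \<in> cobd R M N A B k"
proof (cases k)
  case 0
  then show ?thesis using assms submodule_add[OF B] by auto
next
  case (Suc j)
  then obtain \<psi> \<psi>' where \<psi>: "\<psi> \<in> res_basis R N j \<rightarrow> A" "\<psi>' \<in> res_basis R N j \<rightarrow> A"
    "\<And>s. s \<in> res_basis R N k \<Longrightarrow> \<phi> s \<ominus>\<^bsub>M\<^esub> dif R M \<psi> s \<in> B"
    "\<And>s. s \<in> res_basis R N k \<Longrightarrow> \<phi>' s \<ominus>\<^bsub>M\<^esub> dif R M \<psi>' s \<in> B" using assms(5,6) by auto
  note \<psi>M = submodule_funcset[OF A \<psi>(1)] submodule_funcset[OF A \<psi>(2)]
  have "(\<phi> s \<oplus>\<^bsub>M\<^esub> \<phi>' s) \<ominus>\<^bsub>M\<^esub> dif R M (\<lambda>s. \<psi> s \<oplus>\<^bsub>M\<^esub> \<psi>' s) s \<in> B" if s: "s \<in> res_basis R N k" for s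
  proof -
    have z: "decode R s \<in> carrier (free_module R (res_basis R N j))" using s Suc by (simp add: decode_carrier)
    have c: "\<phi> s \<in> carrier M" "\<phi>' s \<in> carrier M" "dif R M \<psi> s \<in> carrier M" "dif R M \<psi>' s \<in> carrier M"
      using assms(3,4) s lin_ext_closed[OF z \<psi>M(1)] lin_ext_closed[OF z \<psi>M(2)] by (auto simp: dif_def)
    have "(\<phi> s \<oplus>\<^bsub>M\<^esub> \<phi>' s) \<ominus>\<^bsub>M\<^esub> dif R M (\<lambda>s. \<psi> s \<oplus>\<^bsub>M\<^esub> \<psi>' s) s
      = (\<phi> s \<ominus>\<^bsub>M\<^esub> dif R M \<psi> s) \<oplus>\<^bsub>M\<^esub> (\<phi>' s \<ominus>\<^bsub>M\<^esub> dif R M \<psi>' s)"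
      using c lin_ext_fun_add[OF z \<psi>M] by (simp add: dif_def a_minus_def M.minus_add M.a_ac)
    then show ?thesis using submodule_add[OF B \<psi>(3)[OF s] \<psi>(4)[OF s]] by simp
  qed
  moreover have "(\<lambda>s. \<psi> s \<oplus>\<^bsub>M\<^esub> \<psi>' s) \<in> res_basis R N j \<rightarrow> A" using \<psi> submodule_add[OF A] by (simp add: Pi_def)
  ultimately show ?thesis using Suc by auto
qed

lemma cobd_smult:
  assumes A: "submodule A R M" and B: "submodule B R M" and r: "r \<in> carrier R"
    and "\<phi> \<in> res_basis R N k \<rightarrow> carrier M" "\<phi> \<in> cobd R M N A B k"
  shows "(\<lambda>s. r \<odot>\<^bsub>M\<^esub> \<phi> s) \<in> cobd R M N A B k"
proof (cases k)
  case 0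
  then show ?thesis using assms submodule_smult[OF B] by auto
next
  case (Suc j)
  then obtain \<psi> where \<psi>: "\<psi> \<in> res_basis R N j \<rightarrow> A"
    "\<And>s. s \<in> res_basis R N k \<Longrightarrow> \<phi> s \<ominus>\<^bsub>M\<^esub> dif R M \<psi> s \<in> B" using assms(5) by auto
  note \<psi>M = submodule_funcset[OF A \<psi>(1)]
  have "r \<odot>\<^bsub>M\<^esub> \<phi> s \<ominus>\<^bsub>M\<^esub> dif R M (\<lambda>s. r \<odot>\<^bsub>M\<^esub> \<psi> s) s \<in> B" if s: "s \<in> res_basis R N k" for s
  proof -
    have z: "decode R s \<in> carrier (free_module R (res_basis R N j))" using s Suc by (simp add: decode_carrier)
    have c: "\<phi> s \<in> carrier M" "dif R M \<psi> s \<in> carrier M"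
      using assms(4) s lin_ext_closed[OF z \<psi>M] by (auto simp: dif_def)
    have "r \<odot>\<^bsub>M\<^esub> \<phi> s \<ominus>\<^bsub>M\<^esub> dif R M (\<lambda>s. r \<odot>\<^bsub>M\<^esub> \<psi> s) s = r \<odot>\<^bsub>M\<^esub> (\<phi> s \<ominus>\<^bsub>M\<^esub> dif R M \<psi> s)"
      using c lin_ext_fun_smult[OF z \<psi>M r] r by (simp add: dif_def a_minus_def smult_r_distr smult_r_minus)
    then show ?thesis using submodule_smult[OF B r \<psi>(2)[OF s]] by simp
  qed
  moreover have "(\<lambda>s. r \<odot>\<^bsub>M\<^esub> \<psi> s) \<in> res_basis R N j \<rightarrow> A" using \<psi> submodule_smult[OF A r] by auto
  ultimately show ?thesis using Suc by auto
qed

lemma cobd_diffD: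
  assumes A: "submodule A R M" and B: "submodule B R M"
    and "\<phi> \<in> res_basis R N k \<rightarrow> carrier M" "\<phi>' \<in> res_basis R N k \<rightarrow> carrier M"
    and "(\<lambda>s. \<phi> s \<ominus>\<^bsub>M\<^esub> \<phi>' s) \<in> cobd R M N A B k" "\<phi>' \<in> cobd R M N A B k"
  shows "\<phi> \<in> cobd R M N A B k"
proof (rule cobd_cong[OF cobd_add[OF A B _ assms(4) assms(5,6)]])
  show "(\<lambda>s. \<phi> s \<ominus>\<^bsub>M\<^esub> \<phi>' s) \<in> res_basis R N k \<rightarrow> carrier M" using assms(3,4) by auto
  show "(\<phi> s \<ominus>\<^bsub>M\<^esub> \<phi>' s) \<oplus>\<^bsub>M\<^esub> \<phi>' s = \<phi> s" if "s \<in> res_basis R N k" for s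
    using assms(3,4) that by (auto simp: a_minus_def M.a_assoc M.l_neg Pi_def)
qed

lemma cobd_of_values:
  assumes A: "submodule A R M" and B: "submodule B R M" and "\<phi> \<in> res_basis R N k \<rightarrow> B"
  shows "\<phi> \<in> cobd R M N A B k"
proof (cases k)
  case 0
  then show ?thesis using assms by auto
next
  case (Suc j)
  have "dif R M (\<lambda>s. \<zero>\<^bsub>M\<^esub>) s = \<zero>\<^bsub>M\<^esub>" if "s \<in> res_basis R N k" for s
    using dif_closed[OF _ submodule_zero_set, of "\<lambda>s. \<zero>\<^bsub>M\<^esub>" N j s] that Suc by auto
  then have "\<forall>s\<in>res_basis R N (Suc j). \<phi> s \<ominus>\<^bsub>M\<^esub> dif R M (\<lambda>s. \<zero>\<^bsub>M\<^esub>) s \<in> B"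
    using Suc assms(3) submodule_minus[OF B _ submodule_zero[OF B]] by (simp add: Pi_def)
  moreover have "(\<lambda>s. \<zero>\<^bsub>M\<^esub>) \<in> res_basis R N j \<rightarrow> A" using submodule_zero[OF A] by auto
  ultimately show ?thesis using Suc by auto
qed

lemma cobd_dif:
  assumes A: "submodule A R M" and B: "submodule B R M" and "\<psi> \<in> res_basis R N k \<rightarrow> A"
  shows "dif R M \<psi> \<in> cobd R M N A B (Suc k)"
proof -
  have "dif R M \<psi> s \<ominus>\<^bsub>M\<^esub> dif R M \<psi> s \<in> B" if "s \<in> res_basis R N (Suc k)" for s
    using dif_closed[OF submodule_funcset[OF A assms(3)] carrier_is_submodule that] submodule_zero[OF B]
    by (simp add: a_minus_def M.r_neg)
  then show ?thesis using assms(3) by auto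
qed

lemma cocyc_dif:
  assumes A: "submodule A R M" and B: "submodule B R M" and \<psi>: "\<psi> \<in> res_basis R N k \<rightarrow> A"
  shows "dif R M \<psi> \<in> cocyc R M N A B (Suc k)"
proof -
  note \<psi>M = submodule_funcset[OF A \<psi>]
  have "dif R M (dif R M \<psi>) s \<in> B" if s: "s \<in> res_basis R N (Suc (Suc k))" for s
  proof -
    have z: "decode R s \<in> carrier (free_module R (res_basis R N (Suc k)))" "res_diff R (decode R s) = (\<lambda>b. \<zero>)"
      using decode_cycles[OF s] by (auto simp: cycles_def)
    have "dif R M (dif R M \<psi>) s = \<zero>\<^bsub>M\<^esub>"
      unfolding dif_def[of _ _ "dif R M \<psi>"] lin_ext_dif[OF \<psi>M z(1)] z(2) by (rule lin_ext_zero[OF \<psi>M])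
    then show ?thesis using submodule_zero[OF B] by simp
  qed
  then show ?thesis using dif_closed[OF \<psi> A] by (auto simp: cocyc_def)
qed

lemma dif_minus:
  assumes "\<phi> \<in> res_basis R N k \<rightarrow> carrier M" "\<phi>' \<in> res_basis R N k \<rightarrow> carrier M" "s \<in> res_basis R N (Suc k)"
  shows "dif R M (\<lambda>s. \<phi> s \<ominus>\<^bsub>M\<^esub> \<phi>' s) s = dif R M \<phi> s \<ominus>\<^bsub>M\<^esub> dif R M \<phi>' s"
  unfolding dif_def by (rule lin_ext_fun_minus[OF decode_carrier[OF assms(3)] assms(1,2)])

lemma dif_smult:
  assumes "\<phi> \<in> res_basis R N k \<rightarrow> carrier M" "r \<in> carrier R" "s \<in> res_basis R N (Suc k)"
  shows "dif R M (\<lambda>s. r \<odot>\<^bsub>M\<^esub> \<phi> s) s = r \<odot>\<^bsub>M\<^esub> dif R M \<phi> s"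
  unfolding dif_def by (rule lin_ext_fun_smult[OF decode_carrier[OF assms(3)] assms(1,2)])

lemma dif_cong:
  assumes "\<phi> \<in> res_basis R N k \<rightarrow> carrier M" "\<And>b. b \<in> res_basis R N k \<Longrightarrow> \<phi> b = \<phi>' b" "s \<in> res_basis R N (Suc k)"
  shows "dif R M \<phi> s = dif R M \<phi>' s"
  unfolding dif_def by (rule lin_ext_cong[OF decode_carrier[OF assms(3)] assms(1,2)])

lemma cocyc_add:
  assumes A: "submodule A R M" and B: "submodule B R M"
    and "\<phi> \<in> cocyc R M N A B k" "\<phi>' \<in> cocyc R M N A B k"
  shows "(\<lambda>s. \<phi> s \<oplus>\<^bsub>M\<^esub> \<phi>' s) \<in> cocyc R M N A B k"
proof -
  have c: "\<phi> \<in> res_basis R N k \<rightarrow> A" "\<phi>' \<in> res_basis R N k \<rightarrow> A" using assms(3,4) by (auto simp: cocyc_def)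
  have "dif R M (\<lambda>s. \<phi> s \<oplus>\<^bsub>M\<^esub> \<phi>' s) s = dif R M \<phi> s \<oplus>\<^bsub>M\<^esub> dif R M \<phi>' s" if "s \<in> res_basis R N (Suc k)" for s
    unfolding dif_def
    by (rule lin_ext_fun_add[OF decode_carrier[OF that] submodule_funcset[OF A c(1)] submodule_funcset[OF A c(2)]])
  then show ?thesis
    using assms(3,4) c submodule_add[OF A] submodule_add[OF B] by (auto simp: cocyc_def Pi_def)
qed

lemma cocyc_zero:
  assumes B: "submodule B R M"
  shows "(\<lambda>s. \<zero>\<^bsub>M\<^esub>) \<in> cocyc R M N (carrier M) B k"
proof -
  have "dif R M (\<lambda>s. \<zero>\<^bsub>M\<^esub>) s = \<zero>\<^bsub>M\<^esub>" if "s \<in> res_basis R N (Suc k)" for s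
    using dif_closed[OF _ submodule_zero_set that, of "\<lambda>s. \<zero>\<^bsub>M\<^esub>"] by auto
  then show ?thesis using submodule_zero[OF B] by (auto simp: cocyc_def)
qed

lemma cocyc_minus:
  assumes A: "submodule A R M" and B: "submodule B R M"
    and "\<phi> \<in> cocyc R M N A B k" "\<phi>' \<in> cocyc R M N A B k"
  shows "(\<lambda>s. \<phi> s \<ominus>\<^bsub>M\<^esub> \<phi>' s) \<in> cocyc R M N A B k"
proof -
  have c: "\<phi> \<in> res_basis R N k \<rightarrow> A" "\<phi>' \<in> res_basis R N k \<rightarrow> A" using assms(3,4) by (auto simp: cocyc_def)
  show ?thesis
    using assms(3,4) c submodule_minus[OF A] submodule_minus[OF B]
      dif_minus[OF submodule_funcset[OF A c(1)] submodule_funcset[OF A c(2)]]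
    by (auto simp: cocyc_def Pi_def)
qed

lemma cocyc_smult:
  assumes A: "submodule A R M" and B: "submodule B R M" and r: "r \<in> carrier R" and "\<phi> \<in> cocyc R M N A B k"
  shows "(\<lambda>s. r \<odot>\<^bsub>M\<^esub> \<phi> s) \<in> cocyc R M N A B k"
proof -
  have c: "\<phi> \<in> res_basis R N k \<rightarrow> A" using assms(4) by (auto simp: cocyc_def)
  show ?thesis
    using assms(4) c submodule_smult[OF A r] submodule_smult[OF B r]
      dif_smult[OF submodule_funcset[OF A c] r]
    by (auto simp: cocyc_def)
qed

lemma chain_pull_cocyc:
  assumes N: "module R N" and N': "module R N'" and F: "F \<in> mod_hom R N N'"
    and f: "chain_map R N N' F K f" and k: "k \<le> K"
    and A: "submodule A R M" and B: "submodule B R M" and \<phi>: "\<phi> \<in> cocyc R M N' A B k"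
  shows "(\<lambda>s. lin_ext R M \<phi> (f k s)) \<in> cocyc R M N A B k"
proof -
  have \<phi>A: "\<phi> \<in> res_basis R N' k \<rightarrow> A" using \<phi> by (auto simp: cocyc_def)
  note \<phi>M = submodule_funcset[OF A \<phi>A]
  note fk = chain_mapD(1)[OF f k]
  have "dif R M (\<lambda>s. lin_ext R M \<phi> (f k s)) s \<in> B" if s: "s \<in> res_basis R N (Suc k)" for s
    unfolding dif_def lin_ext_comp[symmetric, OF \<phi>M fk decode_carrier[OF s]]
    by (rule cocyc_cycles[OF A B \<phi> chain_map_cycles[OF N N' F f k decode_cycles[OF s]]])
  moreover have "(\<lambda>s. lin_ext R M \<phi> (f k s)) \<in> res_basis R N k \<rightarrow> A"
    using lin_ext_submodule[OF _ \<phi>A A] fk by auto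
  ultimately show ?thesis by (simp add: cocyc_def)
qed

lemma chain_pull_cobd:
  assumes f: "chain_map R N N' F K f" and k: "k \<le> K"
    and A: "submodule A R M" and B: "submodule B R M"
    and \<phi>M: "\<phi> \<in> res_basis R N' k \<rightarrow> carrier M" and \<phi>: "\<phi> \<in> cobd R M N' A B k"
  shows "(\<lambda>s. lin_ext R M \<phi> (f k s)) \<in> cobd R M N A B k"
proof (cases k)
  case 0
  then have "\<phi> \<in> res_basis R N' k \<rightarrow> B" using \<phi> by auto
  then have "\<phi> \<in> res_basis R N' k \<rightarrow> B" using 0 by simp
  then have "lin_ext R M \<phi> (f k s) \<in> B" if "s \<in> res_basis R N k" for s
    using lin_ext_submodule[OF _ \<open>\<phi> \<in> res_basis R N' k \<rightarrow> B\<close> B] chain_mapD(1)[OF f k] that by auto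
  then show ?thesis using 0 by simp
next
  case (Suc j)
  then obtain \<psi> where \<psi>: "\<psi> \<in> res_basis R N' j \<rightarrow> A"
    "\<And>s. s \<in> res_basis R N' k \<Longrightarrow> \<phi> s \<ominus>\<^bsub>M\<^esub> dif R M \<psi> s \<in> B" using \<phi> by auto
  note \<psi>M = submodule_funcset[OF A \<psi>(1)]
  have j: "j \<le> K" "j < K" using k Suc by auto
  note fk = chain_mapD(1)[OF f k] and fj = chain_mapD(1)[OF f j(1)]
  define \<psi>' where "\<psi>' = (\<lambda>s. lin_ext R M \<psi> (f j s))"
  have "lin_ext R M \<phi> (f k s) \<ominus>\<^bsub>M\<^esub> dif R M \<psi>' s \<in> B" if s: "s \<in> res_basis R N k" for s
  proof -
    have fs: "f k s \<in> carrier (free_module R (res_basis R N' k))" using fk s by auto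
    have s': "s \<in> res_basis R N (Suc j)" using s Suc by simp
    have d: "dif R M \<psi> \<in> res_basis R N' k \<rightarrow> carrier M"
      using dif_closed[OF \<psi>M carrier_is_submodule] Suc by auto
    have "dif R M \<psi>' s = lin_ext R M \<psi> (lin_ext R (free_module R UNIV) (f j) (decode R s))"
      unfolding dif_def \<psi>'_def by (rule lin_ext_comp[symmetric, OF \<psi>M fj decode_carrier[OF s']])
    also have "\<dots> = lin_ext R M (dif R M \<psi>) (f k s)"
      using chain_mapD(3)[OF f j(2) s'] lin_ext_dif[OF \<psi>M, of "f k s"] fs Suc by simp
    finally have "lin_ext R M \<phi> (f k s) \<ominus>\<^bsub>M\<^esub> dif R M \<psi>' s
      = lin_ext R M (\<lambda>b. \<phi> b \<ominus>\<^bsub>M\<^esub> dif R M \<psi> b) (f k s)"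
      using lin_ext_fun_minus[OF fs \<phi>M d] by simp
    also have "\<dots> \<in> B" by (rule lin_ext_submodule[OF fs _ B]) (use \<psi>(2) in auto)
    finally show ?thesis .
  qed
  moreover have "\<psi>' \<in> res_basis R N j \<rightarrow> A" using lin_ext_submodule[OF _ \<psi>(1) A] fj by (auto simp: \<psi>'_def)
  ultimately show ?thesis using Suc by auto
qed

end

section \<open>The functorial chain map\<close>

text \<open>The chain map induced by \<open>F\<close>, in the form in which \<open>chain_map\<close> expects it.\<close>

definition fmap :: "('r, 'c) ring_scheme \<Rightarrow> ('x \<Rightarrow> 'y) \<Rightarrow> nat \<Rightarrow> ('r, 'x) syz \<Rightarrow> ('r, 'y) syz \<Rightarrow> 'r"
  where "fmap R F k s = delta R (res_basis_map R F k s)"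

lemma push_forward_fmap:
  "push_forward R (res_basis_map R F k) = lin_ext R (free_module R UNIV) (fmap R F k)"
  by (simp add: push_forward_def fmap_def[abs_def] delta_def)

context cring begin

text \<open>Both claims are proved by one induction: the basis map in degree \<open>K + 1\<close> is well defined because
the chain map in degree \<open>K\<close> preserves cycles.\<close>

lemma chain_map_fmap:
  assumes N: "module R N" and N': "module R N'" and F: "F \<in> mod_hom R N N'"
  shows "res_basis_map R F K \<in> res_basis R N K \<rightarrow> res_basis R N' K \<and> chain_map R N N' F K (fmap R F)"
proof (induction K)
  case 0
  interpret N': module R N' by fact
  have *: "res_basis_map R F 0 \<in> res_basis R N 0 \<rightarrow> res_basis R N' 0"
    using mod_homD(1)[OF F] by (auto simp: res_basis_0)
  have gen: "gen \<in> res_basis R N' 0 \<rightarrow> carrier N'" by (auto simp: res_basis_0)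
  have "res_aug R N' (fmap R F 0 s) = F (gen s)" if "s \<in> res_basis R N 0" for s
  proof -
    have "res_basis_map R F 0 s \<in> res_basis R N' 0" using * that by blast
    then show ?thesis
      unfolding fmap_def res_aug_def by (subst N'.lin_ext_delta[OF _ gen]) auto
  qed
  moreover have "fmap R F 0 \<in> res_basis R N 0 \<rightarrow> carrier (free_module R (res_basis R N' 0))"
    using * by (auto simp: fmap_def Pi_def simp del: res_basis_map.simps)
  ultimately show ?case using * by (auto simp: chain_map_def simp del: res_basis_map.simps)
next
  case (Suc K)
  then have c: "chain_map R N N' F K (fmap R F)" by simp
  have push: "push_forward R (res_basis_map R F K) (decode R s) \<in> cycles R N' K"
    if "s \<in> res_basis R N (Suc K)" for s
    unfolding push_forward_fmap by (rule chain_map_cycles[OF N N' F c order_refl decode_cycles[OF that]])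
  have b: "res_basis_map R F (Suc K) \<in> res_basis R N (Suc K) \<rightarrow> res_basis R N' (Suc K)"
    using push by (auto simp: encode_basis)
  have d: "res_diff R (fmap R F (Suc K) s) = lin_ext R (free_module R UNIV) (fmap R F K) (decode R s)"
    if "s \<in> res_basis R N (Suc K)" for s
    using res_diff_delta_encode[OF push[OF that]] by (simp add: fmap_def push_forward_fmap)
  have "fmap R F (Suc K) \<in> res_basis R N (Suc K) \<rightarrow> carrier (free_module R (res_basis R N' (Suc K)))"
    using b by (auto simp: fmap_def Pi_def simp del: res_basis_map.simps)
  then show ?case using b c d by (auto simp: chain_map_def le_Suc_eq less_Suc_eq simp del: res_basis_map.simps)
qed

lemmas res_basis_map_closed = conjunct1[OF chain_map_fmap]
lemmas fmap_chain = conjunct2[OF chain_map_fmap]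

text \<open>The standard resolution is strictly functorial, not only up to homotopy. The equation for \<open>H\<close> is
assumed on the carrier only, which covers the projections between the quotients by powers of an ideal.\<close>

lemma res_basis_map_comp:
  fixes F :: "'x \<Rightarrow> 'y" and G :: "'y \<Rightarrow> 'z"
  assumes N: "module R N" and N': "module R N'" and N'': "module R N''"
    and F: "F \<in> mod_hom R N N'" and G: "G \<in> mod_hom R N' N''"
    and H: "\<And>x. x \<in> carrier N \<Longrightarrow> H x = G (F x)" and "s \<in> res_basis R N k"
  shows "res_basis_map R H k s = res_basis_map R G k (res_basis_map R F k s)"
  using assms(7)
proof (induction k arbitrary: s)
  case 0
  then show ?case using H by (auto simp: res_basis_0)
next
  case (Suc k)
  let ?FX = "free_module R UNIV :: ('a, ('a, 'z) syz \<Rightarrow> 'a) module"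
  interpret F: module R ?FX by (rule module_free_module)
  let ?z = "decode R s"
  note z = decode_cycles[OF Suc.prems] decode_carrier[OF Suc.prems]
  note Fc = res_basis_map_closed[OF N N' F] and Gc = res_basis_map_closed[OF N' N'' G]
  have Fz: "push_forward R (res_basis_map R F k) ?z \<in> cycles R N' k"
    unfolding push_forward_fmap by (rule chain_map_cycles[OF N N' F fmap_chain[OF N N' F] order_refl z(1)])
  have fF: "fmap R F k \<in> res_basis R N k \<rightarrow> carrier (free_module R (res_basis R N' k))"
    by (rule chain_mapD(1)[OF fmap_chain[OF N N' F] order_refl])
  have fG: "fmap R G k \<in> res_basis R N' k \<rightarrow> carrier ?FX"
    by (rule free_funcset_UNIV[OF chain_mapD(1)[OF fmap_chain[OF N' N'' G] order_refl]])
  have "push_forward R (res_basis_map R G k) (push_forward R (res_basis_map R F k) ?z)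
    = lin_ext R ?FX (\<lambda>b. lin_ext R ?FX (fmap R G k) (fmap R F k b)) ?z"
    unfolding push_forward_fmap by (rule F.lin_ext_comp[OF fG fF z(2)])
  also have "\<dots> = lin_ext R ?FX (fmap R H k) ?z"
  proof (rule F.lin_ext_cong[OF z(2)])
    show "(\<lambda>b. lin_ext R ?FX (fmap R G k) (fmap R F k b)) \<in> res_basis R N k \<rightarrow> carrier ?FX"
      using F.lin_ext_closed[OF _ fG] fF by auto
    show "lin_ext R ?FX (fmap R G k) (fmap R F k b) = fmap R H k b" if "b \<in> res_basis R N k" for b
    proof -
      have "res_basis_map R F k b \<in> res_basis R N' k" using Fc that by blast
      then show ?thesis using F.lin_ext_delta[OF _ fG] Suc.IH[OF that] by (simp add: fmap_def)
    qed
  qed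
  finally show ?case
    by (simp add: decode_encode[OF cycles_carrier[OF Fz[unfolded push_forward_fmap]]] push_forward_fmap)
qed

end

context module begin

lemma lin_ext_fmap:
  assumes "module R N" "module R N'" "F \<in> mod_hom R N N'" "\<phi> \<in> res_basis R N' k \<rightarrow> carrier M" "s \<in> res_basis R N k"
  shows "lin_ext R M \<phi> (fmap R F k s) = \<phi> (res_basis_map R F k s)"
  unfolding fmap_def
  by (rule lin_ext_delta[OF _ assms(4)]) (use res_basis_map_closed[OF assms(1-3)] assms(5) in blast)

lemma pull_cocyc:
  assumes N: "module R N" and N': "module R N'" and F: "F \<in> mod_hom R N N'"
    and A: "submodule A R M" and B: "submodule B R M" and \<phi>: "\<phi> \<in> cocyc R M N' A B k"
  shows "(\<lambda>s. \<phi> (res_basis_map R F k s)) \<in> cocyc R M N A B k"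
proof -
  have \<phi>M: "\<phi> \<in> res_basis R N' k \<rightarrow> carrier M" using \<phi> submodule_sub[OF A] by (auto simp: cocyc_def)
  have *: "(\<lambda>s. lin_ext R M \<phi> (fmap R F k s)) \<in> cocyc R M N A B k"
    by (rule chain_pull_cocyc[OF N N' F fmap_chain[OF N N' F] order_refl A B \<phi>])
  note e = lin_ext_fmap[OF N N' F \<phi>M]
  have c: "(\<lambda>s. lin_ext R M \<phi> (fmap R F k s)) \<in> res_basis R N k \<rightarrow> carrier M"
    using * submodule_sub[OF A] by (auto simp: cocyc_def)
  show ?thesis
    using * e dif_cong[OF c e] by (auto simp: cocyc_def Pi_def)
qed

lemma pull_cobd:
  assumes N: "module R N" and N': "module R N'" and F: "F \<in> mod_hom R N N'"
    and A: "submodule A R M" and B: "submodule B R M"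
    and \<phi>M: "\<phi> \<in> res_basis R N' k \<rightarrow> carrier M" and \<phi>: "\<phi> \<in> cobd R M N' A B k"
  shows "(\<lambda>s. \<phi> (res_basis_map R F k s)) \<in> cobd R M N A B k"
  by (rule cobd_cong[OF chain_pull_cobd[OF fmap_chain[OF N N' F] order_refl A B \<phi>M \<phi>]])
    (rule lin_ext_fmap[OF N N' F \<phi>M])

lemma pull_dif:
  assumes N: "module R N" and N': "module R N'" and F: "F \<in> mod_hom R N N'"
    and \<phi>M: "\<phi> \<in> res_basis R N' k \<rightarrow> carrier M" and s: "s \<in> res_basis R N (Suc k)"
  shows "dif R M (\<lambda>s. \<phi> (res_basis_map R F k s)) s = dif R M \<phi> (res_basis_map R F (Suc k) s)"
proof -
  note f = fmap_chain[OF N N' F]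
  have fk: "fmap R F k \<in> res_basis R N k \<rightarrow> carrier (free_module R (res_basis R N' k))"
    by (rule chain_mapD(1)[OF f order_refl])
  have Fz: "push_forward R (res_basis_map R F k) (decode R s) \<in> cycles R N' k"
    unfolding push_forward_fmap by (rule chain_map_cycles[OF N N' F f order_refl decode_cycles[OF s]])
  have "dif R M \<phi> (res_basis_map R F (Suc k) s)
    = lin_ext R M \<phi> (lin_ext R (free_module R UNIV) (fmap R F k) (decode R s))"
    by (simp add: dif_def decode_encode[OF cycles_carrier[OF Fz[unfolded push_forward_fmap]]] push_forward_fmap)
  also have "\<dots> = lin_ext R M (\<lambda>b. lin_ext R M \<phi> (fmap R F k b)) (decode R s)"
    by (rule lin_ext_comp[OF \<phi>M fk decode_carrier[OF s]])
  also have "\<dots> = dif R M (\<lambda>s. \<phi> (res_basis_map R F k s)) s"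
    unfolding dif_def
    by (rule lin_ext_cong[OF decode_carrier[OF s]])
      (use lin_ext_fmap[OF N N' F \<phi>M] lin_ext_closed[OF _ \<phi>M] fk in auto)
  finally show ?thesis by simp
qed

end

section \<open>Quotient modules\<close>

context module begin

lemma rcos_elem: "y \<in> B +>\<^bsub>M\<^esub> x \<longleftrightarrow> (\<exists>b\<in>B. y = b \<oplus>\<^bsub>M\<^esub> x)"
  by (auto simp: a_r_coset_def r_coset_def)

lemma submodule_subgroup: "submodule B R M \<Longrightarrow> abelian_subgroup B M"
  by (rule abelian_subgroupI3[OF additive_subgroup.intro M.abelian_group_axioms])
    (rule submodule.axioms)

context
  fixes B assumes B: "submodule B R M"
begin

lemma rcos_self: "x \<in> carrier M \<Longrightarrow> x \<in> B +>\<^bsub>M\<^esub> x"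
  using submodule_zero[OF B] by (auto simp: rcos_elem intro!: bexI[of _ "\<zero>\<^bsub>M\<^esub>"])

lemma rcos_eq_iff:
  assumes "x \<in> carrier M" "y \<in> carrier M"
  shows "B +>\<^bsub>M\<^esub> x = B +>\<^bsub>M\<^esub> y \<longleftrightarrow> x \<ominus>\<^bsub>M\<^esub> y \<in> B"
proof
  assume "B +>\<^bsub>M\<^esub> x = B +>\<^bsub>M\<^esub> y"
  then obtain b where "b \<in> B" "x = b \<oplus>\<^bsub>M\<^esub> y" using rcos_self[OF assms(1)] rcos_elem by auto
  then show "x \<ominus>\<^bsub>M\<^esub> y \<in> B" using submodule_sub[OF B] assms by (simp add: diff_add_right)
next
  assume d: "x \<ominus>\<^bsub>M\<^esub> y \<in> B"
  have d': "y \<ominus>\<^bsub>M\<^esub> x \<in> B"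
    using submodule_neg[OF B d] assms by (simp add: a_minus_def M.minus_add M.a_comm)
  have *: "B +>\<^bsub>M\<^esub> u \<subseteq> B +>\<^bsub>M\<^esub> v" if "u \<ominus>\<^bsub>M\<^esub> v \<in> B" "u \<in> carrier M" "v \<in> carrier M" for u v
  proof
    fix w assume "w \<in> B +>\<^bsub>M\<^esub> u"
    then obtain b where b: "b \<in> B" "w = b \<oplus>\<^bsub>M\<^esub> u" by (auto simp: rcos_elem)
    then have "w = (b \<oplus>\<^bsub>M\<^esub> (u \<ominus>\<^bsub>M\<^esub> v)) \<oplus>\<^bsub>M\<^esub> v"
      using that submodule_sub[OF B] minus_conv[OF that(2,3)] by (simp add: a_minus_def M.a_assoc)
    then show "w \<in> B +>\<^bsub>M\<^esub> v" using submodule_add[OF B b(1) that(1)] by (auto simp: rcos_elem)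
  qed
  show "B +>\<^bsub>M\<^esub> x = B +>\<^bsub>M\<^esub> y" using *[OF d assms] *[OF d' assms(2,1)] by blast
qed

lemma rcos_zero: "B +>\<^bsub>M\<^esub> \<zero>\<^bsub>M\<^esub> = B"
  using submodule_sub[OF B] by (force simp: rcos_elem)

lemma rcos_eq_self_iff: "x \<in> carrier M \<Longrightarrow> B +>\<^bsub>M\<^esub> x = B \<longleftrightarrow> x \<in> B"
  using rcos_eq_iff[of x "\<zero>\<^bsub>M\<^esub>"] rcos_zero minus_conv[of x "\<zero>\<^bsub>M\<^esub>"] by simp

lemma quot_carrier: "carrier (quot_module M B) = (\<lambda>x. B +>\<^bsub>M\<^esub> x) ` carrier M"
  by (auto simp: quot_module_def A_RCOSETS_def' image_def)

lemma quot_add: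
  assumes "x \<in> carrier M" "y \<in> carrier M"
  shows "(B +>\<^bsub>M\<^esub> x) \<oplus>\<^bsub>quot_module M B\<^esub> (B +>\<^bsub>M\<^esub> y) = B +>\<^bsub>M\<^esub> (x \<oplus>\<^bsub>M\<^esub> y)"
proof -
  interpret S: abelian_subgroup B M by (rule submodule_subgroup[OF B])
  show ?thesis using S.a_rcos_sum[OF assms] by (simp add: quot_module_def)
qed

lemma quot_smult:
  assumes "r \<in> carrier R" "x \<in> carrier M"
  shows "r \<odot>\<^bsub>quot_module M B\<^esub> (B +>\<^bsub>M\<^esub> x) = B +>\<^bsub>M\<^esub> (r \<odot>\<^bsub>M\<^esub> x)"
proof -
  have "B +>\<^bsub>M\<^esub> (r \<odot>\<^bsub>M\<^esub> y) = B +>\<^bsub>M\<^esub> (r \<odot>\<^bsub>M\<^esub> x)" if "y \<in> B +>\<^bsub>M\<^esub> x" for y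
  proof -
    obtain b where b: "b \<in> B" "y = b \<oplus>\<^bsub>M\<^esub> x" using \<open>y \<in> B +>\<^bsub>M\<^esub> x\<close> by (auto simp: rcos_elem)
    then have "r \<odot>\<^bsub>M\<^esub> y \<ominus>\<^bsub>M\<^esub> r \<odot>\<^bsub>M\<^esub> x = r \<odot>\<^bsub>M\<^esub> b"
      using assms submodule_sub[OF B b(1)] by (simp add: smult_r_distr diff_add_right)
    then show ?thesis
      using rcos_eq_iff[of "r \<odot>\<^bsub>M\<^esub> y" "r \<odot>\<^bsub>M\<^esub> x"] b assms submodule_sub[OF B b(1)] submodule_smult[OF B assms(1) b(1)]
      by simp
  qed
  then have "(\<Union>y\<in>B +>\<^bsub>M\<^esub> x. B +>\<^bsub>M\<^esub> (r \<odot>\<^bsub>M\<^esub> y)) = B +>\<^bsub>M\<^esub> (r \<odot>\<^bsub>M\<^esub> x)" using rcos_self[OF assms(2)] by blast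
  then show ?thesis by (simp add: quot_module_def)
qed

lemma quot_zero: "\<zero>\<^bsub>quot_module M B\<^esub> = B"
  by (simp add: quot_module_def)

lemma module_quot: "module R (quot_module M B)"
proof (rule moduleI)
  show "cring R" by (rule R.is_cring)
  show "abelian_group (quot_module M B)"
  proof (rule abelian_groupI)
    show "\<zero>\<^bsub>quot_module M B\<^esub> \<in> carrier (quot_module M B)"
      unfolding quot_carrier quot_zero using rcos_zero by (metis M.zero_closed imageI)
  next
    fix X assume X: "X \<in> carrier (quot_module M B)"
    then obtain x where x: "x \<in> carrier M" "X = B +>\<^bsub>M\<^esub> x" by (auto simp: quot_carrier)
    then show "\<zero>\<^bsub>quot_module M B\<^esub> \<oplus>\<^bsub>quot_module M B\<^esub> X = X"
      using quot_add[of "\<zero>\<^bsub>M\<^esub>" x] by (simp add: rcos_zero quot_zero)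
    show "\<exists>Y\<in>carrier (quot_module M B). Y \<oplus>\<^bsub>quot_module M B\<^esub> X = \<zero>\<^bsub>quot_module M B\<^esub>"
      using x quot_add[of "\<ominus>\<^bsub>M\<^esub> x" x]
      by (intro bexI[of _ "B +>\<^bsub>M\<^esub> (\<ominus>\<^bsub>M\<^esub> x)"]) (auto simp: quot_carrier rcos_zero quot_zero M.l_neg)
  qed (auto simp: quot_carrier quot_add M.a_ac)
qed (auto simp: quot_carrier quot_add quot_smult smult_l_distr smult_r_distr smult_assoc1)

lemma proj_hom: "(\<lambda>x. B +>\<^bsub>M\<^esub> x) \<in> mod_hom R M (quot_module M B)"
  by (rule mod_homI) (auto simp: quot_carrier quot_add quot_smult)

end

end

section \<open>The tower of quotients by the powers of an ideal\<close>

context cring begin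

lemma module_quot_ideal: "ideal J R \<Longrightarrow> module R (quot_module (ring_module R) J)"
  by (rule module.module_quot[OF module_ring_module]) (simp add: ideal_iff_submodule[symmetric])

lemma module_quot_power: "ideal J R \<Longrightarrow> module R (quot_power R J n)"
  unfolding quot_power_def by (rule module_quot_ideal[OF ipow_ideal])

end

definition power_coset :: "('r, 'c) ring_scheme \<Rightarrow> 'r set \<Rightarrow> nat \<Rightarrow> 'r \<Rightarrow> 'r set"
  where "power_coset R J n x = ipow R J n +>\<^bsub>ring_module R\<^esub> x"

abbreviation proj :: "('r, 'c) ring_scheme \<Rightarrow> 'r set \<Rightarrow> nat \<Rightarrow> 'r set \<Rightarrow> 'r set"
  where "proj R J n \<equiv> (\<lambda>X. ipow R J n <+>\<^bsub>R\<^esub> X)"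

context cring begin

context
  fixes J assumes J: "ideal J R"
begin

lemma ipow_submodule: "submodule (ipow R J n) R (ring_module R)"
  using ipow_ideal[OF J] by (simp add: ideal_iff_submodule[symmetric])

lemma quot_power_carrier: "carrier (quot_power R J n) = power_coset R J n ` carrier R"
  unfolding quot_power_def module.quot_carrier[OF module_ring_module ipow_submodule]
  by (simp add: power_coset_def[abs_def])

lemma power_coset_hom: "power_coset R J n \<in> mod_hom R (ring_module R) (quot_power R J n)"
  unfolding quot_power_def power_coset_def[abs_def]
  by (rule module.proj_hom[OF module_ring_module ipow_submodule])

lemma power_coset_zero_iff: "x \<in> carrier R \<Longrightarrow> power_coset R J n x = \<zero>\<^bsub>quot_power R J n\<^esub> \<longleftrightarrow> x \<in> ipow R J n"
  unfolding quot_power_def power_coset_def module.quot_zero[OF module_ring_module ipow_submodule]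
  using module.rcos_eq_self_iff[OF module_ring_module ipow_submodule] by simp

lemma power_coset_mem: "x \<in> carrier R \<Longrightarrow> x \<in> power_coset R J n x"
  unfolding power_coset_def using module.rcos_self[OF module_ring_module ipow_submodule] by simp

lemma power_coset_eq_of_mem:
  assumes "x \<in> carrier R" "y \<in> power_coset R J n x"
  shows "y \<in> carrier R \<and> power_coset R J n y = power_coset R J n x"
proof -
  interpret RM: module R "ring_module R" by (rule module_ring_module)
  obtain b where b: "b \<in> ipow R J n" "y = b \<oplus> x"
    using assms(2) RM.rcos_elem by (auto simp: power_coset_def)
  have bR: "b \<in> carrier R" using ideal.Icarr[OF ipow_ideal[OF J] b(1)] .
  then have "y \<ominus> x = b" using RM.diff_add_right[of b x] assms b by simp
  then show ?thesis
    unfolding power_coset_def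
    using RM.rcos_eq_iff[OF ipow_submodule, of y x n] b bR assms by simp
qed

text \<open>The projection \<open>R/J\<^sup>m \<longrightarrow> R/J\<^sup>n\<close> is defined on cosets as sets; on representatives it is the identity.\<close>

lemma proj_power_coset:
  assumes "n \<le> m" "x \<in> carrier R"
  shows "proj R J n (power_coset R J m x) = power_coset R J n x"
proof -
  interpret RM: module R "ring_module R" by (rule module_ring_module)
  have car: "i \<in> ipow R J k \<Longrightarrow> i \<in> carrier R" for i k using ideal.Icarr[OF ipow_ideal[OF J]] .
  show ?thesis
  proof (intro equalityI subsetI)
    fix y assume "y \<in> proj R J n (power_coset R J m x)"
    then obtain i j where ij: "i \<in> ipow R J n" "j \<in> ipow R J m" "y = i \<oplus> (j \<oplus> x)"
      using RM.rcos_elem by (auto simp: set_add_def' power_coset_def)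
    have j: "j \<in> ipow R J n" using ipow_decreasing[OF J assms(1)] ij by auto
    have "i \<oplus> j \<in> ipow R J n" using RM.submodule_add[OF ipow_submodule ij(1) j] by simp
    moreover have "y = (i \<oplus> j) \<oplus> x" using ij car assms by (simp add: a_assoc)
    ultimately show "y \<in> power_coset R J n x" using RM.rcos_elem by (auto simp: power_coset_def)
  next
    fix y assume "y \<in> power_coset R J n x"
    then obtain i where i: "i \<in> ipow R J n" "y = i \<oplus> x" using RM.rcos_elem by (auto simp: power_coset_def)
    then show "y \<in> proj R J n (power_coset R J m x)"
      using power_coset_mem[OF assms(2)] by (auto simp: set_add_def')
  qed
qed

lemma proj_hom_power:
  assumes "n \<le> m"
  shows "proj R J n \<in> mod_hom R (quot_power R J m) (quot_power R J n)"
proof (rule mod_homI)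
  note c = mod_homD[OF power_coset_hom, simplified]
  fix X assume X: "X \<in> carrier (quot_power R J m)"
  then obtain x where x: "x \<in> carrier R" "X = power_coset R J m x" by (auto simp: quot_power_carrier)
  then show "proj R J n X \<in> carrier (quot_power R J n)"
    using proj_power_coset[OF assms] by (auto simp: quot_power_carrier)
  { fix Y assume "Y \<in> carrier (quot_power R J m)"
    then obtain y where y: "y \<in> carrier R" "Y = power_coset R J m y" by (auto simp: quot_power_carrier)
    show "proj R J n (X \<oplus>\<^bsub>quot_power R J m\<^esub> Y) = proj R J n X \<oplus>\<^bsub>quot_power R J n\<^esub> proj R J n Y"
      using x y c(2)[of x y m, symmetric] c(2)[of x y n] proj_power_coset[OF assms] by simp }
  { fix r assume "r \<in> carrier R"
    then show "proj R J n (r \<odot>\<^bsub>quot_power R J m\<^esub> X) = r \<odot>\<^bsub>quot_power R J n\<^esub> proj R J n X"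
      using x c(3)[of r x m, symmetric] c(3)[of r x n] proj_power_coset[OF assms] by simp }
qed

lemma proj_proj:
  assumes "n \<le> m" "m \<le> k" "X \<in> carrier (quot_power R J k)"
  shows "proj R J n X = proj R J n (proj R J m X)"
  using assms proj_power_coset[of n k] proj_power_coset[of m k] proj_power_coset[of n m] by (auto simp: quot_power_carrier)

end

end

section \<open>Chain maps with small image\<close>

lemma mspan_free: "mspan R (free_module R B) E = mspan R (free_module R UNIV) E"
  using mspan_subset_cong[of "free_module R B" "free_module R UNIV" _ R E]
    mspan_subset_cong[of "free_module R UNIV" "free_module R B" _ R E] by auto

lemma imul_free: "imul R (free_module R B) J W = imul R (free_module R UNIV) J W"
  unfolding imul_def by (subst mspan_free) simp

context cring begin

lemma chain_map_extend:
  assumes "module R N" "module R N'" "F \<in> mod_hom R N N'" "chain_map R N N' F K f"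
    and y: "\<And>s. s \<in> res_basis R N (Suc K) \<Longrightarrow> y s \<in> carrier (free_module R (res_basis R N' (Suc K)))"
    and dy: "\<And>s. s \<in> res_basis R N (Suc K) \<Longrightarrow> res_diff R (y s) = lin_ext R (free_module R UNIV) (f K) (decode R s)"
  shows "chain_map R N N' F (Suc K) (f(Suc K := y))"
  using assms(4) y dy unfolding chain_map_def
  by (auto simp: le_Suc_eq less_Suc_eq)

lemma smult_hom:
  assumes "module R M" "x \<in> carrier M"
  shows "(\<lambda>r. r \<odot>\<^bsub>M\<^esub> x) \<in> mod_hom R (ring_module R) M"
proof -
  interpret M: module R M by fact
  show ?thesis by (rule mod_homI) (use assms(2) in \<open>auto simp: M.smult_l_distr M.smult_assoc1\<close>)
qed

end

locale noetherian_ideal = noetherian_cring R for R (structure) +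
  fixes \<aa>
  assumes \<aa>: "ideal \<aa> R"

context noetherian_ideal begin

abbreviation Q :: "nat \<Rightarrow> ('a, 'a set) module" where "Q \<equiv> quot_power R \<aa>"

abbreviation FQ :: "('a, ('a, 'a set) syz \<Rightarrow> 'a) module" where "FQ \<equiv> free_module R UNIV"

lemma modQ: "module R (Q n)"
  by (rule module_quot_power[OF \<aa>])

lemma projQ: "n \<le> m \<Longrightarrow> proj R \<aa> n \<in> mod_hom R (Q m) (Q n)"
  by (rule proj_hom_power[OF \<aa>])

text \<open>Send the basis element of a coset \<open>X\<close> to \<open>x\<close> times the basis element of \<open>1\<close>, for a representative
\<open>x\<close> of \<open>X\<close>. A cycle then goes to an element of \<open>\<aa>\<^bsup>c+n\<^esup> = \<aa>\<^sup>c \<aa>\<^sup>n\<close> times this basis element, and the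
multiples of the latter by \<open>\<aa>\<^sup>n\<close> are cycles over \<open>R/\<aa>\<^sup>n\<close>.\<close>

lemma augmentation_lift:
  shows "\<exists>f. chain_map R (Q (c + n)) (Q n) (proj R \<aa> n) 0 f \<and>
    (\<forall>s\<in>res_basis R (Q (c + n)) 0. f 0 s \<in> carrier (free_module R {Gen (power_coset R \<aa> n \<one>)})) \<and>
    (\<forall>z\<in>cycles R (Q (c + n)) 0. lin_ext R FQ (f 0) z
       \<in> imul R FQ (ipow R \<aa> c) (cycles R (Q n) 0 \<inter> carrier (free_module R {Gen (power_coset R \<aa> n \<one>)})))"
proof -
  interpret F: module R FQ by (rule module_free_module)
  interpret RM: module R "ring_module R" by (rule module_ring_module)
  interpret Qn: module R "Q n" by (rule modQ)
  let ?m = "c + n" and ?e = "Gen (power_coset R \<aa> n \<one>)"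
  interpret Qm: module R "Q ?m" by (rule modQ)
  let ?E = "free_module R {?e}" and ?B = "free_module R (res_basis R (Q n) 0)"
  have e: "?e \<in> res_basis R (Q n) 0" by (auto simp: res_basis_0 quot_power_carrier[OF \<aa>])
  have dE: "r \<odot>\<^bsub>FQ\<^esub> delta R ?e \<in> carrier ?E" if "r \<in> carrier R" for r
    using F.submodule_smult[OF free_sub_module[OF subset_UNIV] that, of "delta R ?e" "{?e}"] by auto
  have dB: "delta R ?e \<in> carrier ?B" using e by simp
  have sB: "r \<odot>\<^bsub>?B\<^esub> x = r \<odot>\<^bsub>FQ\<^esub> x" for r x by simp
  have aug: "res_aug R (Q n) (r \<odot>\<^bsub>FQ\<^esub> delta R ?e) = power_coset R \<aa> n r" if "r \<in> carrier R" for r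
  proof -
    have gen: "gen \<in> res_basis R (Q n) 0 \<rightarrow> carrier (Q n)" by (auto simp: res_basis_0)
    have "res_aug R (Q n) (delta R ?e) = power_coset R \<aa> n \<one>"
      unfolding res_aug_def using Qn.lin_ext_delta[OF e gen] by simp
    then have "res_aug R (Q n) (r \<odot>\<^bsub>?B\<^esub> delta R ?e) = r \<odot>\<^bsub>Q n\<^esub> power_coset R \<aa> n \<one>"
      using mod_homD(3)[OF res_aug_hom[OF modQ] that dB] by simp
    also have "\<dots> = power_coset R \<aa> n r"
      using mod_homD(3)[OF power_coset_hom[OF \<aa>], of r \<one> n] that by simp
    finally show ?thesis by (simp only: sB)
  qed
  define rep where "rep X = (SOME x. x \<in> X)" for X :: "'a set"
  have rep: "rep X \<in> carrier R" "power_coset R \<aa> ?m (rep X) = X" if X: "X \<in> carrier (Q ?m)" for X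
  proof -
    obtain x where x: "x \<in> carrier R" "X = power_coset R \<aa> ?m x" using X by (auto simp: quot_power_carrier[OF \<aa>])
    then have "rep X \<in> power_coset R \<aa> ?m x" unfolding rep_def using power_coset_mem[OF \<aa> x(1)] x(2) by (metis someI)
    then show "rep X \<in> carrier R" "power_coset R \<aa> ?m (rep X) = X"
      using power_coset_eq_of_mem[OF \<aa> x(1)] x by auto
  qed
  define f where "f = (\<lambda>(k::nat) (s::('a, 'a set) syz). rep (gen s) \<odot>\<^bsub>FQ\<^esub> delta R ?e)"
  have g: "gen s \<in> carrier (Q ?m)" if "s \<in> res_basis R (Q ?m) 0" for s using that by (auto simp: res_basis_0)
  have fE: "f 0 s \<in> carrier ?E" if "s \<in> res_basis R (Q ?m) 0" for s
    unfolding f_def by (rule dE[OF rep(1)[OF g[OF that]]])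
  have EB: "h \<in> carrier ?E \<Longrightarrow> h \<in> carrier ?B" for h using e by (auto intro: free_carrier_mono)
  have "chain_map R (Q ?m) (Q n) (proj R \<aa> n) 0 f"
    unfolding chain_map_def
  proof (intro conjI allI impI ballI)
    fix k assume "k \<le> (0::nat)"
    then show "f k \<in> res_basis R (Q ?m) k \<rightarrow> carrier (free_module R (res_basis R (Q n) k))"
      using fE EB by auto
  next
    fix s assume s: "s \<in> res_basis R (Q ?m) 0"
    have "res_aug R (Q n) (f 0 s) = power_coset R \<aa> n (rep (gen s))"
      unfolding f_def by (rule aug[OF rep(1)[OF g[OF s]]])
    also have "\<dots> = proj R \<aa> n (power_coset R \<aa> ?m (rep (gen s)))"
      by (rule proj_power_coset[OF \<aa>, symmetric]) (use rep(1)[OF g[OF s]] in auto)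
    also have "\<dots> = proj R \<aa> n (gen s)" using rep(2)[OF g[OF s]] by simp
    finally show "res_aug R (Q n) (f 0 s) = proj R \<aa> n (gen s)" .
  qed auto
  moreover have "lin_ext R FQ (f 0) z \<in> imul R FQ (ipow R \<aa> c) (cycles R (Q n) 0 \<inter> carrier ?E)"
    if z: "z \<in> cycles R (Q ?m) 0" for z
  proof -
    let ?I = "imul R FQ (ipow R \<aa> c) (cycles R (Q n) 0 \<inter> carrier ?E)"
    have zc: "z \<in> carrier (free_module R (res_basis R (Q ?m) 0))" and z0: "res_aug R (Q ?m) z = \<zero>\<^bsub>Q ?m\<^esub>"
      using z by (auto simp: cycles_def)
    define \<rho> where "\<rho> = lin_ext R (ring_module R) (\<lambda>s. rep (gen s)) z"
    have rg: "(\<lambda>s. rep (gen s)) \<in> res_basis R (Q ?m) 0 \<rightarrow> carrier (ring_module R)" using rep(1)[OF g] by auto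
    have \<rho>: "\<rho> \<in> carrier R" using RM.lin_ext_closed[OF zc rg] by (simp add: \<rho>_def)
    have "lin_ext R FQ (f 0) z = \<rho> \<odot>\<^bsub>FQ\<^esub> delta R ?e"
      unfolding f_def \<rho>_def
      by (rule F.hom_lin_ext[symmetric, OF module_ring_module smult_hom[OF module_free_module] rg zc]) simp
    moreover have "power_coset R \<aa> ?m \<rho> = \<zero>\<^bsub>Q ?m\<^esub>"
    proof -
      have "power_coset R \<aa> ?m \<rho> = lin_ext R (Q ?m) (\<lambda>s. power_coset R \<aa> ?m (rep (gen s))) z"
        unfolding \<rho>_def by (rule Qm.hom_lin_ext[OF module_ring_module power_coset_hom[OF \<aa>] rg zc])
      also have "\<dots> = res_aug R (Q ?m) z"
        unfolding res_aug_def by (rule Qm.lin_ext_cong[OF zc]) (use rep(2) g in auto)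
      finally show ?thesis using z0 by simp
    qed
    then have "\<rho> \<in> ideal_prod R (ipow R \<aa> c) (ipow R \<aa> n)"
      using power_coset_zero_iff[OF \<aa> \<rho>] ipow_add[OF \<aa>] by simp
    then have "\<rho> \<odot>\<^bsub>FQ\<^esub> delta R ?e \<in> ?I"
    proof (induction \<rho> rule: ideal_prod.induct)
      case (prod i j)
      have ij: "i \<in> carrier R" "j \<in> carrier R" using prod ideal.Icarr[OF ipow_ideal[OF \<aa>]] by auto
      have "j \<odot>\<^bsub>FQ\<^esub> delta R ?e \<in> cycles R (Q n) 0 \<inter> carrier ?E"
        using dE[OF ij(2)] EB[OF dE[OF ij(2)]] aug[OF ij(2)] power_coset_zero_iff[OF \<aa> ij(2)] prod
        by (simp add: cycles_def del: free_module_simps)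
      then have "i \<odot>\<^bsub>FQ\<^esub> (j \<odot>\<^bsub>FQ\<^esub> delta R ?e) \<in> ?I" by (rule imul_base[OF prod(1)])
      then show ?case using F.smult_assoc1[OF ij] by (simp del: free_module_simps)
    next
      case (sum i j)
      have "s \<in> carrier R" if "s \<in> ideal_prod R (ipow R \<aa> c) (ipow R \<aa> n)" for s
        using ideal_prod_in_carrier[OF ipow_ideal[OF \<aa>] ipow_ideal[OF \<aa>]] that by blast
      then have eq: "(i \<oplus> j) \<odot>\<^bsub>FQ\<^esub> delta R ?e = i \<odot>\<^bsub>FQ\<^esub> delta R ?e \<oplus>\<^bsub>FQ\<^esub> j \<odot>\<^bsub>FQ\<^esub> delta R ?e"
        using F.smult_l_distr[of i j "delta R ?e"] sum by (simp del: free_module_simps)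
      show ?case unfolding eq using sum.IH unfolding imul_def by (rule mspan_add)
    qed
    ultimately show ?thesis by simp
  qed
  ultimately show ?thesis using fE by blast
qed

text \<open>Induction on \<open>k\<close>, starting with \<open>augmentation_lift\<close>. The finite set \<open>E\<close> depends only on \<open>n\<close> and \<open>k\<close>: in
degree \<open>k + 1\<close> it consists of basis elements whose boundaries generate the cycles supported on the
previous \<open>E\<close>. If the chain map sends cycles into \<open>\<aa>\<^sup>l\<close> times these cycles, it lifts to a map into \<open>\<aa>\<^sup>l\<close>
times the free module on the new \<open>E\<close>. The Artin-Rees property turns this again into divisibility of
the images of cycles within the module of cycles, at the cost of a larger \<open>l\<close>. This is why \<open>c\<close>
is quantified after \<open>E\<close>.\<close>

theorem small_chain_maps:
  "\<exists>E. finite E \<and> E \<subseteq> res_basis R (Q n) k \<and> (\<forall>c. \<exists>m\<ge>n. \<exists>f.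
     chain_map R (Q m) (Q n) (proj R \<aa> n) k f \<and>
     (\<forall>s\<in>res_basis R (Q m) k. f k s \<in> carrier (free_module R E)) \<and>
     (k > 0 \<longrightarrow> (\<forall>s\<in>res_basis R (Q m) k. f k s \<in> imul R FQ (ipow R \<aa> c) (carrier (free_module R E)))) \<and>
     (\<forall>z\<in>cycles R (Q m) k. lin_ext R FQ (f k) z \<in> imul R FQ (ipow R \<aa> c) (cycles R (Q n) k \<inter> carrier (free_module R E))))"
proof (induction k)
  case 0
  show ?case
  proof (intro exI[of _ "{Gen (power_coset R \<aa> n \<one>)}"] conjI allI)
    show "{Gen (power_coset R \<aa> n \<one>)} \<subseteq> res_basis R (Q n) 0"
      by (auto simp: res_basis_0 quot_power_carrier[OF \<aa>])
    fix c
    show "\<exists>m\<ge>n. \<exists>f. chain_map R (Q m) (Q n) (proj R \<aa> n) 0 f \<and>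
      (\<forall>s\<in>res_basis R (Q m) 0. f 0 s \<in> carrier (free_module R {Gen (power_coset R \<aa> n \<one>)})) \<and>
      (0 < (0::nat) \<longrightarrow> (\<forall>s\<in>res_basis R (Q m) 0. f 0 s \<in> imul R FQ (ipow R \<aa> c) (carrier (free_module R {Gen (power_coset R \<aa> n \<one>)})))) \<and>
      (\<forall>z\<in>cycles R (Q m) 0. lin_ext R FQ (f 0) z \<in> imul R FQ (ipow R \<aa> c) (cycles R (Q n) 0 \<inter> carrier (free_module R {Gen (power_coset R \<aa> n \<one>)})))"
      using augmentation_lift[of c n] by (intro exI[of _ "c + n"]) auto
  qed simp
next
  case (Suc k)
  then obtain E where E: "finite E" "E \<subseteq> res_basis R (Q n) k"
    and small: "\<And>c. \<exists>m\<ge>n. \<exists>f.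
     chain_map R (Q m) (Q n) (proj R \<aa> n) k f \<and>
     (\<forall>z\<in>cycles R (Q m) k. lin_ext R FQ (f k) z \<in> imul R FQ (ipow R \<aa> c) (cycles R (Q n) k \<inter> carrier (free_module R E)))"
    by meson
  interpret F: noetherian_module R FQ
    by (intro noetherian_module.intro module_free_module) (rule noetherian_ring_axioms)
  let ?fr = "\<lambda>E. carrier (free_module R E)"
  let ?B = "free_module R (res_basis R (Q n) (Suc k))" and ?Bk = "free_module R (res_basis R (Q n) k)"
  define W where "W = cycles R (Q n) k \<inter> ?fr E"
  have subF: "submodule (?fr E) R FQ" for E by (rule free_sub_module) simp
  have W: "submodule W R FQ"
    unfolding W_def by (rule F.submodule_inter[OF cycles_submodule[OF modQ] subF])
  have "W \<subseteq> mspan R FQ (delta R ` E)" unfolding free_module_span[symmetric] by (simp add: W_def)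
  then obtain G where G: "finite G" "G \<subseteq> W" "W = mspan R FQ G"
    using F.submodule_finitely_generated[OF finite_imageI[OF E(1)] _ W] by (metis UNIV_I delta_carrier image_subsetI)
  define E' where "E' = encode R ` G"
  have E': "finite E'" "E' \<subseteq> res_basis R (Q n) (Suc k)"
    using G encode_basis[of _ R "Q n" k] by (auto simp: E'_def W_def)
  have frE': "?fr E' \<subseteq> carrier ?B" using E'(2) by (auto intro: free_carrier_mono)
  have ipowR: "ipow R \<aa> c \<subseteq> carrier R" for c using ideal.Icarr[OF ipow_ideal[OF \<aa>]] by auto
  note rd = res_diff_hom[of "Q n" k]
  have dG: "delta R ` E' \<subseteq> carrier ?B" using E'(2) by auto
  have "res_diff R ` delta R ` E' = G"
    unfolding E'_def image_image using res_diff_delta_encode[of _ "Q n" k] G(2) by (force simp: W_def)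
  then have rdW: "res_diff R ` ?fr E' = W"
    using mod_hom_image_mspan[OF module_free_module module_free_module rd dG]
    by (simp add: mspan_free[of R "res_basis R (Q n) k"] mspan_free[of R "res_basis R (Q n) (Suc k)"]
        free_module_span G(3))
  have rdI: "res_diff R ` imul R FQ (ipow R \<aa> c) (?fr E') = imul R FQ (ipow R \<aa> c) W" for c
    using mod_hom_image_imul[OF module_free_module module_free_module rd frE' ipowR]
    by (simp add: imul_free[of R "res_basis R (Q n) k"] imul_free[of R "res_basis R (Q n) (Suc k)"] rdW)
  define K where "K = cycles R (Q n) (Suc k) \<inter> ?fr E'"
  have K: "submodule K R FQ"
    unfolding K_def by (rule F.submodule_inter[OF cycles_submodule[OF modQ] subF])
  have "\<exists>m\<ge>n. \<exists>f. chain_map R (Q m) (Q n) (proj R \<aa> n) (Suc k) f \<and>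
     (\<forall>s\<in>res_basis R (Q m) (Suc k). f (Suc k) s \<in> ?fr E') \<and>
     (Suc k > 0 \<longrightarrow> (\<forall>s\<in>res_basis R (Q m) (Suc k). f (Suc k) s \<in> imul R FQ (ipow R \<aa> c) (?fr E'))) \<and>
     (\<forall>z\<in>cycles R (Q m) (Suc k). lin_ext R FQ (f (Suc k)) z \<in> imul R FQ (ipow R \<aa> c) (cycles R (Q n) (Suc k) \<inter> ?fr E'))"
    for c
  proof -
    have dU: "delta R ` E' \<subseteq> carrier FQ" by auto
    have Kd: "K \<subseteq> mspan R FQ (delta R ` E')" unfolding free_module_span[symmetric] by (simp add: K_def)
    obtain e where e: "K \<inter> imul R FQ (ipow R \<aa> e) (?fr E') \<subseteq> imul R FQ (ipow R \<aa> c) K"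
      using F.weak_artin_rees[OF finite_imageI[OF E'(1)] dU K Kd \<aa>, of c]
      unfolding free_module_span[symmetric] by blast
    \<comment> \<open>\<open>e\<close> makes Artin-Rees applicable, and \<open>c\<close> is the required divisibility of the lift itself\<close>
    define l where "l = max c e"
    have el: "imul R FQ (ipow R \<aa> l) (?fr E') \<subseteq> imul R FQ (ipow R \<aa> e) (?fr E')"
      "imul R FQ (ipow R \<aa> l) (?fr E') \<subseteq> imul R FQ (ipow R \<aa> c) (?fr E')"
      by (rule imul_mono[OF ipow_decreasing[OF \<aa>]]; simp add: l_def)+
    obtain m f where m: "m \<ge> n" and f: "chain_map R (Q m) (Q n) (proj R \<aa> n) k f"
      and fz: "\<And>z. z \<in> cycles R (Q m) k \<Longrightarrow> lin_ext R FQ (f k) z \<in> imul R FQ (ipow R \<aa> l) W"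
      using small[of l] unfolding W_def by blast
    have "\<forall>s\<in>res_basis R (Q m) (Suc k). \<exists>y. y \<in> imul R FQ (ipow R \<aa> l) (?fr E') \<and>
      res_diff R y = lin_ext R FQ (f k) (decode R s)"
    proof
      fix s assume "s \<in> res_basis R (Q m) (Suc k)"
      then have "lin_ext R FQ (f k) (decode R s) \<in> res_diff R ` imul R FQ (ipow R \<aa> l) (?fr E')"
        unfolding rdI by (rule fz[OF decode_cycles])
      then show "\<exists>y. y \<in> imul R FQ (ipow R \<aa> l) (?fr E') \<and> res_diff R y = lin_ext R FQ (f k) (decode R s)"
        by auto
    qed
    then obtain y where y: "\<And>s. s \<in> res_basis R (Q m) (Suc k) \<Longrightarrow> y s \<in> imul R FQ (ipow R \<aa> l) (?fr E')"
      "\<And>s. s \<in> res_basis R (Q m) (Suc k) \<Longrightarrow> res_diff R (y s) = lin_ext R FQ (f k) (decode R s)"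
      by metis
    have ifr: "imul R FQ (ipow R \<aa> l) (?fr E') \<subseteq> ?fr E'" by (rule F.imul_subset[OF subF ipowR])
    let ?f = "f(Suc k := y)"
    have cm: "chain_map R (Q m) (Q n) (proj R \<aa> n) (Suc k) ?f"
      by (rule chain_map_extend[OF modQ modQ projQ[OF m] f]) (use y ifr frE' in auto)
    have iS: "submodule (imul R FQ (ipow R \<aa> l) (?fr E')) R FQ"
      by (rule F.imul_submodule[OF ipowR]) (auto intro: free_carrier_mono)
    have "lin_ext R FQ y z \<in> imul R FQ (ipow R \<aa> c) K" if z: "z \<in> cycles R (Q m) (Suc k)" for z
    proof -
      have 1: "lin_ext R FQ y z \<in> imul R FQ (ipow R \<aa> l) (?fr E')"
        by (rule F.lin_ext_submodule[OF cycles_carrier[OF z] _ iS]) (use y in auto)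
      have "lin_ext R FQ y z \<in> cycles R (Q n) (Suc k)"
        using chain_map_cycles[OF modQ modQ projQ[OF m] cm order_refl z] by simp
      then show ?thesis using 1 e el ifr by (auto simp: K_def)
    qed
    then show ?thesis
      using m cm y ifr el by (intro exI[of _ m] conjI exI[of _ ?f]) (auto simp: K_def)
  qed
  then show ?case using E' by blast
qed

end

section \<open>Vanishing of local cohomology of a subquotient\<close>

text \<open>This says that \<open>H\<^sup>i\<^sub>\<aa>(A/B) = 0\<close>: every cocycle over some \<open>R/\<aa>\<^sup>n\<close> becomes a coboundary over some \<open>R/\<aa>\<^sup>m\<close>.
Subquotients \<open>A/B\<close> of one module \<open>M\<close> are used instead of modules so that filtrations and
induction stay within one type.\<close>

definition lc_vanishes ::
  "('r, 'c) ring_scheme \<Rightarrow> 'r set \<Rightarrow> ('r, 'm, 'e) module_scheme \<Rightarrow> nat \<Rightarrow> 'm set \<Rightarrow> 'm set \<Rightarrow> bool"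
  where "lc_vanishes R \<aa> M i A B \<longleftrightarrow> (\<forall>n\<ge>1. \<forall>\<phi>\<in>cocyc R M (quot_power R \<aa> n) A B i. \<exists>m\<ge>n.
    (\<lambda>s. \<phi> (res_basis_map R (proj R \<aa> n) i s)) \<in> cobd R M (quot_power R \<aa> m) A B i)"

locale noetherian_module_ideal = noetherian_module R M + noetherian_ideal R \<aa>
  for R (structure) and M (structure) and \<aa>

context noetherian_module_ideal begin

abbreviation pull :: "nat \<Rightarrow> nat \<Rightarrow> (('a, 'a set) syz \<Rightarrow> 'c) \<Rightarrow> ('a, 'a set) syz \<Rightarrow> 'c"
  where "pull n i \<phi> \<equiv> (\<lambda>s. \<phi> (res_basis_map R (proj R \<aa> n) i s))"

lemma basis_map: "n \<le> m \<Longrightarrow> s \<in> res_basis R (Q m) i \<Longrightarrow> res_basis_map R (proj R \<aa> n) i s \<in> res_basis R (Q n) i"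
  using res_basis_map_closed[OF modQ modQ projQ] by blast

lemma basis_map_comp:
  assumes "n \<le> m" "m \<le> k" "s \<in> res_basis R (Q k) i"
  shows "res_basis_map R (proj R \<aa> n) i s = res_basis_map R (proj R \<aa> n) i (res_basis_map R (proj R \<aa> m) i s)"
  by (rule res_basis_map_comp[OF modQ modQ modQ projQ[OF assms(2)] projQ[OF assms(1)] _ assms(3)])
    (rule proj_proj[OF \<aa> assms(1,2)])

lemma pull_carrier: "n \<le> m \<Longrightarrow> \<phi> \<in> res_basis R (Q n) i \<rightarrow> S \<Longrightarrow> pull n i \<phi> \<in> res_basis R (Q m) i \<rightarrow> S"
  using basis_map by blast

lemmas pull_cocycQ = pull_cocyc[OF modQ modQ projQ]
lemmas pull_cobdQ = pull_cobd[OF modQ modQ projQ]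
lemmas pull_difQ = pull_dif[OF modQ modQ projQ]

lemma pull_again:
  assumes "n \<le> m" "m \<le> k" "pull m i (pull n i \<phi>) \<in> cobd R M (Q k) A B i"
  shows "pull n i \<phi> \<in> cobd R M (Q k) A B i"
  by (rule cobd_cong[OF assms(3)]) (simp add: basis_map_comp[OF assms(1,2), symmetric])

text \<open>A cochain that is a coboundary modulo \<open>C\<close> can be corrected by a coboundary modulo \<open>B\<close> so that all its
values lie in \<open>C\<close>. This is the step from \<open>A/C\<close> to \<open>C/B\<close> in arguments with exact sequences.\<close>

lemma cobd_split:
  assumes A: "submodule A R M" and B: "submodule B R M" and "\<phi> \<in> cobd R M N A C k"
    and \<phi>: "\<phi> \<in> res_basis R N k \<rightarrow> carrier M"
  shows "\<exists>\<delta>. \<delta> \<in> cocyc R M N A B k \<and> \<delta> \<in> cobd R M N A B k \<and> (\<forall>s\<in>res_basis R N k. \<phi> s \<ominus>\<^bsub>M\<^esub> \<delta> s \<in> C)"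
proof (cases k)
  case 0
  have "dif R M (\<lambda>s. \<zero>\<^bsub>M\<^esub>) s = \<zero>\<^bsub>M\<^esub>" if "s \<in> res_basis R N (Suc 0)" for s
    using dif_closed[OF _ submodule_zero_set, of "\<lambda>s. \<zero>\<^bsub>M\<^esub>" N 0 s] that by auto
  moreover have "\<phi> s \<ominus>\<^bsub>M\<^esub> \<zero>\<^bsub>M\<^esub> = \<phi> s" if "s \<in> res_basis R N k" for s
    using \<phi> that minus_conv[of "\<phi> s" "\<zero>\<^bsub>M\<^esub>"] by (auto simp: Pi_def)
  ultimately show ?thesis
    using assms 0 submodule_zero[OF A] submodule_zero[OF B]
    by (intro exI[of _ "\<lambda>s. \<zero>\<^bsub>M\<^esub>"]) (auto simp: cocyc_def)
next
  case (Suc j)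
  then obtain \<psi> where "\<psi> \<in> res_basis R N j \<rightarrow> A" "\<forall>s\<in>res_basis R N (Suc j). \<phi> s \<ominus>\<^bsub>M\<^esub> dif R M \<psi> s \<in> C"
    using assms by auto
  then show ?thesis using cocyc_dif[OF A B] cobd_dif[OF A B] Suc by blast
qed

text \<open>Exactness of \<open>H\<^sup>i(C/B) \<longrightarrow> H\<^sup>i(A/B) \<longrightarrow> H\<^sup>i(A/C)\<close> in the middle.\<close>

lemma vanishing_trans:
  assumes A: "submodule A R M" and B: "submodule B R M" and C: "submodule C R M"
    and BC: "B \<subseteq> C" "C \<subseteq> A" and AC: "lc_vanishes R \<aa> M i A C" and CB: "lc_vanishes R \<aa> M i C B"
  shows "lc_vanishes R \<aa> M i A B"
  unfolding lc_vanishes_def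
proof (intro allI impI ballI)
  fix n \<phi> assume n: "1 \<le> (n::nat)" and \<phi>: "\<phi> \<in> cocyc R M (Q n) A B i"
  have "\<phi> \<in> cocyc R M (Q n) A C i" using \<phi> BC by (auto simp: cocyc_def)
  then obtain m where m: "m \<ge> n" "pull n i \<phi> \<in> cobd R M (Q m) A C i" using AC n by (auto simp: lc_vanishes_def)
  have p\<phi>: "pull n i \<phi> \<in> cocyc R M (Q m) A B i" by (rule pull_cocycQ[OF m(1) A B \<phi>])
  note p\<phi>M = cocyc_carrier[OF A p\<phi>]
  obtain \<delta> where \<delta>: "\<delta> \<in> cocyc R M (Q m) A B i" "\<delta> \<in> cobd R M (Q m) A B i"
    "\<forall>s\<in>res_basis R (Q m) i. pull n i \<phi> s \<ominus>\<^bsub>M\<^esub> \<delta> s \<in> C"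
    using cobd_split[OF A B m(2) p\<phi>M] by blast
  note \<delta>M = cocyc_carrier[OF A \<delta>(1)]
  let ?\<theta> = "\<lambda>s. pull n i \<phi> s \<ominus>\<^bsub>M\<^esub> \<delta> s"
  have "?\<theta> \<in> cocyc R M (Q m) C B i"
    using cocyc_minus[OF A B p\<phi> \<delta>(1)] \<delta>(3) by (simp add: cocyc_def)
  then obtain k where k: "k \<ge> m" "pull m i ?\<theta> \<in> cobd R M (Q k) C B i"
    using CB n m(1) by (auto simp: lc_vanishes_def) (meson le_trans)
  have "pull m i (pull n i \<phi>) \<in> cobd R M (Q k) A B i"
  proof (rule cobd_diffD[OF A B])
    show "pull m i (pull n i \<phi>) \<in> res_basis R (Q k) i \<rightarrow> carrier M" by (rule pull_carrier[OF k(1) p\<phi>M])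
    show "pull m i \<delta> \<in> res_basis R (Q k) i \<rightarrow> carrier M" by (rule pull_carrier[OF k(1) \<delta>M])
    show "pull m i \<delta> \<in> cobd R M (Q k) A B i" by (rule pull_cobdQ[OF k(1) A B \<delta>M \<delta>(2)])
    show "(\<lambda>s. pull m i (pull n i \<phi>) s \<ominus>\<^bsub>M\<^esub> pull m i \<delta> s) \<in> cobd R M (Q k) A B i"
      by (rule cobd_mono[OF k(2) BC(2) order_refl])
  qed
  then show "\<exists>m\<ge>n. pull n i \<phi> \<in> cobd R M (Q m) A B i"
    using pull_again[OF m(1) k(1)] m(1) k(1) le_trans by blast
qed

lemma vanishing_refl: "submodule A R M \<Longrightarrow> lc_vanishes R \<aa> M i A A"
  unfolding lc_vanishes_def
proof (intro allI impI ballI)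
  assume A: "submodule A R M"
  fix n \<phi> assume "\<phi> \<in> cocyc R M (Q n) A A i"
  then have "pull n i \<phi> \<in> res_basis R (Q n) i \<rightarrow> A"
    using pull_carrier[OF order_refl, of \<phi> n i A] by (auto simp: cocyc_def)
  then show "\<exists>m\<ge>n. pull n i \<phi> \<in> cobd R M (Q m) A A i" using cobd_of_values[OF A A] by blast
qed

text \<open>Whether a class dies in the direct limit can be tested with any chain map over the projection
\<open>R/\<aa>\<^sup>m \<longrightarrow> R/\<aa>\<^sup>n\<close>, since it is homotopic to the functorial one.\<close>

lemma cobd_via_chain_map:
  assumes A: "submodule A R M" and B: "submodule B R M" and \<phi>: "\<phi> \<in> cocyc R M (Q n) A B i"
    and m: "n \<le> m" and f: "chain_map R (Q m) (Q n) (proj R \<aa> n) i f" and k: "m \<le> k"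
    and "pull m i (\<lambda>s. lin_ext R M \<phi> (f i s)) \<in> cobd R M (Q k) A B i"
  shows "pull n i \<phi> \<in> cobd R M (Q k) A B i"
proof -
  note \<phi>M = cocyc_carrier[OF A \<phi>]
  have f\<phi>: "(\<lambda>s. lin_ext R M \<phi> (f i s)) \<in> res_basis R (Q m) i \<rightarrow> carrier M"
    by (rule cocyc_carrier[OF A chain_pull_cocyc[OF modQ modQ projQ[OF m] f order_refl A B \<phi>]])
  have n\<phi>: "pull n i \<phi> \<in> res_basis R (Q m) i \<rightarrow> carrier M" by (rule pull_carrier[OF m \<phi>M])
  have "(\<lambda>s. lin_ext R M \<phi> (fmap R (proj R \<aa> n) i s) \<ominus>\<^bsub>M\<^esub> lin_ext R M \<phi> (f i s)) \<in> cobd R M (Q m) A B i"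
    by (rule homotopic[OF modQ modQ projQ[OF m] fmap_chain[OF modQ modQ projQ[OF m]] f order_refl A B \<phi>])
  then have *: "(\<lambda>s. pull n i \<phi> s \<ominus>\<^bsub>M\<^esub> lin_ext R M \<phi> (f i s)) \<in> cobd R M (Q m) A B i"
    by (rule cobd_cong) (simp add: lin_ext_fmap[OF modQ modQ projQ[OF m] \<phi>M])
  have "pull m i (pull n i \<phi>) \<in> cobd R M (Q k) A B i"
  proof (rule cobd_diffD[OF A B _ _ _ assms(7)])
    show "pull m i (pull n i \<phi>) \<in> res_basis R (Q k) i \<rightarrow> carrier M" by (rule pull_carrier[OF k n\<phi>])
    show "pull m i (\<lambda>s. lin_ext R M \<phi> (f i s)) \<in> res_basis R (Q k) i \<rightarrow> carrier M" by (rule pull_carrier[OF k f\<phi>])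
    have "(\<lambda>s. pull n i \<phi> s \<ominus>\<^bsub>M\<^esub> lin_ext R M \<phi> (f i s)) \<in> res_basis R (Q m) i \<rightarrow> carrier M"
      using n\<phi> f\<phi> by (auto simp: Pi_def)
    from pull_cobdQ[OF k A B this *]
    show "(\<lambda>s. pull m i (pull n i \<phi>) s \<ominus>\<^bsub>M\<^esub> pull m i (\<lambda>s. lin_ext R M \<phi> (f i s)) s) \<in> cobd R M (Q k) A B i" .
  qed
  then show ?thesis by (rule pull_again[OF m k])
qed

lemma pull_self_cobd:
  assumes A: "submodule A R M" and B: "submodule B R M"
    and "\<phi> \<in> res_basis R (Q m) i \<rightarrow> carrier M" "\<phi> \<in> cobd R M (Q m) A B i"
  shows "pull m i \<phi> \<in> cobd R M (Q m) A B i"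
  by (rule pull_cobdQ[OF order_refl A B assms(3,4)])

text \<open>The pullback of a cocycle along a small chain map has values in \<open>\<aa>A\<close>. This uses that the degree is
positive, where small chain maps are divisible by \<open>\<aa>\<close>.\<close>

lemma vanishing_torsion:
  assumes A: "submodule A R M" and B: "submodule B R M"
    and tor: "\<And>x y. x \<in> \<aa> \<Longrightarrow> y \<in> A \<Longrightarrow> x \<odot>\<^bsub>M\<^esub> y \<in> B"
  shows "lc_vanishes R \<aa> M (Suc i) A B"
  unfolding lc_vanishes_def
proof (intro allI impI ballI)
  let ?i = "Suc i"
  fix n \<phi> assume n: "1 \<le> (n::nat)" and \<phi>: "\<phi> \<in> cocyc R M (Q n) A B ?i"
  interpret F: module R FQ by (rule module_free_module)
  obtain E m f where E: "E \<subseteq> res_basis R (Q n) ?i" and m: "m \<ge> n"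
    and f: "chain_map R (Q m) (Q n) (proj R \<aa> n) ?i f"
    and fs: "\<And>s. s \<in> res_basis R (Q m) ?i \<Longrightarrow> f ?i s \<in> imul R FQ (ipow R \<aa> 1) (carrier (free_module R E))"
    using small_chain_maps[of n ?i] by (metis zero_less_Suc)
  have \<phi>A: "\<phi> \<in> res_basis R (Q n) ?i \<rightarrow> A" using \<phi> by (auto simp: cocyc_def)
  note \<phi>M = cocyc_carrier[OF A \<phi>]
  let ?B = "free_module R (res_basis R (Q n) ?i)"
  have i1: "ipow R \<aa> 1 \<subseteq> \<aa>" by (rule ipow_subset[OF \<aa> order_refl])
  have \<aa>R: "\<aa> \<subseteq> carrier R" using ideal.Icarr[OF \<aa>] by auto
  have EB: "carrier (free_module R E) \<subseteq> carrier ?B" using E by (auto intro: free_carrier_mono)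
  have "lin_ext R M \<phi> ` imul R ?B (ipow R \<aa> 1) (carrier (free_module R E)) \<subseteq> B"
    unfolding mod_hom_image_imul[OF module_free_module module_axioms lin_ext_hom[OF \<phi>M] EB subset_trans[OF i1 \<aa>R]]
  proof (rule imul_least[OF B])
    fix a w assume a: "a \<in> ipow R \<aa> 1" and "w \<in> lin_ext R M \<phi> ` carrier (free_module R E)"
    then have "w \<in> A" using lin_ext_submodule[OF _ \<phi>A A] EB by blast
    then show "a \<odot>\<^bsub>M\<^esub> w \<in> B" by (rule tor[OF subsetD[OF i1 a]])
  qed
  then have "lin_ext R M \<phi> (f ?i s) \<in> B" if "s \<in> res_basis R (Q m) ?i" for s
    using fs[OF that] unfolding imul_free[of R "res_basis R (Q n) ?i"] by blast
  then have fB: "(\<lambda>s. lin_ext R M \<phi> (f ?i s)) \<in> res_basis R (Q m) ?i \<rightarrow> B" by auto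
  have "pull m ?i (\<lambda>s. lin_ext R M \<phi> (f ?i s)) \<in> cobd R M (Q m) A B ?i"
    by (rule pull_self_cobd[OF A B submodule_funcset[OF B fB] cobd_of_values[OF A B fB]])
  then show "\<exists>m\<ge>n. pull n ?i \<phi> \<in> cobd R M (Q m) A B ?i"
    using cobd_via_chain_map[OF A B \<phi> m f order_refl] m by blast
qed

text \<open>A small chain map factors through a finitely generated free module, so the pullback of a cocycle
has values in a finitely generated submodule.\<close>

lemma vanishing_of_finitely_generated:
  assumes A: "submodule A R M" and B: "submodule B R M" and BA: "B \<subseteq> A"
    and fg: "\<And>X. finite X \<Longrightarrow> X \<subseteq> A \<Longrightarrow> lc_vanishes R \<aa> M i (mspan R M (X \<union> B)) B"
  shows "lc_vanishes R \<aa> M i A B"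
  unfolding lc_vanishes_def
proof (intro allI impI ballI)
  fix n \<phi> assume n: "1 \<le> (n::nat)" and \<phi>: "\<phi> \<in> cocyc R M (Q n) A B i"
  obtain E m f where E: "finite E" "E \<subseteq> res_basis R (Q n) i" and m: "m \<ge> n"
    and f: "chain_map R (Q m) (Q n) (proj R \<aa> n) i f"
    and fs: "\<And>s. s \<in> res_basis R (Q m) i \<Longrightarrow> f i s \<in> carrier (free_module R E)"
    using small_chain_maps[of n i] by metis
  have \<phi>A: "\<phi> \<in> res_basis R (Q n) i \<rightarrow> A" using \<phi> by (auto simp: cocyc_def)
  define A' where "A' = mspan R M (\<phi> ` E \<union> B)"
  have X: "\<phi> ` E \<subseteq> A" using \<phi>A E by auto
  have A': "submodule A' R M"
    unfolding A'_def by (rule mspan_submodule) (use X submodule_sub[OF A] submodule_sub[OF B] in auto)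
  have A'A: "A' \<subseteq> A" unfolding A'_def by (rule mspan_least[OF A]) (use X BA in auto)
  have "\<phi> \<in> E \<rightarrow> A'" by (auto simp: A'_def intro: mspan_base)
  then have "lin_ext R M \<phi> (f i s) \<in> A'" if "s \<in> res_basis R (Q m) i" for s
    by (rule lin_ext_submodule[OF fs[OF that] _ A'])
  then have c: "(\<lambda>s. lin_ext R M \<phi> (f i s)) \<in> cocyc R M (Q m) A' B i"
    using chain_pull_cocyc[OF modQ modQ projQ[OF m] f order_refl A B \<phi>] by (auto simp: cocyc_def)
  obtain k where k: "k \<ge> m" "pull m i (\<lambda>s. lin_ext R M \<phi> (f i s)) \<in> cobd R M (Q k) A' B i"
    using fg[OF _ X] E(1) c n m by (auto simp: lc_vanishes_def A'_def) (meson le_trans)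
  show "\<exists>m\<ge>n. pull n i \<phi> \<in> cobd R M (Q m) A B i"
    using cobd_via_chain_map[OF A B \<phi> m f k(1) cobd_mono[OF k(2) A'A order_refl]] m k(1) le_trans by blast
qed

subsection \<open>Multiplication by a nonzerodivisor\<close>

text \<open>Multiplication by \<open>r \<in> \<aa>\<^sup>n\<close> is zero on \<open>R/\<aa>\<^sup>n\<close>, so it is null homotopic on the resolution.\<close>

lemma ideal_power_kills_cohomology:
  assumes A: "submodule A R M" and B: "submodule B R M" and \<phi>: "\<phi> \<in> cocyc R M (Q n) A B i"
    and r: "r \<in> ipow R \<aa> n"
  shows "(\<lambda>s. r \<odot>\<^bsub>M\<^esub> \<phi> s) \<in> cobd R M (Q n) A B i"
proof -
  interpret F: module R FQ by (rule module_free_module)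
  let ?B = "\<lambda>k. free_module R (res_basis R (Q n) k)"
  interpret Qn: module R "Q n" by (rule modQ)
  have rR: "r \<in> carrier R" using ideal.Icarr[OF ipow_ideal[OF \<aa>] r] .
  define f where "f = (\<lambda>(k::nat) (s::('a, 'a set) syz). r \<odot>\<^bsub>FQ\<^esub> delta R s)"
  have f: "f k s \<in> carrier (?B k)" "f k s = r \<odot>\<^bsub>?B k\<^esub> delta R s" if "s \<in> res_basis R (Q n) k" for k s
  proof -
    show "f k s = r \<odot>\<^bsub>?B k\<^esub> delta R s" by (simp add: f_def)
    then show "f k s \<in> carrier (?B k)"
      using module.smult_closed[OF module_free_module rR delta_carrier[OF that]] by simp
  qed
  have "chain_map R (Q n) (Q n) (\<lambda>x. \<zero>\<^bsub>Q n\<^esub>) i f"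
    unfolding chain_map_def
  proof (intro conjI allI impI ballI)
    fix k assume "k \<le> i"
    show "f k \<in> res_basis R (Q n) k \<rightarrow> carrier (?B k)" using f by auto
  next
    fix s assume s: "s \<in> res_basis R (Q n) 0"
    have gen: "gen \<in> res_basis R (Q n) 0 \<rightarrow> carrier (Q n)" by (auto simp: res_basis_0)
    have "res_aug R (Q n) (f 0 s) = r \<odot>\<^bsub>Q n\<^esub> res_aug R (Q n) (delta R s)"
      unfolding f(2)[OF s] by (rule mod_homD(3)[OF res_aug_hom[OF modQ] rR delta_carrier[OF s]])
    also have "res_aug R (Q n) (delta R s) = gen s"
      unfolding res_aug_def by (rule Qn.lin_ext_delta[OF s gen])
    also have "r \<odot>\<^bsub>Q n\<^esub> gen s = \<zero>\<^bsub>Q n\<^esub>"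
    proof -
      obtain x where x: "x \<in> carrier R" "gen s = power_coset R \<aa> n x"
        using gen s by (auto simp: quot_power_carrier[OF \<aa>] Pi_def)
      have "r \<otimes> x \<in> ipow R \<aa> n" using ideal.I_r_closed[OF ipow_ideal[OF \<aa>] r x(1)] .
      then show ?thesis
        using mod_homD(3)[OF power_coset_hom[OF \<aa>], of r x n] x rR power_coset_zero_iff[OF \<aa>, of "r \<otimes> x" n] by simp
    qed
    finally show "res_aug R (Q n) (f 0 s) = \<zero>\<^bsub>Q n\<^esub>" .
  next
    fix k s assume s: "s \<in> res_basis R (Q n) (Suc k)"
    have d: "delta R \<in> res_basis R (Q n) k \<rightarrow> carrier FQ" by auto
    have z: "decode R s \<in> carrier (?B k)" by (rule decode_carrier[OF s])
    have "res_diff R (f (Suc k) s) = r \<odot>\<^bsub>?B k\<^esub> res_diff R (delta R s)"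
      unfolding f(2)[OF s] by (rule mod_homD(3)[OF res_diff_hom rR delta_carrier[OF s]])
    also have "\<dots> = r \<odot>\<^bsub>FQ\<^esub> decode R s" by (simp add: res_diff_delta[OF s])
    also have "\<dots> = r \<odot>\<^bsub>FQ\<^esub> lin_ext R FQ (delta R) (decode R s)" by (simp only: lin_ext_delta_id[OF z])
    also have "\<dots> = lin_ext R FQ (f k) (decode R s)"
      unfolding f_def by (rule F.lin_ext_fun_smult[OF z d rR, symmetric])
    finally show "res_diff R (f (Suc k) s) = lin_ext R FQ (f k) (decode R s)" .
  qed
  from null_homotopic[OF modQ modQ this order_refl A B \<phi>]
  have "(\<lambda>s. lin_ext R M \<phi> (f i s)) \<in> cobd R M (Q n) A B i" .
  then show ?thesis
  proof (rule cobd_cong)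
    fix s assume s: "s \<in> res_basis R (Q n) i"
    note \<phi>M = cocyc_carrier[OF A \<phi>]
    show "lin_ext R M \<phi> (f i s) = r \<odot>\<^bsub>M\<^esub> \<phi> s"
      unfolding f(2)[OF s]
      using mod_homD(3)[OF lin_ext_hom[OF \<phi>M] rR delta_carrier[OF s]] lin_ext_delta[OF s \<phi>M] by simp
  qed
qed

text \<open>Here \<open>C = rA + B\<close>. From \<open>H\<^sup>i(A/C) = 0\<close> and the exact sequence of \<open>0 \<longrightarrow> A/B \<longrightarrow> A/B \<longrightarrow> A/C \<longrightarrow> 0\<close>,
with multiplication by \<open>r\<close> as its first map, \<open>r\<close> acts injectively on \<open>H\<^bsup>i+1\<^esup>(A/B)\<close>. But a power of \<open>r\<close> kills each
class, by \<open>ideal_power_kills_cohomology\<close>.\<close>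

lemma vanishing_nonzerodivisor:
  assumes A: "submodule A R M" and B: "submodule B R M" and BA: "B \<subseteq> A"
    and r: "r \<in> \<aa>" and nzd: "\<And>x. x \<in> A \<Longrightarrow> r \<odot>\<^bsub>M\<^esub> x \<in> B \<Longrightarrow> x \<in> B"
    and C: "submodule C R M" "\<And>x. x \<in> C \<Longrightarrow> \<exists>y\<in>A. \<exists>b\<in>B. x = r \<odot>\<^bsub>M\<^esub> y \<oplus>\<^bsub>M\<^esub> b"
      "\<And>y. y \<in> A \<Longrightarrow> r \<odot>\<^bsub>M\<^esub> y \<in> C" "B \<subseteq> C"
    and AC: "lc_vanishes R \<aa> M i A C"
  shows "lc_vanishes R \<aa> M (Suc i) A B"
proof -
  have rR: "r \<in> carrier R" using ideal.Icarr[OF \<aa> r] .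
  \<comment> \<open>injectivity of \<open>r\<close>: if \<open>r\<phi> = \<partial>\<psi>\<close>, then \<open>\<psi>\<close> is a cocycle modulo \<open>C\<close>, so after pulling back \<open>\<psi> = \<delta> + r\<omega>\<close> modulo \<open>B\<close>
    with a cocycle \<open>\<delta>\<close>; cancelling \<open>r\<close> gives \<open>\<phi> = \<partial>\<omega>\<close>\<close>
  have step: "\<exists>m\<ge>n. pull n (Suc i) \<phi> \<in> cobd R M (Q m) A B (Suc i)"
    if n: "1 \<le> n" and \<phi>: "\<phi> \<in> cocyc R M (Q n) A B (Suc i)"
      and r\<phi>: "(\<lambda>s. r \<odot>\<^bsub>M\<^esub> \<phi> s) \<in> cobd R M (Q n) A B (Suc i)" for n \<phi>
  proof -
    note \<phi>M = cocyc_carrier[OF A \<phi>]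
    obtain \<psi> where \<psi>: "\<psi> \<in> res_basis R (Q n) i \<rightarrow> A"
      "\<And>s. s \<in> res_basis R (Q n) (Suc i) \<Longrightarrow> r \<odot>\<^bsub>M\<^esub> \<phi> s \<ominus>\<^bsub>M\<^esub> dif R M \<psi> s \<in> B" using r\<phi> by auto
    note \<psi>M = submodule_funcset[OF A \<psi>(1)]
    have "dif R M \<psi> s \<in> C" if s: "s \<in> res_basis R (Q n) (Suc i)" for s
      by (rule submodule_diffD'[OF C(1) _ C(3)[OF cocyc_values[OF \<phi> s]]])
        (use \<psi>(2)[OF s] C(4) dif_closed[OF \<psi>M carrier_is_submodule s] in auto)
    then have "\<psi> \<in> cocyc R M (Q n) A C i" using \<psi>(1) by (simp add: cocyc_def)
    then obtain m where m: "m \<ge> n" "pull n i \<psi> \<in> cobd R M (Q m) A C i"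
      using AC n by (auto simp: lc_vanishes_def)
    note p\<psi>A = pull_carrier[OF m(1) \<psi>(1)]
    note p\<psi>M = submodule_funcset[OF A p\<psi>A]
    obtain \<delta> where \<delta>: "\<delta> \<in> cocyc R M (Q m) A B i"
      "\<forall>s\<in>res_basis R (Q m) i. pull n i \<psi> s \<ominus>\<^bsub>M\<^esub> \<delta> s \<in> C"
      using cobd_split[OF A B m(2) p\<psi>M] by blast
    note \<delta>M = cocyc_carrier[OF A \<delta>(1)]
    have "\<forall>s\<in>res_basis R (Q m) i. \<exists>y. y \<in> A \<and> (\<exists>b\<in>B. pull n i \<psi> s \<ominus>\<^bsub>M\<^esub> \<delta> s = r \<odot>\<^bsub>M\<^esub> y \<oplus>\<^bsub>M\<^esub> b)"
      using C(2) \<delta>(2) by blast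
    then obtain \<omega> where \<omega>: "\<And>s. s \<in> res_basis R (Q m) i \<Longrightarrow> \<omega> s \<in> A"
      "\<And>s. s \<in> res_basis R (Q m) i \<Longrightarrow> \<exists>b\<in>B. pull n i \<psi> s \<ominus>\<^bsub>M\<^esub> \<delta> s = r \<odot>\<^bsub>M\<^esub> \<omega> s \<oplus>\<^bsub>M\<^esub> b" by metis
    have \<omega>A: "\<omega> \<in> res_basis R (Q m) i \<rightarrow> A" using \<omega>(1) by auto
    note \<omega>M = submodule_funcset[OF A \<omega>A]
    let ?p = "pull n i \<psi>"
    let ?\<beta> = "\<lambda>s. (?p s \<ominus>\<^bsub>M\<^esub> \<delta> s) \<ominus>\<^bsub>M\<^esub> r \<odot>\<^bsub>M\<^esub> \<omega> s"
    have \<beta>: "?\<beta> \<in> res_basis R (Q m) i \<rightarrow> B"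
    proof
      fix s assume s: "s \<in> res_basis R (Q m) i"
      obtain b where b: "b \<in> B" "?p s \<ominus>\<^bsub>M\<^esub> \<delta> s = r \<odot>\<^bsub>M\<^esub> \<omega> s \<oplus>\<^bsub>M\<^esub> b" using \<omega>(2)[OF s] by auto
      then show "?\<beta> s \<in> B" using diff_add_left[of "r \<odot>\<^bsub>M\<^esub> \<omega> s" b] \<omega>(1)[OF s] submodule_sub[OF A]
          submodule_sub[OF B] rR by simp
    qed
    have p\<delta>M: "(\<lambda>s. ?p s \<ominus>\<^bsub>M\<^esub> \<delta> s) \<in> res_basis R (Q m) i \<rightarrow> carrier M" using p\<psi>M \<delta>M by (auto simp: Pi_def)
    have r\<omega>M: "(\<lambda>s. r \<odot>\<^bsub>M\<^esub> \<omega> s) \<in> res_basis R (Q m) i \<rightarrow> carrier M" using \<omega>M rR by (auto simp: Pi_def)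
    have "pull n (Suc i) \<phi> s \<ominus>\<^bsub>M\<^esub> dif R M \<omega> s \<in> B" if s: "s \<in> res_basis R (Q m) (Suc i)" for s
    proof -
      let ?u = "pull n (Suc i) \<phi> s" and ?v = "dif R M \<omega> s" and ?w = "dif R M ?p s"
      note ns = basis_map[OF m(1) s]
      have u: "?u \<in> A" by (rule cocyc_values[OF \<phi> ns])
      have v: "?v \<in> A" by (rule dif_closed[OF \<omega>A A s])
      have w: "?w \<in> A" by (rule dif_closed[OF p\<psi>A A s])
      note c = submodule_sub[OF A u] submodule_sub[OF A v] submodule_sub[OF A w]
      have "?w = dif R M \<psi> (res_basis_map R (proj R \<aa> n) (Suc i) s)" by (rule pull_difQ[OF m(1) \<psi>M s])
      then have 1: "r \<odot>\<^bsub>M\<^esub> ?u \<ominus>\<^bsub>M\<^esub> ?w \<in> B" using \<psi>(2)[OF ns] by simp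
      have d: "dif R M \<delta> s \<in> B" using \<delta>(1) s by (auto simp: cocyc_def)
      have "dif R M ?\<beta> s \<in> B" by (rule dif_closed[OF \<beta> B s])
      then have "(?w \<ominus>\<^bsub>M\<^esub> dif R M \<delta> s) \<ominus>\<^bsub>M\<^esub> r \<odot>\<^bsub>M\<^esub> ?v \<in> B"
        using dif_minus[OF p\<delta>M r\<omega>M s] dif_minus[OF p\<psi>M \<delta>M s] dif_smult[OF \<omega>M rR s] by simp
      moreover have "(?w \<ominus>\<^bsub>M\<^esub> dif R M \<delta> s) \<ominus>\<^bsub>M\<^esub> r \<odot>\<^bsub>M\<^esub> ?v = (?w \<ominus>\<^bsub>M\<^esub> r \<odot>\<^bsub>M\<^esub> ?v) \<ominus>\<^bsub>M\<^esub> dif R M \<delta> s"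
        using c rR submodule_sub[OF B d] by (simp add: a_minus_def M.a_ac)
      ultimately have 2: "?w \<ominus>\<^bsub>M\<^esub> r \<odot>\<^bsub>M\<^esub> ?v \<in> B"
        using submodule_diffD[OF B _ d] c rR by simp
      have "r \<odot>\<^bsub>M\<^esub> (?u \<ominus>\<^bsub>M\<^esub> ?v) = r \<odot>\<^bsub>M\<^esub> ?u \<ominus>\<^bsub>M\<^esub> r \<odot>\<^bsub>M\<^esub> ?v"
        using c rR by (simp add: a_minus_def smult_r_distr smult_r_minus)
      also have "\<dots> = (r \<odot>\<^bsub>M\<^esub> ?u \<ominus>\<^bsub>M\<^esub> ?w) \<oplus>\<^bsub>M\<^esub> (?w \<ominus>\<^bsub>M\<^esub> r \<odot>\<^bsub>M\<^esub> ?v)"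
        using c rR by (simp add: diff_triangle)
      finally have "r \<odot>\<^bsub>M\<^esub> (?u \<ominus>\<^bsub>M\<^esub> ?v) \<in> B" using submodule_add[OF B 1 2] by simp
      then show ?thesis by (rule nzd[OF submodule_minus[OF A u v]])
    qed
    then have "pull n (Suc i) \<phi> \<in> cobd R M (Q m) A B (Suc i)" using \<omega>A by auto
    then show ?thesis using m(1) by blast
  qed
  \<comment> \<open>remove the factors of \<open>r\<^sup>k\<close> one at a time, each at the cost of a further pullback\<close>
  have powers: "\<exists>m\<ge>n. pull n (Suc i) \<phi> \<in> cobd R M (Q m) A B (Suc i)"
    if "1 \<le> n" "\<phi> \<in> cocyc R M (Q n) A B (Suc i)"
      "(\<lambda>s. r [^] k \<odot>\<^bsub>M\<^esub> \<phi> s) \<in> cobd R M (Q n) A B (Suc i)" for n \<phi> and k :: nat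
    using that
  proof (induction k arbitrary: n \<phi>)
    case 0
    note \<phi>M = cocyc_carrier[OF A 0(2)]
    have "\<phi> \<in> cobd R M (Q n) A B (Suc i)"
      by (rule cobd_cong[OF 0(3)]) (use \<phi>M in \<open>auto simp: Pi_def\<close>)
    then show ?case using pull_self_cobd[OF A B \<phi>M] by blast
  next
    case (Suc k)
    note \<phi>M = cocyc_carrier[OF A Suc.prems(2)]
    have rk: "r [^] k \<in> carrier R" using rR by simp
    have c: "(\<lambda>s. r [^] k \<odot>\<^bsub>M\<^esub> \<phi> s) \<in> cocyc R M (Q n) A B (Suc i)"
      by (rule cocyc_smult[OF A B rk Suc.prems(2)])
    have "(\<lambda>s. r \<odot>\<^bsub>M\<^esub> (r [^] k \<odot>\<^bsub>M\<^esub> \<phi> s)) \<in> cobd R M (Q n) A B (Suc i)"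
      by (rule cobd_cong[OF Suc.prems(3)])
        (use \<phi>M rR rk in \<open>auto simp: Pi_def smult_assoc1[symmetric] R.m_comm\<close>)
    from step[OF Suc.prems(1) c this] obtain m where m: "m \<ge> n"
      "(\<lambda>s. r [^] k \<odot>\<^bsub>M\<^esub> pull n (Suc i) \<phi> s) \<in> cobd R M (Q m) A B (Suc i)" by auto
    then obtain l where l: "l \<ge> m" "pull m (Suc i) (pull n (Suc i) \<phi>) \<in> cobd R M (Q l) A B (Suc i)"
      using Suc.IH[OF _ pull_cocycQ[OF m(1) A B Suc.prems(2)] m(2)] Suc.prems(1) by auto
    then show ?case using pull_again[OF m(1) l] m(1) le_trans by blast
  qed
  show ?thesis
    unfolding lc_vanishes_def
  proof (intro allI impI ballI)
    fix n \<phi> assume n: "1 \<le> (n::nat)" and \<phi>: "\<phi> \<in> cocyc R M (Q n) A B (Suc i)"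
    show "\<exists>m\<ge>n. pull n (Suc i) \<phi> \<in> cobd R M (Q m) A B (Suc i)"
      by (rule powers[OF n \<phi> ideal_power_kills_cohomology[OF A B \<phi> ipow_pow[OF \<aa> r]]])
  qed
qed

end

subsection \<open>Cyclic subquotients\<close>

context module begin

lemma dif_hom:
  assumes N: "module R P" and L: "L \<in> mod_hom R P M" and \<phi>: "\<phi> \<in> res_basis R N k \<rightarrow> carrier P"
    and s: "s \<in> res_basis R N (Suc k)"
  shows "dif R M (\<lambda>s. L (\<phi> s)) s = L (dif R P \<phi> s)"
  unfolding dif_def by (rule hom_lin_ext[OF N L \<phi> decode_carrier[OF s], symmetric])

lemma cobd_hom:
  assumes P: "module R P" and L: "L \<in> mod_hom R P M" and A: "submodule A R P"
    and \<phi>: "\<phi> \<in> res_basis R N k \<rightarrow> carrier P" and cob: "\<phi> \<in> cobd R P N A B k"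
    and sub: "L ` A \<subseteq> A'" "L ` B \<subseteq> B'"
  shows "(\<lambda>s. L (\<phi> s)) \<in> cobd R M N A' B' k"
proof (cases k)
  case 0
  then show ?thesis using cob sub by auto
next
  case (Suc j)
  interpret P: module R P by (rule P)
  obtain \<psi> where \<psi>: "\<psi> \<in> res_basis R N j \<rightarrow> A" "\<forall>s\<in>res_basis R N k. \<phi> s \<ominus>\<^bsub>P\<^esub> dif R P \<psi> s \<in> B"
    using cob Suc by auto
  note \<psi>P = P.submodule_funcset[OF A \<psi>(1)]
  have "L (\<phi> s) \<ominus>\<^bsub>M\<^esub> dif R M (\<lambda>s. L (\<psi> s)) s \<in> B'" if s: "s \<in> res_basis R N k" for s
  proof -
    have s': "s \<in> res_basis R N (Suc j)" using s Suc by simp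
    have "\<phi> s \<in> carrier P" using \<phi> s by auto
    then have "L (\<phi> s) \<ominus>\<^bsub>M\<^esub> dif R M (\<lambda>s. L (\<psi> s)) s = L (\<phi> s \<ominus>\<^bsub>P\<^esub> dif R P \<psi> s)"
      using dif_hom[OF P L \<psi>P s'] mod_hom_minus[OF P module_axioms L _ P.dif_closed[OF \<psi>P P.carrier_is_submodule s']]
      by simp
    then show ?thesis using \<psi>(2) s sub(2) by auto
  qed
  moreover have "(\<lambda>s. L (\<psi> s)) \<in> res_basis R N j \<rightarrow> A'" using \<psi>(1) sub(1) by auto
  ultimately show ?thesis using Suc by auto
qed

end

context noetherian_module_ideal begin

text \<open>The map \<open>r \<mapsto> rx\<close> identifies \<open>R/(D : x)\<close> with \<open>(Rx + D)/D\<close>. This carries vanishing from the ring over to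
subquotients of arbitrary modules.\<close>

lemma vanishing_cyclic:
  assumes x: "x \<in> carrier M" and D: "submodule D R M"
    and J: "lc_vanishes R \<aa> (ring_module R) i (carrier R) {r \<in> carrier R. r \<odot>\<^bsub>M\<^esub> x \<in> D}"
  shows "lc_vanishes R \<aa> M i (mspan R M (insert x D)) D"
  unfolding lc_vanishes_def
proof (intro allI impI ballI)
  let ?A = "mspan R M (insert x D)" and ?J = "{r \<in> carrier R. r \<odot>\<^bsub>M\<^esub> x \<in> D}"
  interpret RM: noetherian_module_ideal R "ring_module R" \<aa>
    by (intro noetherian_module_ideal.intro noetherian_module.intro module_ring_module
        noetherian_ring_axioms noetherian_ideal_axioms)
  have xD: "insert x D \<subseteq> carrier M" using x submodule_sub[OF D] by auto
  have A: "submodule ?A R M" by (rule mspan_submodule[OF xD])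
  have DA: "D \<subseteq> ?A" by (auto intro: mspan_base)
  have L: "(\<lambda>r. r \<odot>\<^bsub>M\<^esub> x) \<in> mod_hom R (ring_module R) M" by (rule smult_hom[OF module_axioms x])
  fix n \<phi> assume n: "1 \<le> (n::nat)" and \<phi>: "\<phi> \<in> cocyc R M (Q n) ?A D i"
  note \<phi>M = cocyc_carrier[OF A \<phi>]
  have "\<forall>s\<in>res_basis R (Q n) i. \<exists>r. r \<in> carrier R \<and> (\<exists>b\<in>D. \<phi> s = r \<odot>\<^bsub>M\<^esub> x \<oplus>\<^bsub>M\<^esub> b)"
    using mspan_insertD[OF cocyc_values[OF \<phi>] xD] mspan_idem[OF D] by metis
  then obtain \<rho> where \<rho>: "\<And>s. s \<in> res_basis R (Q n) i \<Longrightarrow> \<rho> s \<in> carrier R"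
    "\<And>s. s \<in> res_basis R (Q n) i \<Longrightarrow> \<exists>b\<in>D. \<phi> s = \<rho> s \<odot>\<^bsub>M\<^esub> x \<oplus>\<^bsub>M\<^esub> b" by metis
  have \<rho>R: "\<rho> \<in> res_basis R (Q n) i \<rightarrow> carrier (ring_module R)" using \<rho>(1) by auto
  have \<rho>x: "(\<lambda>s. \<rho> s \<odot>\<^bsub>M\<^esub> x) \<in> res_basis R (Q n) i \<rightarrow> carrier M" using \<rho>(1) x by auto
  have \<beta>: "(\<lambda>s. \<phi> s \<ominus>\<^bsub>M\<^esub> \<rho> s \<odot>\<^bsub>M\<^esub> x) \<in> res_basis R (Q n) i \<rightarrow> D"
  proof
    fix s assume s: "s \<in> res_basis R (Q n) i"
    obtain b where "b \<in> D" "\<phi> s = \<rho> s \<odot>\<^bsub>M\<^esub> x \<oplus>\<^bsub>M\<^esub> b" using \<rho>(2)[OF s] by auto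
    then show "\<phi> s \<ominus>\<^bsub>M\<^esub> \<rho> s \<odot>\<^bsub>M\<^esub> x \<in> D"
      using diff_add_left[of "\<rho> s \<odot>\<^bsub>M\<^esub> x" b] \<rho>(1)[OF s] x submodule_sub[OF D] by simp
  qed
  have "dif R (ring_module R) \<rho> s \<in> ?J" if s: "s \<in> res_basis R (Q n) (Suc i)" for s
  proof -
    have c: "dif R (ring_module R) \<rho> s \<in> carrier R"
      using RM.dif_closed[OF \<rho>R RM.carrier_is_submodule s] by simp
    have "dif R M (\<lambda>s. \<phi> s \<ominus>\<^bsub>M\<^esub> \<rho> s \<odot>\<^bsub>M\<^esub> x) s \<in> D" by (rule dif_closed[OF \<beta> D s])
    then have "dif R M \<phi> s \<ominus>\<^bsub>M\<^esub> dif R (ring_module R) \<rho> s \<odot>\<^bsub>M\<^esub> x \<in> D"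
      using dif_minus[OF \<phi>M \<rho>x s] dif_hom[OF module_ring_module L \<rho>R s] by simp
    moreover have "dif R M \<phi> s \<in> D" using \<phi> s by (auto simp: cocyc_def)
    ultimately have "dif R (ring_module R) \<rho> s \<odot>\<^bsub>M\<^esub> x \<in> D"
      by (rule submodule_diffD'[OF D]) (use c x in auto)
    then show ?thesis using c by simp
  qed
  then have "\<rho> \<in> cocyc R (ring_module R) (Q n) (carrier R) ?J i" using \<rho>R by (simp add: cocyc_def)
  then obtain m where m: "m \<ge> n" "RM.pull n i \<rho> \<in> cobd R (ring_module R) (Q m) (carrier R) ?J i"
    using J n by (auto simp: lc_vanishes_def)
  have sub: "(\<lambda>r. r \<odot>\<^bsub>M\<^esub> x) ` carrier R \<subseteq> ?A" "(\<lambda>r. r \<odot>\<^bsub>M\<^esub> x) ` ?J \<subseteq> D"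
    by (auto intro: mspan_smult mspan_base)
  have "(\<lambda>s. RM.pull n i \<rho> s \<odot>\<^bsub>M\<^esub> x) \<in> cobd R M (Q m) ?A D i"
    using cobd_hom[OF module_ring_module L RM.carrier_is_submodule RM.pull_carrier[OF m(1) \<rho>R] _ _ sub(2), of ?A]
      m(2) sub(1) by simp
  moreover have "(\<lambda>s. pull n i \<phi> s \<ominus>\<^bsub>M\<^esub> RM.pull n i \<rho> s \<odot>\<^bsub>M\<^esub> x) \<in> cobd R M (Q m) ?A D i"
    by (rule cobd_of_values[OF A D pull_carrier[OF m(1) \<beta>]])
  ultimately have "pull n i \<phi> \<in> cobd R M (Q m) ?A D i"
    by (rule cobd_diffD[OF A D pull_carrier[OF m(1) \<phi>M] pull_carrier[OF m(1) \<rho>x], rotated])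
  then show "\<exists>m\<ge>n. pull n i \<phi> \<in> cobd R M (Q m) ?A D i" using m(1) by blast
qed

end

section \<open>Reduction to prime ideals\<close>

context noetherian_ideal begin

lemma ring_as_module: "noetherian_module_ideal R (ring_module R) \<aa>"
  by (intro noetherian_module_ideal.intro noetherian_module.intro module_ring_module
      noetherian_ring_axioms noetherian_ideal_axioms)

text \<open>Noetherian induction on \<open>J\<close>: if \<open>uv \<in> J\<close> with \<open>u, v \<notin> J\<close>, then \<open>R/J\<close> is an extension of \<open>R/(J + uR)\<close> by
\<open>(J + uR)/J\<close>, which is isomorphic to \<open>R/(J : u)\<close>, and both ideals are larger than \<open>J\<close>.\<close>

lemma vanishing_ideal_of_primes:
  assumes "ideal J R"
    and "\<And>q. primeideal q R \<Longrightarrow> J \<subseteq> q \<Longrightarrow> lc_vanishes R \<aa> (ring_module R) i (carrier R) q"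
  shows "lc_vanishes R \<aa> (ring_module R) i (carrier R) J"
  using assms
proof (induction rule: ideal_noetherian_induct)
  case (step J)
  interpret RM: noetherian_module_ideal R "ring_module R" \<aa> by (rule ring_as_module)
  interpret J: ideal J R by fact
  have Jsub: "submodule J R (ring_module R)" using step.hyps by (simp add: ideal_iff_submodule)
  have Rsub: "submodule (carrier R) R (ring_module R)" using RM.carrier_is_submodule by simp
  show ?case
  proof (cases "primeideal J R \<or> J = carrier R")
    case True
    then show ?thesis using step.prems RM.vanishing_refl[OF Jsub] by auto
  next
    case False
    then obtain u v where uv: "u \<in> carrier R" "v \<in> carrier R" "u \<otimes> v \<in> J" "u \<notin> J" "v \<notin> J"
      using primeidealI[OF step.hyps is_cring] by metis
    define C where "C = mspan R (ring_module R) (insert u J)"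
    define D where "D = {r \<in> carrier R. r \<otimes> u \<in> J}"
    have uJ: "insert u J \<subseteq> carrier (ring_module R)" using uv J.Icarr by auto
    have C: "submodule C R (ring_module R)" unfolding C_def by (rule RM.mspan_submodule[OF uJ])
    have D: "ideal D R"
      unfolding ideal_iff_submodule D_def
      by (rule RM.submodule_test) (use uv in \<open>auto simp: l_distr m_assoc J.I_l_closed J.zero_closed\<close>)
    have JC: "J \<subset> C" using uv by (auto simp: C_def intro: mspan_base)
    have "J \<subset> D" using uv J.Icarr J.I_r_closed m_comm by (auto simp: D_def)
    then have "lc_vanishes R \<aa> (ring_module R) i (carrier R) D"
      by (rule step.IH[OF D]) (use step.prems \<open>J \<subset> D\<close> in auto)
    then have CJ: "lc_vanishes R \<aa> (ring_module R) i C J"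
      unfolding C_def D_def using RM.vanishing_cyclic[OF _ Jsub, of u i] uv by simp
    have "lc_vanishes R \<aa> (ring_module R) i (carrier R) C"
      by (rule step.IH[OF _ JC]) (use C step.prems JC in \<open>auto simp: ideal_iff_submodule\<close>)
    from RM.vanishing_trans[OF Rsub Jsub C _ _ this CJ] JC RM.submodule_sub[OF C]
    show ?thesis by auto
  qed
qed

end

context noetherian_module_ideal begin

text \<open>The primes that occur are those that contain the annihilator of an element of \<open>A/B\<close>, that is, the
support of \<open>A/B\<close>.\<close>

theorem vanishing_of_primes:
  assumes A: "submodule A R M" and B: "submodule B R M" and BA: "B \<subseteq> A"
    and primes: "\<And>x q. x \<in> A \<Longrightarrow> primeideal q R \<Longrightarrow> {r \<in> carrier R. r \<odot>\<^bsub>M\<^esub> x \<in> B} \<subseteq> q \<Longrightarrow>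
       lc_vanishes R \<aa> (ring_module R) i (carrier R) q"
  shows "lc_vanishes R \<aa> M i A B"
proof (rule vanishing_of_finitely_generated[OF A B BA])
  interpret RM: module R "ring_module R" by (rule module_ring_module)
  fix X assume "finite X" "X \<subseteq> A"
  then show "lc_vanishes R \<aa> M i (mspan R M (X \<union> B)) B"
  proof (induction X rule: finite_induct)
    case empty
    then show ?case using vanishing_refl[OF B] mspan_idem[OF B] by simp
  next
    case (insert x F)
    let ?D = "mspan R M (F \<union> B)"
    have car: "F \<union> B \<subseteq> carrier M" "x \<in> carrier M" using insert submodule_sub[OF A] submodule_sub[OF B] by auto
    have D: "submodule ?D R M" by (rule mspan_submodule[OF car(1)])
    have xD: "insert x ?D \<subseteq> carrier M" using car submodule_sub[OF D] by auto
    have eq: "mspan R M (insert x F \<union> B) = mspan R M (insert x ?D)"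
    proof
      show "mspan R M (insert x F \<union> B) \<subseteq> mspan R M (insert x ?D)"
        by (rule mspan_mono) (auto intro: mspan_base)
      have "?D \<subseteq> mspan R M (insert x F \<union> B)" by (rule mspan_mono) auto
      then show "mspan R M (insert x ?D) \<subseteq> mspan R M (insert x F \<union> B)"
        by (intro mspan_least mspan_submodule) (use car in \<open>auto intro: mspan_base\<close>)
    qed
    define J where "J = {r \<in> carrier R. r \<odot>\<^bsub>M\<^esub> x \<in> ?D}"
    have J: "ideal J R"
      unfolding ideal_iff_submodule J_def
      by (rule RM.submodule_test)
        (use car in \<open>auto simp: smult_l_distr smult_assoc1 submodule_zero[OF D]
          intro: submodule_add[OF D] submodule_smult[OF D]\<close>)
    have BJ: "{r \<in> carrier R. r \<odot>\<^bsub>M\<^esub> x \<in> B} \<subseteq> J" by (auto simp: J_def intro: mspan_base)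
    have "lc_vanishes R \<aa> (ring_module R) i (carrier R) J"
      by (rule vanishing_ideal_of_primes[OF J]) (use primes[of x] insert.prems BJ in blast)
    then have 1: "lc_vanishes R \<aa> M i (mspan R M (insert x ?D)) ?D"
      unfolding J_def by (rule vanishing_cyclic[OF car(2) D])
    have 2: "lc_vanishes R \<aa> M i ?D B" using insert by auto
    show ?case
      unfolding eq by (rule vanishing_trans[OF mspan_submodule[OF xD] B D _ _ 1 2]) (auto intro: mspan_base)
  qed
qed

end

section \<open>Vanishing above the dimension\<close>

definition prime_chain :: "('r, 'c) ring_scheme \<Rightarrow> nat \<Rightarrow> (nat \<Rightarrow> 'r set) \<Rightarrow> bool"
  where "prime_chain R n P \<longleftrightarrow> (\<forall>i\<le>n. primeideal (P i) R) \<and> (\<forall>i<n. P i \<subset> P (Suc i))"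

lemma prime_chain_Cons:
  assumes "prime_chain R n P" "primeideal q R" "q \<subset> P 0"
  shows "prime_chain R (Suc n) (\<lambda>i. case i of 0 \<Rightarrow> q | Suc j \<Rightarrow> P j)"
  using assms unfolding prime_chain_def by (auto split: nat.splits)

context noetherian_ideal begin

text \<open>Grothendieck's vanishing theorem for \<open>R/q\<close>; the hypothesis says that \<open>dim R/q < i\<close>. For \<open>i = 0\<close> it is
contradictory, since \<open>q\<close> alone is a chain of length 0.\<close>

theorem vanishing_above_coheight:
  assumes "primeideal q R" "\<And>P. prime_chain R i P \<Longrightarrow> P 0 \<noteq> q"
  shows "lc_vanishes R \<aa> (ring_module R) i (carrier R) q"
  using assms
proof (induction i arbitrary: q)
  case 0
  have "prime_chain R 0 (\<lambda>_. q)" using 0(1) by (simp add: prime_chain_def)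
  then show ?case using 0(2) by blast
next
  case (Suc j)
  interpret RM: noetherian_module_ideal R "ring_module R" \<aa> by (rule ring_as_module)
  interpret q: primeideal q R by (rule Suc.prems)
  have qsub: "submodule q R (ring_module R)" using q.is_ideal by (simp add: ideal_iff_submodule)
  have Rsub: "submodule (carrier R) R (ring_module R)" using RM.carrier_is_submodule by simp
  \<comment> \<open>a chain that starts strictly above \<open>q\<close> can be prolonged by \<open>q\<close>\<close>
  have above: "lc_vanishes R \<aa> (ring_module R) j (carrier R) q'" if q': "primeideal q' R" "q \<subset> q'" for q'
  proof (rule Suc.IH[OF q'(1)])
    fix P assume "prime_chain R j P"
    then show "P 0 \<noteq> q'" using prime_chain_Cons[of R j P q] Suc.prems q' by fastforce
  qed
  show ?case
  proof (cases "\<aa> \<subseteq> q")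
    case True
    then show ?thesis
      by (intro RM.vanishing_torsion[OF Rsub qsub]) (auto simp: q.I_r_closed)
  next
    case False
    then obtain r where r: "r \<in> \<aa>" "r \<notin> q" by auto
    have rR: "r \<in> carrier R" using ideal.Icarr[OF \<aa> r(1)] .
    define C where "C = mspan R (ring_module R) (insert r q)"
    have rq: "insert r q \<subseteq> carrier (ring_module R)" using rR q.Icarr by auto
    have C: "submodule C R (ring_module R)" unfolding C_def by (rule RM.mspan_submodule[OF rq])
    have Cid: "ideal C R" using C by (simp add: ideal_iff_submodule)
    have qC: "q \<subset> C" using r by (auto simp: C_def intro: mspan_base)
    have "lc_vanishes R \<aa> (ring_module R) j (carrier R) C"
      by (rule vanishing_ideal_of_primes[OF Cid]) (use above qC in blast)
    then show ?thesis
    proof (intro RM.vanishing_nonzerodivisor[OF Rsub qsub _ r(1) _ C])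
      show "x \<in> q" if "x \<in> carrier R" "r \<odot>\<^bsub>ring_module R\<^esub> x \<in> q" for x
        using q.I_prime[OF rR that(1)] that(2) r(2) by auto
      show "\<exists>y\<in>carrier R. \<exists>b\<in>q. x = r \<odot>\<^bsub>ring_module R\<^esub> y \<oplus>\<^bsub>ring_module R\<^esub> b" if "x \<in> C" for x
        using RM.mspan_insertD[of x r q] that rq RM.mspan_idem[OF qsub] rR
        by (auto simp: C_def m_comm)
      show "r \<odot>\<^bsub>ring_module R\<^esub> y \<in> C" if "y \<in> carrier R" for y
        using ideal.I_r_closed[OF Cid _ that, of r] by (auto simp: C_def intro: mspan_base)
    qed (use qC q.Icarr in auto)
  qed
qed

end

section \<open>Associated primes\<close>

context noetherian_module begin

text \<open>Among the annihilators of elements of \<open>M\<close> that are contained in \<open>p\<close>, a maximal one, \<open>ann y\<close>, is prime,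
hence equal to the minimal prime \<open>p\<close>. Indeed, it does not change when \<open>y\<close> is multiplied by an element outside \<open>p\<close>, and if \<open>uv y = 0\<close> then either
\<open>ann (vy)\<close> is again contained in \<open>p\<close>, hence equal to \<open>ann y\<close> and \<open>uy = 0\<close>, or some element outside \<open>p\<close> kills \<open>vy\<close> and
then \<open>vy = 0\<close>.\<close>

lemma minimal_prime_associated:
  assumes p: "primeideal p R" and min: "\<And>q. primeideal q R \<Longrightarrow> q \<subseteq> p \<Longrightarrow> q = p"
    and x: "x \<in> carrier M" "{r \<in> carrier R. r \<odot>\<^bsub>M\<^esub> x = \<zero>\<^bsub>M\<^esub>} \<subseteq> p"
  shows "p \<in> Ass R M"
proof -
  interpret p: primeideal p R by (rule p)
  interpret RM: module R "ring_module R" by (rule module_ring_module)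
  define ann where "ann y = {r \<in> carrier R. r \<odot>\<^bsub>M\<^esub> y = \<zero>\<^bsub>M\<^esub>}" for y
  have ideal_ann: "ideal (ann y) R" if "y \<in> carrier M" for y
    unfolding ideal_iff_submodule ann_def
    by (rule RM.submodule_test) (use that in \<open>auto simp: smult_l_distr smult_assoc1\<close>)
  define S where "S = {ann y | y. y \<in> carrier M \<and> ann y \<subseteq> p}"
  have "ann x \<in> S" using x by (auto simp: S_def ann_def)
  moreover have "J \<in> S \<Longrightarrow> ideal J R" for J using ideal_ann by (auto simp: S_def)
  ultimately obtain J where J: "J \<in> S" and max: "\<And>X. X \<in> S \<Longrightarrow> J \<subseteq> X \<Longrightarrow> X = J"
    using maximal_ideal_in_family by metis
  obtain y where y: "y \<in> carrier M" "J = ann y" "ann y \<subseteq> p" using J by (auto simp: S_def)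
  have le: "ann y \<subseteq> ann (u \<odot>\<^bsub>M\<^esub> y)" if "u \<in> carrier R" for u
  proof
    fix r assume r: "r \<in> ann y"
    then have rR: "r \<in> carrier R" and ry: "r \<odot>\<^bsub>M\<^esub> y = \<zero>\<^bsub>M\<^esub>" by (auto simp: ann_def)
    have "r \<odot>\<^bsub>M\<^esub> (u \<odot>\<^bsub>M\<^esub> y) = (u \<otimes> r) \<odot>\<^bsub>M\<^esub> y"
      using smult_assoc1[OF rR that y(1)] R.m_comm[OF rR that] by simp
    also have "\<dots> = \<zero>\<^bsub>M\<^esub>" using smult_assoc1[OF that rR y(1)] ry that by simp
    finally have "r \<odot>\<^bsub>M\<^esub> (u \<odot>\<^bsub>M\<^esub> y) = \<zero>\<^bsub>M\<^esub>" .
    then show "r \<in> ann (u \<odot>\<^bsub>M\<^esub> y)" using r that by (simp add: ann_def)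
  qed
  have same: "ann (u \<odot>\<^bsub>M\<^esub> y) = ann y" if "u \<in> carrier R" "ann (u \<odot>\<^bsub>M\<^esub> y) \<subseteq> p" for u
    using max[of "ann (u \<odot>\<^bsub>M\<^esub> y)"] le[OF that(1)] that y by (auto simp: S_def)
  have sat: "u \<in> ann y" if s: "s \<in> carrier R" "s \<notin> p" "u \<in> carrier R" "s \<otimes> u \<in> ann y" for s u
  proof -
    have "ann (s \<odot>\<^bsub>M\<^esub> y) \<subseteq> p"
    proof
      fix t assume t: "t \<in> ann (s \<odot>\<^bsub>M\<^esub> y)"
      then have "t \<otimes> s \<in> ann y" using s(1) y(1) by (simp add: ann_def smult_assoc1)
      then show "t \<in> p" using p.I_prime[of t s] y(3) s(1,2) t by (auto simp: ann_def)
    qed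
    then have "ann (s \<odot>\<^bsub>M\<^esub> y) = ann y" by (rule same[OF s(1)])
    moreover have "u \<in> ann (s \<odot>\<^bsub>M\<^esub> y)"
      using s y(1) by (simp add: ann_def smult_assoc1[symmetric] R.m_comm)
    ultimately show ?thesis by simp
  qed
  have "primeideal (ann y) R"
  proof (rule primeidealI[OF ideal_ann[OF y(1)] R.is_cring])
    show "carrier R \<noteq> ann y" using y(3) p.I_notcarr p.Icarr by blast
    fix u v assume uv: "u \<in> carrier R" "v \<in> carrier R" "u \<otimes> v \<in> ann y"
    show "u \<in> ann y \<or> v \<in> ann y"
    proof (cases "ann (v \<odot>\<^bsub>M\<^esub> y) \<subseteq> p")
      case True
      have "u \<in> ann (v \<odot>\<^bsub>M\<^esub> y)" using uv y(1) by (simp add: ann_def smult_assoc1)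
      then show ?thesis using same[OF uv(2) True] by simp
    next
      case False
      then obtain s where "s \<in> carrier R" "s \<notin> p" "s \<odot>\<^bsub>M\<^esub> (v \<odot>\<^bsub>M\<^esub> y) = \<zero>\<^bsub>M\<^esub>" by (auto simp: ann_def)
      then show ?thesis using sat[of s v] uv y(1) by (auto simp: ann_def smult_assoc1)
    qed
  qed
  then have "ann y = p" using min y(3) by blast
  then show ?thesis using p y(1) by (auto simp: Ass_def ann_def)
qed

end

section \<open>Right exactness of the top local cohomology\<close>

context noetherian_module_ideal begin

lemma multiples_submodule:
  "G \<subseteq> carrier R \<Longrightarrow> submodule (imul R M G (carrier M)) R M"
  by (rule imul_submodule) auto

lemma imul_insertD:
  assumes "insert g G \<subseteq> carrier R" "x \<in> imul R M (insert g G) (carrier M)"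
  shows "\<exists>y\<in>carrier M. \<exists>b\<in>imul R M G (carrier M). x = g \<odot>\<^bsub>M\<^esub> y \<oplus>\<^bsub>M\<^esub> b"
proof -
  let ?N = "imul R M G (carrier M)"
  have N: "submodule ?N R M" using assms(1) by (intro multiples_submodule) auto
  have g: "g \<in> carrier R" using assms(1) by auto
  let ?S = "{g \<odot>\<^bsub>M\<^esub> y \<oplus>\<^bsub>M\<^esub> b | y b. y \<in> carrier M \<and> b \<in> ?N}"
  note Nc = submodule_sub[OF N]
  have S: "submodule ?S R M"
  proof (rule submodule_test)
    show "?S \<subseteq> carrier M" using g Nc by auto
    show "\<zero>\<^bsub>M\<^esub> \<in> ?S" using g submodule_zero[OF N] by (intro CollectI exI[of _ "\<zero>\<^bsub>M\<^esub>"]) auto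
  next
    fix u v assume "u \<in> ?S" "v \<in> ?S"
    then obtain y b y' b' where *: "y \<in> carrier M" "b \<in> ?N" "u = g \<odot>\<^bsub>M\<^esub> y \<oplus>\<^bsub>M\<^esub> b"
      "y' \<in> carrier M" "b' \<in> ?N" "v = g \<odot>\<^bsub>M\<^esub> y' \<oplus>\<^bsub>M\<^esub> b'" by blast
    then have "u \<oplus>\<^bsub>M\<^esub> v = g \<odot>\<^bsub>M\<^esub> (y \<oplus>\<^bsub>M\<^esub> y') \<oplus>\<^bsub>M\<^esub> (b \<oplus>\<^bsub>M\<^esub> b')" using g Nc by (simp add: smult_r_distr M.a_ac)
    then show "u \<oplus>\<^bsub>M\<^esub> v \<in> ?S" using * submodule_add[OF N] by blast
  next
    fix r u assume r: "r \<in> carrier R" and "u \<in> ?S"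
    then obtain y b where *: "y \<in> carrier M" "b \<in> ?N" "u = g \<odot>\<^bsub>M\<^esub> y \<oplus>\<^bsub>M\<^esub> b" by blast
    then have "r \<odot>\<^bsub>M\<^esub> u = g \<odot>\<^bsub>M\<^esub> (r \<odot>\<^bsub>M\<^esub> y) \<oplus>\<^bsub>M\<^esub> r \<odot>\<^bsub>M\<^esub> b"
      using g r Nc by (simp add: smult_r_distr smult_assoc1[symmetric] R.m_comm)
    then show "r \<odot>\<^bsub>M\<^esub> u \<in> ?S" using * r submodule_smult[OF N] by blast
  qed
  have "imul R M (insert g G) (carrier M) \<subseteq> ?S"
  proof (rule imul_least[OF S])
    fix a w assume aw: "a \<in> insert g G" "w \<in> carrier M"
    show "a \<odot>\<^bsub>M\<^esub> w \<in> ?S"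
    proof (cases "a = g")
      case True
      then show ?thesis using aw g submodule_zero[OF N] by (intro CollectI exI[of _ w] exI[of _ "\<zero>\<^bsub>M\<^esub>"]) auto
    next
      case False
      then have "a \<odot>\<^bsub>M\<^esub> w \<in> ?N" using aw by (intro imul_base) auto
      then show ?thesis using g Nc
        by (intro CollectI exI[of _ "\<zero>\<^bsub>M\<^esub>"] exI[of _ "a \<odot>\<^bsub>M\<^esub> w"]) auto
    qed
  qed
  then show ?thesis using assms(2) by blast
qed

text \<open>The predicate \<open>P\<close> stands for membership of the class of a cocycle in a submodule of \<open>H\<^sup>i(M)\<close> that contains all
multiples of classes by elements of \<open>p\<close>. If \<open>H\<^bsup>i+1\<^esup>\<close> vanishes on submodules of \<open>M\<close>, a class that comes
from \<open>gM + N\<close> is the sum of \<open>g\<close> times a class of \<open>M\<close> and a class that comes from \<open>N\<close>: with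
\<open>K = {x | gx \<in> N}\<close>, the obstruction to lifting it along \<open>M \<longrightarrow> M/K \<cong> (gM + N)/N\<close> lies in \<open>H\<^bsup>i+1\<^esup>(K)\<close>.
Induction on the number of generators treats \<open>N = \<Sum> gM\<close>.\<close>

lemma classes_of_multiples:
  fixes P :: "nat \<Rightarrow> (('a, 'a set) syz \<Rightarrow> 'c) \<Rightarrow> bool"
  assumes top: "\<And>K. submodule K R M \<Longrightarrow> lc_vanishes R \<aa> M (Suc i) K {\<zero>\<^bsub>M\<^esub>}"
    and P_pull: "\<And>n m \<phi>. 1 \<le> n \<Longrightarrow> n \<le> m \<Longrightarrow> \<phi> \<in> cocyc R M (Q n) (carrier M) {\<zero>\<^bsub>M\<^esub>} i \<Longrightarrow> P m (pull n i \<phi>) \<Longrightarrow> P n \<phi>"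
    and P_cobd: "\<And>n \<phi>. 1 \<le> n \<Longrightarrow> \<phi> \<in> cocyc R M (Q n) (carrier M) {\<zero>\<^bsub>M\<^esub>} i \<Longrightarrow> \<phi> \<in> cobd R M (Q n) (carrier M) {\<zero>\<^bsub>M\<^esub>} i \<Longrightarrow> P n \<phi>"
    and P_add: "\<And>n \<phi> \<phi>' \<phi>''. 1 \<le> n \<Longrightarrow> \<phi> \<in> cocyc R M (Q n) (carrier M) {\<zero>\<^bsub>M\<^esub>} i \<Longrightarrow>
      \<phi>' \<in> cocyc R M (Q n) (carrier M) {\<zero>\<^bsub>M\<^esub>} i \<Longrightarrow> \<phi>'' \<in> cocyc R M (Q n) (carrier M) {\<zero>\<^bsub>M\<^esub>} i \<Longrightarrow> P n \<phi> \<Longrightarrow> P n \<phi>' \<Longrightarrow>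
      (\<And>s. s \<in> res_basis R (Q n) i \<Longrightarrow> \<phi>'' s = \<phi> s \<oplus>\<^bsub>M\<^esub> \<phi>' s) \<Longrightarrow> P n \<phi>''"
    and P_smult: "\<And>n \<phi> g. 1 \<le> n \<Longrightarrow> \<phi> \<in> cocyc R M (Q n) (carrier M) {\<zero>\<^bsub>M\<^esub>} i \<Longrightarrow> g \<in> p \<Longrightarrow> P n (\<lambda>s. g \<odot>\<^bsub>M\<^esub> \<phi> s)"
    and pR: "p \<subseteq> carrier R"
    and G: "finite G" "G \<subseteq> p" and n: "1 \<le> n"
    and \<theta>: "\<theta> \<in> cocyc R M (Q n) (carrier M) {\<zero>\<^bsub>M\<^esub>} i" "\<theta> \<in> res_basis R (Q n) i \<rightarrow> imul R M G (carrier M)"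
  shows "P n \<theta>"
  using G n \<theta>
proof (induction G arbitrary: n \<theta> rule: finite_induct)
  case empty
  note Z = submodule_zero_set and MM = carrier_is_submodule
  have "imul R M {} (carrier M) \<subseteq> {\<zero>\<^bsub>M\<^esub>}" by (rule imul_least[OF Z]) auto
  then have "\<theta> \<in> res_basis R (Q n) i \<rightarrow> {\<zero>\<^bsub>M\<^esub>}" using empty.prems(4) by blast
  then show ?case using P_cobd[OF empty.prems(2,3)] cobd_of_values[OF MM Z] by blast
next
  case (insert g G)
  note Z = submodule_zero_set and MM = carrier_is_submodule
  let ?N = "imul R M G (carrier M)"
  have GR: "insert g G \<subseteq> carrier R" and g: "g \<in> carrier R" "g \<in> p" using insert.prems(1) pR by auto
  have N: "submodule ?N R M" using GR by (intro multiples_submodule) auto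
  note Nc = submodule_sub[OF N]
  note \<theta> = insert.prems(3)
  note \<theta>M = cocyc_carrier[OF MM \<theta>]
  have "\<forall>s\<in>res_basis R (Q n) i. \<exists>y. y \<in> carrier M \<and> (\<exists>b\<in>?N. \<theta> s = g \<odot>\<^bsub>M\<^esub> y \<oplus>\<^bsub>M\<^esub> b)"
    using imul_insertD[OF GR] insert.prems(4) by blast
  then obtain y where y: "\<And>s. s \<in> res_basis R (Q n) i \<Longrightarrow> y s \<in> carrier M"
    "\<And>s. s \<in> res_basis R (Q n) i \<Longrightarrow> \<exists>b\<in>?N. \<theta> s = g \<odot>\<^bsub>M\<^esub> y s \<oplus>\<^bsub>M\<^esub> b" by metis
  have yM: "y \<in> res_basis R (Q n) i \<rightarrow> carrier M" using y(1) by auto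
  have gyM: "(\<lambda>s. g \<odot>\<^bsub>M\<^esub> y s) \<in> res_basis R (Q n) i \<rightarrow> carrier M" using y(1) g by auto
  have b: "\<theta> s \<ominus>\<^bsub>M\<^esub> g \<odot>\<^bsub>M\<^esub> y s \<in> ?N" if s: "s \<in> res_basis R (Q n) i" for s
  proof -
    obtain c where "c \<in> ?N" "\<theta> s = g \<odot>\<^bsub>M\<^esub> y s \<oplus>\<^bsub>M\<^esub> c" using y(2)[OF s] by auto
    then show ?thesis using diff_add_left[of "g \<odot>\<^bsub>M\<^esub> y s" c] y(1)[OF s] g Nc by simp
  qed
  \<comment> \<open>the function \<open>y\<close> lifts the class modulo \<open>N\<close>, and its failure to be a cocycle has values in \<open>K\<close>\<close>
  define K where "K = {x \<in> carrier M. g \<odot>\<^bsub>M\<^esub> x \<in> ?N}"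
  have K: "submodule K R M"
  proof (rule submodule_test)
    fix r x assume r: "r \<in> carrier R" "x \<in> K"
    then have "g \<odot>\<^bsub>M\<^esub> (r \<odot>\<^bsub>M\<^esub> x) = r \<odot>\<^bsub>M\<^esub> (g \<odot>\<^bsub>M\<^esub> x)"
      using g by (simp add: K_def smult_assoc1[symmetric] R.m_comm)
    then show "r \<odot>\<^bsub>M\<^esub> x \<in> K" using r submodule_smult[OF N] by (simp add: K_def)
  qed (use g submodule_zero[OF N] in \<open>auto simp: K_def smult_r_distr intro: submodule_add[OF N]\<close>)
  have dK: "dif R M y s \<in> K" if s: "s \<in> res_basis R (Q n) (Suc i)" for s
  proof -
    have c: "dif R M y s \<in> carrier M" by (rule dif_closed[OF yM MM s])
    have "dif R M (\<lambda>s. \<theta> s \<ominus>\<^bsub>M\<^esub> g \<odot>\<^bsub>M\<^esub> y s) s \<in> ?N" by (rule dif_closed[OF _ N s]) (use b in auto)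
    then have "dif R M \<theta> s \<ominus>\<^bsub>M\<^esub> g \<odot>\<^bsub>M\<^esub> dif R M y s \<in> ?N"
      using dif_minus[OF \<theta>M gyM s] dif_smult[OF yM g(1) s] by simp
    moreover have "dif R M \<theta> s \<in> ?N" using \<theta> s submodule_zero[OF N] by (auto simp: cocyc_def)
    ultimately have "g \<odot>\<^bsub>M\<^esub> dif R M y s \<in> ?N" by (rule submodule_diffD'[OF N]) (use c g in auto)
    then show ?thesis using c by (simp add: K_def)
  qed
  have "dif R M y \<in> cocyc R M (Q n) K {\<zero>\<^bsub>M\<^esub>} (Suc i)"
    using cocyc_dif[OF MM Z yM] dK by (simp add: cocyc_def)
  then obtain m where m: "m \<ge> n" "pull n (Suc i) (dif R M y) \<in> cobd R M (Q m) K {\<zero>\<^bsub>M\<^esub>} (Suc i)"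
    using top[OF K, unfolded lc_vanishes_def] insert.prems(2) by blast
  then obtain \<omega> where \<omega>: "\<omega> \<in> res_basis R (Q m) i \<rightarrow> K"
    "\<And>s. s \<in> res_basis R (Q m) (Suc i) \<Longrightarrow> pull n (Suc i) (dif R M y) s \<ominus>\<^bsub>M\<^esub> dif R M \<omega> s = \<zero>\<^bsub>M\<^esub>" by auto
  note \<omega>M = submodule_funcset[OF K \<omega>(1)]
  note pyM = pull_carrier[OF m(1) yM]
  define \<theta>' where "\<theta>' = (\<lambda>s. pull n i y s \<ominus>\<^bsub>M\<^esub> \<omega> s)"
  have \<theta>': "\<theta>' \<in> cocyc R M (Q m) (carrier M) {\<zero>\<^bsub>M\<^esub>} i"
  proof -
    have "dif R M \<theta>' s = \<zero>\<^bsub>M\<^esub>" if s: "s \<in> res_basis R (Q m) (Suc i)" for s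
      unfolding \<theta>'_def dif_minus[OF pyM \<omega>M s] pull_difQ[OF m(1) yM s] by (rule \<omega>(2)[OF s])
    moreover have "\<theta>' \<in> res_basis R (Q m) i \<rightarrow> carrier M" using pyM \<omega>M by (auto simp: \<theta>'_def Pi_def)
    ultimately show ?thesis by (simp add: cocyc_def)
  qed
  note \<theta>'M = cocyc_carrier[OF MM \<theta>']
  have g\<theta>': "(\<lambda>s. g \<odot>\<^bsub>M\<^esub> \<theta>' s) \<in> cocyc R M (Q m) (carrier M) {\<zero>\<^bsub>M\<^esub>} i" by (rule cocyc_smult[OF MM Z g(1) \<theta>'])
  have p\<theta>: "pull n i \<theta> \<in> cocyc R M (Q m) (carrier M) {\<zero>\<^bsub>M\<^esub>} i" by (rule pull_cocycQ[OF m(1) MM Z \<theta>])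
  define \<eta> where "\<eta> = (\<lambda>s. pull n i \<theta> s \<ominus>\<^bsub>M\<^esub> g \<odot>\<^bsub>M\<^esub> \<theta>' s)"
  have \<eta>: "\<eta> \<in> cocyc R M (Q m) (carrier M) {\<zero>\<^bsub>M\<^esub>} i" unfolding \<eta>_def by (rule cocyc_minus[OF MM Z p\<theta> g\<theta>'])
  have m1: "1 \<le> m" using m(1) insert.prems(2) by simp
  have "\<eta> \<in> res_basis R (Q m) i \<rightarrow> ?N"
  proof
    fix s assume s: "s \<in> res_basis R (Q m) i"
    let ?t = "pull n i \<theta> s" and ?y = "pull n i y s"
    have c: "?t \<in> carrier M" "?y \<in> carrier M" "\<omega> s \<in> carrier M" "g \<odot>\<^bsub>M\<^esub> \<omega> s \<in> ?N"
      using pull_carrier[OF m(1) \<theta>M] pyM \<omega>M \<omega>(1) s by (auto simp: K_def Pi_def)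
    have "\<eta> s = (?t \<ominus>\<^bsub>M\<^esub> g \<odot>\<^bsub>M\<^esub> ?y) \<oplus>\<^bsub>M\<^esub> g \<odot>\<^bsub>M\<^esub> \<omega> s"
      using c g by (simp add: \<eta>_def \<theta>'_def a_minus_def smult_r_distr smult_r_minus M.minus_add M.minus_minus M.a_assoc)
    then show "\<eta> s \<in> ?N" using submodule_add[OF N b[OF basis_map[OF m(1) s]] c(4)] by simp
  qed
  then have 1: "P m \<eta>" using insert.IH[OF _ m1 \<eta>] insert.prems(1) by auto
  have 2: "P m (\<lambda>s. g \<odot>\<^bsub>M\<^esub> \<theta>' s)" by (rule P_smult[OF m1 \<theta>' g(2)])
  have "P m (pull n i \<theta>)"
  proof (rule P_add[OF m1 \<eta> g\<theta>' p\<theta> 1 2])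
    fix s assume s: "s \<in> res_basis R (Q m) i"
    show "pull n i \<theta> s = \<eta> s \<oplus>\<^bsub>M\<^esub> g \<odot>\<^bsub>M\<^esub> \<theta>' s"
      unfolding \<eta>_def by (rule minus_conv) (use pull_carrier[OF m(1) \<theta>M] \<theta>'M g s in auto)
  qed
  then show ?case by (rule P_pull[OF insert.prems(2) m(1) \<theta>])
qed

end

section \<open>Ext in terms of cochains on bases\<close>

lemma hom_carrier_iff:
  "f \<in> carrier (hom_module R N M) \<longleftrightarrow> f \<in> extensional (carrier N) \<and> f \<in> mod_hom R N M"
  by (auto simp: hom_module_def mod_hom_def PiE_def)

lemma hom_module_simps:
  "zero (hom_module R N M) = (\<lambda>x\<in>carrier N. \<zero>\<^bsub>M\<^esub>)"
  "add (hom_module R N M) = (\<lambda>f g. \<lambda>x\<in>carrier N. f x \<oplus>\<^bsub>M\<^esub> g x)"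
  "smult (hom_module R N M) = (\<lambda>r f. \<lambda>x\<in>carrier N. r \<odot>\<^bsub>M\<^esub> f x)"
  by (simp_all add: hom_module_def)

context module begin

lemma hom_pointwise:
  assumes N: "module R N"
  shows "f \<in> mod_hom R N M \<Longrightarrow> g \<in> mod_hom R N M \<Longrightarrow> (\<lambda>x\<in>carrier N. f x \<oplus>\<^bsub>M\<^esub> g x) \<in> mod_hom R N M"
    and "r \<in> carrier R \<Longrightarrow> f \<in> mod_hom R N M \<Longrightarrow> (\<lambda>x\<in>carrier N. r \<odot>\<^bsub>M\<^esub> f x) \<in> mod_hom R N M"
    and "(\<lambda>x\<in>carrier N. \<zero>\<^bsub>M\<^esub>) \<in> mod_hom R N M"
proof -
  interpret N: module R N by (rule N)
  show "(\<lambda>x\<in>carrier N. f x \<oplus>\<^bsub>M\<^esub> g x) \<in> mod_hom R N M" if fg: "f \<in> mod_hom R N M" "g \<in> mod_hom R N M"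
    by (rule mod_homI) (use mod_homD[OF fg(1)] mod_homD[OF fg(2)] in \<open>simp_all add: M.a_ac smult_r_distr\<close>)
  show "(\<lambda>x\<in>carrier N. r \<odot>\<^bsub>M\<^esub> f x) \<in> mod_hom R N M" if r: "r \<in> carrier R" and f: "f \<in> mod_hom R N M"
    by (rule mod_homI)
      (use mod_homD[OF f] r in \<open>simp_all add: smult_r_distr smult_assoc1[symmetric] R.m_comm\<close>)
  show "(\<lambda>x\<in>carrier N. \<zero>\<^bsub>M\<^esub>) \<in> mod_hom R N M" by (rule mod_homI) simp_all
qed

lemma module_hom_module:
  assumes N: "module R N"
  shows "module R (hom_module R N M)"
proof -
  interpret N: module R N by (rule N)
  note simps = hom_module_simps hom_carrier_iff
  have hv: "f x \<in> carrier M" if "f \<in> mod_hom R N M" "x \<in> carrier N" for f x using mod_homD(1)[OF that] .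
  show ?thesis
  proof (rule moduleI)
    show "cring R" by (rule R.is_cring)
    show "abelian_group (hom_module R N M)"
    proof (rule abelian_groupI)
      fix f assume f: "f \<in> carrier (hom_module R N M)"
      show "\<zero>\<^bsub>hom_module R N M\<^esub> \<oplus>\<^bsub>hom_module R N M\<^esub> f = f"
        using f by (auto simp: simps hv intro!: extensionalityI[of _ "carrier N"])
      show "\<exists>g\<in>carrier (hom_module R N M). g \<oplus>\<^bsub>hom_module R N M\<^esub> f = \<zero>\<^bsub>hom_module R N M\<^esub>"
      proof (rule bexI)
        show "(\<lambda>x\<in>carrier N. (\<ominus> \<one>) \<odot>\<^bsub>M\<^esub> f x) \<in> carrier (hom_module R N M)"
          using f hom_pointwise(2)[OF N, of "\<ominus> \<one>" f] by (simp add: simps)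
        show "(\<lambda>x\<in>carrier N. (\<ominus> \<one>) \<odot>\<^bsub>M\<^esub> f x) \<oplus>\<^bsub>hom_module R N M\<^esub> f = \<zero>\<^bsub>hom_module R N M\<^esub>"
          using f by (auto simp: simps hv neg_conv_smult[symmetric] M.l_neg intro!: restrict_ext)
      qed
    qed (auto simp: simps hom_pointwise[OF N] hv M.a_ac intro!: restrict_ext)
  qed (auto simp: simps hom_pointwise[OF N] hv smult_l_distr smult_r_distr smult_assoc1
      intro!: restrict_ext extensionalityI[of _ "carrier N"])
qed

text \<open>The homomorphism with given values on the basis. The next lemmas translate the cochain modules
into functions on the bases, and \<open>Ext_class\<close> is the class of such a function in \<open>Ext\<close>.\<close>

definition cochain_of :: "('a, 'x, 'z) module_scheme \<Rightarrow> nat \<Rightarrow> (('a, 'x) syz \<Rightarrow> 'c) \<Rightarrow> (('a, 'x) syz \<Rightarrow> 'a) \<Rightarrow> 'c"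
  where "cochain_of N k c = (\<lambda>h\<in>carrier (res R N k). lin_ext R M c h)"

definition Ext_class ::
  "('a, 'x, 'z) module_scheme \<Rightarrow> nat \<Rightarrow> (('a, 'x) syz \<Rightarrow> 'c) \<Rightarrow> ((('a, 'x) syz \<Rightarrow> 'a) \<Rightarrow> 'c) set"
  where "Ext_class N k c = coboundaries R N M k +>\<^bsub>cochains R N M k\<^esub> cochain_of N k c"

context
  fixes N :: "('a, 'x, 'z) module_scheme"
  assumes N: "module R N"
begin

abbreviation Cz where "Cz \<equiv> cocyc R M N (carrier M) {\<zero>\<^bsub>M\<^esub>}"
abbreviation Bz where "Bz \<equiv> cobd R M N (carrier M) {\<zero>\<^bsub>M\<^esub>}"

lemma res_carrier: "carrier (res R N k) = carrier (free_module R (res_basis R N k))"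
  by (simp add: res_def)

lemma module_res: "module R (res R N k)"
  unfolding res_def by (rule module_free_module)

lemma module_cochains: "module R (cochains R N M k)"
  unfolding cochains_def by (rule module_hom_module[OF module_res])

lemma cochain_of_carrier:
  assumes "c \<in> res_basis R N k \<rightarrow> carrier M"
  shows "cochain_of N k c \<in> carrier (cochains R N M k)"
  unfolding cochains_def hom_carrier_iff cochain_of_def
  using mod_hom_cong[OF lin_ext_hom[OF assms] _ module_free_module]
  by (auto simp: res_def)

lemma cochain_of_delta:
  assumes "c \<in> res_basis R N k \<rightarrow> carrier M" "s \<in> res_basis R N k"
  shows "cochain_of N k c (delta R s) = c s"
  using lin_ext_delta[OF assms(2,1)] assms(2) by (simp add: cochain_of_def res_carrier)

lemma cochain_rep:
  assumes "f \<in> carrier (cochains R N M k)"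
  obtains c where "c \<in> res_basis R N k \<rightarrow> carrier M" "f = cochain_of N k c"
proof
  have f: "f \<in> extensional (carrier (res R N k))" "f \<in> mod_hom R (res R N k) M"
    using assms by (auto simp: cochains_def hom_carrier_iff)
  show "(\<lambda>s. f (delta R s)) \<in> res_basis R N k \<rightarrow> carrier M"
    using mod_homD(1)[OF f(2)] by (auto simp: res_carrier)
  show "f = cochain_of N k (\<lambda>s. f (delta R s))"
    using f hom_free_expand[of f "res_basis R N k"]
    by (intro extensionalityI[OF f(1)]) (auto simp: cochain_of_def res_def)
qed

lemma cochain_of_eq_iff:
  assumes "c \<in> res_basis R N k \<rightarrow> carrier M" "c' \<in> res_basis R N k \<rightarrow> carrier M"
  shows "cochain_of N k c = cochain_of N k c' \<longleftrightarrow> (\<forall>s\<in>res_basis R N k. c s = c' s)"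
proof
  assume "cochain_of N k c = cochain_of N k c'"
  then show "\<forall>s\<in>res_basis R N k. c s = c' s" using cochain_of_delta[OF assms(1)] cochain_of_delta[OF assms(2)] by metis
next
  assume *: "\<forall>s\<in>res_basis R N k. c s = c' s"
  show "cochain_of N k c = cochain_of N k c'"
    unfolding cochain_of_def by (rule restrict_ext) (use lin_ext_cong[OF _ assms(1)] * in \<open>auto simp: res_carrier\<close>)
qed

lemma cochain_of_add:
  assumes "c \<in> res_basis R N k \<rightarrow> carrier M" "c' \<in> res_basis R N k \<rightarrow> carrier M"
  shows "cochain_of N k c \<oplus>\<^bsub>cochains R N M k\<^esub> cochain_of N k c' = cochain_of N k (\<lambda>s. c s \<oplus>\<^bsub>M\<^esub> c' s)"
  unfolding cochains_def hom_module_simps cochain_of_def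
  by (rule restrict_ext) (use lin_ext_fun_add[OF _ assms] in \<open>simp add: res_carrier\<close>)

lemma cochain_of_smult:
  assumes "c \<in> res_basis R N k \<rightarrow> carrier M" "r \<in> carrier R"
  shows "r \<odot>\<^bsub>cochains R N M k\<^esub> cochain_of N k c = cochain_of N k (\<lambda>s. r \<odot>\<^bsub>M\<^esub> c s)"
  unfolding cochains_def hom_module_simps cochain_of_def
  by (rule restrict_ext) (use lin_ext_fun_smult[OF _ assms] in \<open>simp add: res_carrier\<close>)

lemma cochain_of_zero: "cochain_of N k (\<lambda>s. \<zero>\<^bsub>M\<^esub>) = \<zero>\<^bsub>cochains R N M k\<^esub>"
  unfolding cochains_def hom_module_simps cochain_of_def
  by (rule restrict_ext) (use lin_ext_submodule[OF _ _ submodule_zero_set] in \<open>force simp: res_carrier\<close>)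

lemma coboundary_map_cochain_of:
  assumes "c \<in> res_basis R N k \<rightarrow> carrier M"
  shows "coboundary_map R N k (cochain_of N k c) = cochain_of N (Suc k) (dif R M c)"
  unfolding coboundary_map_def cochain_of_def
  by (rule restrict_ext) (use lin_ext_dif[OF assms] res_diff_closed[of _ N k] in \<open>simp add: res_carrier\<close>)

lemma dif_carrier: "c \<in> res_basis R N k \<rightarrow> carrier M \<Longrightarrow> dif R M c \<in> res_basis R N (Suc k) \<rightarrow> carrier M"
  using dif_closed[OF _ carrier_is_submodule] by auto

lemma CzD: "c \<in> Cz k \<Longrightarrow> c \<in> res_basis R N k \<rightarrow> carrier M"
  by (auto simp: cocyc_def)

lemma cochain_of_cocycle_iff:
  assumes "c \<in> res_basis R N k \<rightarrow> carrier M"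
  shows "cochain_of N k c \<in> cocycles R N M k \<longleftrightarrow> c \<in> Cz k"
  unfolding cocycles_def mem_Collect_eq coboundary_map_cochain_of[OF assms] cochain_of_zero[symmetric]
  using cochain_of_carrier[OF assms] cochain_of_eq_iff[OF dif_carrier[OF assms], of "\<lambda>s. \<zero>\<^bsub>M\<^esub>"] assms by (auto simp: cocyc_def)

lemma cochain_of_coboundary_iff:
  assumes c: "c \<in> res_basis R N k \<rightarrow> carrier M"
  shows "cochain_of N k c \<in> coboundaries R N M k \<longleftrightarrow> c \<in> Bz k"
proof (cases k)
  case 0
  then show ?thesis using cochain_of_eq_iff[OF c, of "\<lambda>s. \<zero>\<^bsub>M\<^esub>"] by (simp add: cochain_of_zero)
next
  case (Suc j)
  have "cochain_of N k c \<in> coboundaries R N M k \<longleftrightarrow> (\<exists>\<psi>\<in>res_basis R N j \<rightarrow> carrier M. cochain_of N k c = cochain_of N k (dif R M \<psi>))"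
  proof
    assume "cochain_of N k c \<in> coboundaries R N M k"
    then obtain f where "f \<in> carrier (cochains R N M j)" "cochain_of N k c = coboundary_map R N j f" using Suc by auto
    then show "\<exists>\<psi>\<in>res_basis R N j \<rightarrow> carrier M. cochain_of N k c = cochain_of N k (dif R M \<psi>)"
      using coboundary_map_cochain_of Suc by (metis cochain_rep)
  next
    assume "\<exists>\<psi>\<in>res_basis R N j \<rightarrow> carrier M. cochain_of N k c = cochain_of N k (dif R M \<psi>)"
    then show "cochain_of N k c \<in> coboundaries R N M k"
      using coboundary_map_cochain_of cochain_of_carrier Suc by (auto intro!: image_eqI)
  qed
  also have "\<dots> \<longleftrightarrow> (\<exists>\<psi>\<in>res_basis R N j \<rightarrow> carrier M. \<forall>s\<in>res_basis R N k. c s = dif R M \<psi> s)"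
    using cochain_of_eq_iff[OF c] dif_carrier[of _ j] Suc by blast
  also have "\<dots> \<longleftrightarrow> c \<in> Bz k"
  proof -
    have "c s = dif R M \<psi> s \<longleftrightarrow> c s \<ominus>\<^bsub>M\<^esub> dif R M \<psi> s = \<zero>\<^bsub>M\<^esub>"
      if "\<psi> \<in> res_basis R N j \<rightarrow> carrier M" "s \<in> res_basis R N k" for \<psi> s
    proof -
      have "c s \<in> carrier M" "dif R M \<psi> s \<in> carrier M" using c dif_carrier[OF that(1)] that(2) Suc by auto
      then show ?thesis using minus_conv[of "c s" "dif R M \<psi> s"] by (auto simp: a_minus_def M.r_neg)
    qed
    then show ?thesis using Suc by auto
  qed
  finally show ?thesis .
qed

lemma cocycles_submodule: "submodule (cocycles R N M k) R (cochains R N M k)"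
proof -
  interpret C: module R "cochains R N M k" by (rule module_cochains)
  note Z = submodule_zero_set and MM = carrier_is_submodule
  have rep: "\<exists>c. c \<in> Cz k \<and> f = cochain_of N k c" if "f \<in> cocycles R N M k" for f
    using that cochain_rep[of f k] cochain_of_cocycle_iff[of _ k] by (metis (no_types, lifting) cocycles_def mem_Collect_eq)
  have cochain_of: "c \<in> Cz k \<Longrightarrow> cochain_of N k c \<in> cocycles R N M k" for c using cochain_of_cocycle_iff[OF CzD] by blast
  show ?thesis
  proof (rule C.submodule_test)
    show "cocycles R N M k \<subseteq> carrier (cochains R N M k)" by (auto simp: cocycles_def)
    show "\<zero>\<^bsub>cochains R N M k\<^esub> \<in> cocycles R N M k"
      unfolding cochain_of_zero[symmetric] by (rule cochain_of[OF cocyc_zero[OF Z]])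
  next
    fix f g assume "f \<in> cocycles R N M k" "g \<in> cocycles R N M k"
    then obtain c c' where "c \<in> Cz k" "f = cochain_of N k c" "c' \<in> Cz k" "g = cochain_of N k c'" using rep by metis
    then show "f \<oplus>\<^bsub>cochains R N M k\<^esub> g \<in> cocycles R N M k"
      using cochain_of_add[OF CzD CzD] cochain_of[OF cocyc_add[OF MM Z]] by simp
  next
    fix r f assume "r \<in> carrier R" "f \<in> cocycles R N M k"
    then obtain c where "r \<in> carrier R" "c \<in> Cz k" "f = cochain_of N k c" using rep by metis
    then show "r \<odot>\<^bsub>cochains R N M k\<^esub> f \<in> cocycles R N M k"
      using cochain_of_smult[OF CzD] cochain_of[OF cocyc_smult[OF MM Z]] by simp
  qed
qed

abbreviation Zm where "Zm k \<equiv> cochains R N M k\<lparr>carrier := cocycles R N M k\<rparr>"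

lemma module_Zm: "module R (Zm k)"
  by (rule submodule.submodule_is_module[OF cocycles_submodule module_cochains])

lemma Bz_Cz: "c \<in> res_basis R N k \<rightarrow> carrier M \<Longrightarrow> c \<in> Bz k \<Longrightarrow> c \<in> Cz k"
proof -
  assume c: "c \<in> res_basis R N k \<rightarrow> carrier M" and b: "c \<in> Bz k"
  note Z = submodule_zero_set and MM = carrier_is_submodule
  show "c \<in> Cz k"
  proof (cases k)
    case 0
    then have "\<forall>s\<in>res_basis R N k. \<zero>\<^bsub>M\<^esub> = c s" using b by auto
    then show ?thesis
      using cocyc_zero[OF Z, of N k] dif_cong[of "\<lambda>s. \<zero>\<^bsub>M\<^esub>" N k c] c by (auto simp: cocyc_def)
  next
    case (Suc j)
    then obtain \<psi> where \<psi>: "\<psi> \<in> res_basis R N j \<rightarrow> carrier M" "cochain_of N k c = cochain_of N k (dif R M \<psi>)"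
      using b cochain_of_coboundary_iff[OF c] coboundary_map_cochain_of by (auto elim!: cochain_rep)
    then show ?thesis
      using cocyc_dif[OF MM Z \<psi>(1)] cochain_of_cocycle_iff[OF c] cochain_of_cocycle_iff[OF dif_carrier[OF \<psi>(1)]] Suc by simp
  qed
qed

lemma coboundary_rep:
  assumes "f \<in> coboundaries R N M k"
  obtains c where "c \<in> Cz k" "c \<in> Bz k" "f = cochain_of N k c"
proof -
  have "f \<in> carrier (cochains R N M k)"
  proof (cases k)
    case 0
    then show ?thesis using assms cochain_of_zero[of 0] cochain_of_carrier[of "\<lambda>s. \<zero>\<^bsub>M\<^esub>" 0] by auto
  next
    case (Suc j)
    then obtain g where "g \<in> carrier (cochains R N M j)" "f = coboundary_map R N j g" using assms by auto
    then show ?thesis using Suc coboundary_map_cochain_of dif_carrier cochain_of_carrier by (metis cochain_rep)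
  qed
  then obtain c where c: "c \<in> res_basis R N k \<rightarrow> carrier M" "f = cochain_of N k c" by (rule cochain_rep)
  then have "c \<in> Bz k" using cochain_of_coboundary_iff[OF c(1)] assms by simp
  then show thesis using that Bz_Cz[OF c(1)] c(2) by blast
qed

lemma coboundaries_submodule: "submodule (coboundaries R N M k) R (Zm k)"
proof -
  interpret Z: module R "Zm k" by (rule module_Zm)
  note Z = submodule_zero_set and MM = carrier_is_submodule
  have cochain_of: "c \<in> Bz k \<Longrightarrow> c \<in> res_basis R N k \<rightarrow> carrier M \<Longrightarrow> cochain_of N k c \<in> coboundaries R N M k" for c
    using cochain_of_coboundary_iff by blast
  show ?thesis
  proof (rule Z.submodule_test)
    show "coboundaries R N M k \<subseteq> carrier (Zm k)"
    proof
      fix f assume "f \<in> coboundaries R N M k"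
      then obtain c where c: "c \<in> Cz k" "f = cochain_of N k c" by (rule coboundary_rep)
      then show "f \<in> carrier (Zm k)" using cochain_of_cocycle_iff[OF CzD[OF c(1)]] by simp
    qed
    have "(\<lambda>s. \<zero>\<^bsub>M\<^esub>) \<in> Bz k" by (rule cobd_of_values[OF MM Z]) auto
    then show "\<zero>\<^bsub>Zm k\<^esub> \<in> coboundaries R N M k" using cochain_of[of "\<lambda>s. \<zero>\<^bsub>M\<^esub>"] by (simp add: cochain_of_zero)
  next
    fix f g assume fg: "f \<in> coboundaries R N M k" "g \<in> coboundaries R N M k"
    obtain c where c: "c \<in> Cz k" "c \<in> Bz k" "f = cochain_of N k c" using coboundary_rep[OF fg(1)] .
    obtain c' where c': "c' \<in> Cz k" "c' \<in> Bz k" "g = cochain_of N k c'" using coboundary_rep[OF fg(2)] .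
    have "(\<lambda>s. c s \<oplus>\<^bsub>M\<^esub> c' s) \<in> Bz k"
      by (rule cobd_add[OF MM Z CzD[OF c(1)] CzD[OF c'(1)] c(2) c'(2)])
    then show "f \<oplus>\<^bsub>Zm k\<^esub> g \<in> coboundaries R N M k"
      using cochain_of CzD[OF cocyc_add[OF MM Z c(1) c'(1)]] cochain_of_add[OF CzD[OF c(1)] CzD[OF c'(1)]] c c' by simp
  next
    fix r f assume r: "r \<in> carrier R" and f: "f \<in> coboundaries R N M k"
    obtain c where c: "c \<in> Cz k" "c \<in> Bz k" "f = cochain_of N k c" using coboundary_rep[OF f] .
    have "(\<lambda>s. r \<odot>\<^bsub>M\<^esub> c s) \<in> Bz k" by (rule cobd_smult[OF MM Z r CzD[OF c(1)] c(2)])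
    then show "r \<odot>\<^bsub>Zm k\<^esub> f \<in> coboundaries R N M k"
      using cochain_of CzD[OF cocyc_smult[OF MM Z r c(1)]] cochain_of_smult[OF CzD[OF c(1)] r] c by simp
  qed
qed

lemma Ext_class_Zm: "Ext_class N k c = coboundaries R N M k +>\<^bsub>Zm k\<^esub> cochain_of N k c"
  by (simp add: Ext_class_def a_r_coset_def r_coset_def)

lemma module_Ext: "module R (Ext R k N M)"
  unfolding Ext_def by (rule module.module_quot[OF module_Zm coboundaries_submodule])

lemma Ext_carrier: "carrier (Ext R k N M) = Ext_class N k ` Cz k"
proof -
  have "carrier (Zm k) = cochain_of N k ` Cz k"
    using cochain_of_cocycle_iff[of _ k] CzD cochain_rep[of _ k]
    by (auto simp: image_iff) (metis (no_types, lifting) cocycles_def mem_Collect_eq)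
  then show ?thesis
    unfolding Ext_def module.quot_carrier[OF module_Zm coboundaries_submodule]
    by (simp add: image_image Ext_class_Zm)
qed

lemma cochain_of_Zm: "c \<in> Cz k \<Longrightarrow> cochain_of N k c \<in> carrier (Zm k)"
  using cochain_of_cocycle_iff[OF CzD] by simp

lemma Ext_class_add:
  assumes "c \<in> Cz k" "c' \<in> Cz k"
  shows "Ext_class N k c \<oplus>\<^bsub>Ext R k N M\<^esub> Ext_class N k c' = Ext_class N k (\<lambda>s. c s \<oplus>\<^bsub>M\<^esub> c' s)"
  unfolding Ext_def Ext_class_Zm module.quot_add[OF module_Zm coboundaries_submodule cochain_of_Zm[OF assms(1)] cochain_of_Zm[OF assms(2)]]
  using cochain_of_add[OF CzD[OF assms(1)] CzD[OF assms(2)]] by simp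

lemma Ext_class_smult:
  assumes "c \<in> Cz k" "r \<in> carrier R"
  shows "r \<odot>\<^bsub>Ext R k N M\<^esub> Ext_class N k c = Ext_class N k (\<lambda>s. r \<odot>\<^bsub>M\<^esub> c s)"
  unfolding Ext_def Ext_class_Zm module.quot_smult[OF module_Zm coboundaries_submodule assms(2) cochain_of_Zm[OF assms(1)]]
  using cochain_of_smult[OF CzD[OF assms(1)] assms(2)] by simp

lemma Ext_class_zero_iff:
  assumes "c \<in> Cz k"
  shows "Ext_class N k c = \<zero>\<^bsub>Ext R k N M\<^esub> \<longleftrightarrow> c \<in> Bz k"
  unfolding Ext_def Ext_class_Zm module.quot_zero[OF module_Zm coboundaries_submodule]
    module.rcos_eq_self_iff[OF module_Zm coboundaries_submodule cochain_of_Zm[OF assms]]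
  by (rule cochain_of_coboundary_iff[OF CzD[OF assms]])

lemma Ext_class_cong:
  assumes "c \<in> Cz k" "c' \<in> Cz k" "(\<lambda>s. c s \<ominus>\<^bsub>M\<^esub> c' s) \<in> Bz k"
  shows "Ext_class N k c = Ext_class N k c'"
proof -
  interpret E: module R "Ext R k N M" by (rule module_Ext)
  note Z = submodule_zero_set and MM = carrier_is_submodule
  have d: "(\<lambda>s. c s \<ominus>\<^bsub>M\<^esub> c' s) \<in> Cz k" by (rule cocyc_minus[OF MM Z assms(1,2)])
  have "Ext_class N k c = Ext_class N k (\<lambda>s. (c s \<ominus>\<^bsub>M\<^esub> c' s) \<oplus>\<^bsub>M\<^esub> c' s)"
  proof -
    have "cochain_of N k c = cochain_of N k (\<lambda>s. (c s \<ominus>\<^bsub>M\<^esub> c' s) \<oplus>\<^bsub>M\<^esub> c' s)"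
      using CzD[OF assms(1)] CzD[OF assms(2)] minus_conv
      by (subst cochain_of_eq_iff) (auto simp: Pi_def)
    then show ?thesis by (simp add: Ext_class_def)
  qed
  also have "\<dots> = Ext_class N k (\<lambda>s. c s \<ominus>\<^bsub>M\<^esub> c' s) \<oplus>\<^bsub>Ext R k N M\<^esub> Ext_class N k c'" by (rule Ext_class_add[OF d assms(2), symmetric])
  also have "Ext_class N k (\<lambda>s. c s \<ominus>\<^bsub>M\<^esub> c' s) = \<zero>\<^bsub>Ext R k N M\<^esub>" using Ext_class_zero_iff[OF d] assms(3) by simp
  also have "\<zero>\<^bsub>Ext R k N M\<^esub> \<oplus>\<^bsub>Ext R k N M\<^esub> Ext_class N k c' = Ext_class N k c'"
    by (rule E.M.l_zero) (use assms(2) in \<open>auto simp: Ext_carrier\<close>)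
  finally show ?thesis .
qed

end

text \<open>The union that defines \<open>Ext_map\<close> ranges over all representatives of a class. They differ by
coboundaries, so all its members are the same coset.\<close>

lemma Ext_map_Ext_class:
  assumes N: "module R N" and N': "module R N'" and F: "F \<in> mod_hom R N N'"
    and c: "c \<in> cocyc R M N' (carrier M) {\<zero>\<^bsub>M\<^esub>} k"
  shows "Ext_map R k F N M (Ext_class N' k c) = Ext_class N k (\<lambda>s. c (res_basis_map R F k s))"
proof -
  note Z = submodule_zero_set and MM = carrier_is_submodule
  have pull: "(\<lambda>h\<in>carrier (res R N k). cochain_of N' k b (res_map R F k h)) = cochain_of N k (\<lambda>s. b (res_basis_map R F k s))"
    if b: "b \<in> res_basis R N' k \<rightarrow> carrier M" for b
    unfolding cochain_of_def
  proof (rule restrict_ext)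
    fix h assume "h \<in> carrier (res R N k)"
    then have h: "h \<in> carrier (free_module R (res_basis R N k))" by (simp add: res_def)
    note f = fmap_chain[OF N N' F, of k]
    note fk = chain_mapD(1)[OF f order_refl]
    have "lin_ext R (free_module R UNIV) (fmap R F k) h \<in> carrier (res R N' k)"
      using chain_map_closed[OF f order_refl h] by (simp add: res_def)
    moreover have "lin_ext R M b (lin_ext R (free_module R UNIV) (fmap R F k) h)
      = lin_ext R M (\<lambda>s. lin_ext R M b (fmap R F k s)) h"
      by (rule lin_ext_comp[OF b fk h])
    moreover have "\<dots> = lin_ext R M (\<lambda>s. b (res_basis_map R F k s)) h"
      by (rule lin_ext_cong[OF h]) (use lin_ext_fmap[OF N N' F b] lin_ext_closed[OF _ b] fk in auto)
    ultimately show "(\<lambda>h\<in>carrier (res R N' k). lin_ext R M b h) (res_map R F k h)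
      = lin_ext R M (\<lambda>s. b (res_basis_map R F k s)) h"
      by (simp add: res_map_def push_forward_fmap)
  qed
  have each: "coboundaries R N M k +>\<^bsub>cochains R N M k\<^esub> (\<lambda>h\<in>carrier (res R N k). f (res_map R F k h))
    = Ext_class N k (\<lambda>s. c (res_basis_map R F k s))" if "f \<in> Ext_class N' k c" for f
  proof -
    interpret Zm: module R "cochains R N' M k\<lparr>carrier := cocycles R N' M k\<rparr>" by (rule module_Zm[OF N'])
    have "f \<in> coboundaries R N' M k +>\<^bsub>cochains R N' M k\<lparr>carrier := cocycles R N' M k\<rparr>\<^esub> cochain_of N' k c"
      using that by (simp only: Ext_class_Zm[OF N'])
    then obtain g where g: "g \<in> coboundaries R N' M k" "f = g \<oplus>\<^bsub>cochains R N' M k\<^esub> cochain_of N' k c"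
      by (auto dest: iffD1[OF Zm.rcos_elem])
    obtain b where b: "b \<in> cocyc R M N' (carrier M) {\<zero>\<^bsub>M\<^esub>} k" "b \<in> cobd R M N' (carrier M) {\<zero>\<^bsub>M\<^esub>} k"
      "g = cochain_of N' k b" using coboundary_rep[OF N' g(1)] .
    note bM = CzD[OF N' b(1)] and cM = CzD[OF N' c]
    let ?s = "\<lambda>s. b s \<oplus>\<^bsub>M\<^esub> c s"
    have s: "?s \<in> cocyc R M N' (carrier M) {\<zero>\<^bsub>M\<^esub>} k" by (rule cocyc_add[OF MM Z b(1) c])
    have f: "f = cochain_of N' k ?s" using g b cochain_of_add[OF N' bM cM] by simp
    have p: "res_basis_map R F k \<in> res_basis R N k \<rightarrow> res_basis R N' k" by (rule res_basis_map_closed[OF N N' F])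
    have "Ext_class N k (\<lambda>s. ?s (res_basis_map R F k s)) = Ext_class N k (\<lambda>s. c (res_basis_map R F k s))"
    proof (rule Ext_class_cong[OF N pull_cocyc[OF N N' F MM Z s] pull_cocyc[OF N N' F MM Z c]])
      show "(\<lambda>s. ?s (res_basis_map R F k s) \<ominus>\<^bsub>M\<^esub> c (res_basis_map R F k s)) \<in> cobd R M N (carrier M) {\<zero>\<^bsub>M\<^esub>} k"
      proof (rule cobd_cong[OF pull_cobd[OF N N' F MM Z bM b(2)]])
        fix s assume "s \<in> res_basis R N k"
        then have "b (res_basis_map R F k s) \<in> carrier M" "c (res_basis_map R F k s) \<in> carrier M"
          using p bM cM by auto
        then show "b (res_basis_map R F k s) = ?s (res_basis_map R F k s) \<ominus>\<^bsub>M\<^esub> c (res_basis_map R F k s)"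
          by (simp add: diff_add_right)
      qed
    qed
    then show ?thesis unfolding f pull[OF CzD[OF N' s]] by (simp add: Ext_class_def)
  qed
  have "cochain_of N' k c \<in> Ext_class N' k c"
    using module.rcos_self[OF module_Zm[OF N'] coboundaries_submodule[OF N'] cochain_of_Zm[OF N' c]] by (simp add: Ext_class_Zm[OF N'])
  then show ?thesis unfolding Ext_map_def using each by blast
qed

end

section \<open>Direct limits\<close>

locale directed_system =
  fixes R :: "('r, 'c) ring_scheme" and E :: "nat \<Rightarrow> ('r, 'm, 'd) module_scheme"
    and t :: "nat \<Rightarrow> nat \<Rightarrow> 'm \<Rightarrow> 'm"
  assumes cring: "cring R"
    and mod: "1 \<le> n \<Longrightarrow> module R (E n)"
    and hom: "1 \<le> n \<Longrightarrow> n \<le> m \<Longrightarrow> t n m \<in> mod_hom R (E n) (E m)"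
    and comp: "1 \<le> n \<Longrightarrow> n \<le> m \<Longrightarrow> m \<le> k \<Longrightarrow> x \<in> carrier (E n) \<Longrightarrow> t m k (t n m x) = t n k x"
begin

definition rel where "rel = {((n, x), (m, y)). n \<in> {1..} \<and> m \<in> {1..} \<and> x \<in> carrier (E n) \<and> y \<in> carrier (E m) \<and>
           (\<exists>k\<in>{1..}. n \<le> k \<and> m \<le> k \<and> t n k x = t m k y)}"

definition lim where "lim n x = rel `` {(n, x)}"

definition D where "D = direct_limit {1..} E t"

lemma D_simps:
  "carrier D = (SIGMA n:{1..}. carrier (E n)) // rel"
  "zero D = {(n, x). n \<in> {1..} \<and> x \<in> carrier (E n) \<and> (\<exists>k\<in>{1..}. n \<le> k \<and> t n k x = \<zero>\<^bsub>E k\<^esub>)}"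
  "add D = (\<lambda>X Y. \<Union>(n, x)\<in>X. \<Union>(m, y)\<in>Y. lim (max n m) (t n (max n m) x \<oplus>\<^bsub>E (max n m)\<^esub> t m (max n m) y))"
  "smult D = (\<lambda>r X. \<Union>(n, x)\<in>X. lim n (r \<odot>\<^bsub>E n\<^esub> x))"
  by (simp_all add: D_def direct_limit_def Let_def rel_def lim_def)

lemma t_closed: "1 \<le> n \<Longrightarrow> n \<le> m \<Longrightarrow> x \<in> carrier (E n) \<Longrightarrow> t n m x \<in> carrier (E m)"
  using mod_homD(1)[OF hom] by blast

lemma rel_iff:
  "((n, x), (m, y)) \<in> rel \<longleftrightarrow> 1 \<le> n \<and> 1 \<le> m \<and> x \<in> carrier (E n) \<and> y \<in> carrier (E m) \<and>
    (\<exists>k. n \<le> k \<and> m \<le> k \<and> t n k x = t m k y)"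
  by (auto simp: rel_def)

lemma agree_later:
  assumes "1 \<le> n" "1 \<le> m" "x \<in> carrier (E n)" "y \<in> carrier (E m)" "n \<le> k" "m \<le> k" "t n k x = t m k y" "k \<le> l"
  shows "t n l x = t m l y"
  using assms comp[of n k l x] comp[of m k l y] by simp

lemma equiv_rel: "equiv (SIGMA n:{1..}. carrier (E n)) rel"
proof (rule equivI)
  show "rel \<subseteq> (SIGMA n:{1..}. carrier (E n)) \<times> (SIGMA n:{1..}. carrier (E n))" by (auto simp: rel_def)
  show "refl_on (SIGMA n:{1..}. carrier (E n)) rel" by (auto simp: refl_on_def rel_iff)
  show "sym rel" by (auto simp: sym_def rel_iff)
  show "trans rel"
  proof (rule transI, clarify)
    fix n x m y l z assume a: "((n, x), (m, y)) \<in> rel" "((m, y), (l, z)) \<in> rel"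
    then obtain k k' where k: "n \<le> k" "m \<le> k" "t n k x = t m k y" "m \<le> k'" "l \<le> k'" "t m k' y = t l k' z"
      by (auto simp: rel_iff)
    have "t n (max k k') x = t m (max k k') y" "t m (max k k') y = t l (max k k') z"
      using a k agree_later[of n m x y k "max k k'"] agree_later[of m l y z k' "max k k'"] by (auto simp: rel_iff)
    then show "((n, x), (l, z)) \<in> rel" using a k by (auto simp: rel_iff intro!: exI[of _ "max k k'"])
  qed
qed

lemma lim_eq_iff:
  assumes "1 \<le> n" "1 \<le> m" "x \<in> carrier (E n)" "y \<in> carrier (E m)"
  shows "lim n x = lim m y \<longleftrightarrow> (\<exists>k. n \<le> k \<and> m \<le> k \<and> t n k x = t m k y)"
  unfolding lim_def using eq_equiv_class_iff[OF equiv_rel, of "(n, x)" "(m, y)"] assms by (auto simp: rel_iff)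

lemma lim_step: "1 \<le> n \<Longrightarrow> n \<le> m \<Longrightarrow> x \<in> carrier (E n) \<Longrightarrow> lim m (t n m x) = lim n x"
  using comp by (subst lim_eq_iff) (auto intro: t_closed intro!: exI[of _ m])

lemma carrier_D: "carrier D = {lim n x | n x. 1 \<le> n \<and> x \<in> carrier (E n)}"
  by (auto simp: D_simps quotient_def lim_def)

lemma mem_lim: "(n', x') \<in> lim n x \<longleftrightarrow> ((n, x), (n', x')) \<in> rel"
  by (simp add: lim_def)

lemma lim_self: "1 \<le> n \<Longrightarrow> x \<in> carrier (E n) \<Longrightarrow> (n, x) \<in> lim n x"
  by (auto simp: mem_lim rel_iff)

lemma zero_D: "1 \<le> n \<Longrightarrow> zero D = lim n \<zero>\<^bsub>E n\<^esub>"
proof -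
  assume n: "1 \<le> n"
  have z: "t k l \<zero>\<^bsub>E k\<^esub> = \<zero>\<^bsub>E l\<^esub>" if "1 \<le> k" "k \<le> l" for k l
    using mod_hom_zero[OF mod mod hom] that by simp
  have zc: "\<zero>\<^bsub>E n\<^esub> \<in> carrier (E n)" using module.axioms(2)[OF mod[OF n]] by (simp add: abelian_group_def abelian_monoid.zero_closed)
  show ?thesis
  proof (intro equalityI subrelI)
    fix m y assume "(m, y) \<in> zero D"
    then obtain k where k: "1 \<le> m" "y \<in> carrier (E m)" "m \<le> k" "t m k y = \<zero>\<^bsub>E k\<^esub>" by (auto simp: D_simps)
    then have "t m (max k n) y = \<zero>\<^bsub>E (max k n)\<^esub>"
      using comp[of m k "max k n" y] z[of k "max k n"] by simp
    then show "(m, y) \<in> lim n \<zero>\<^bsub>E n\<^esub>"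
      using n k zc z[of n "max k n"] by (auto simp: mem_lim rel_iff intro!: exI[of _ "max k n"])
  next
    fix m y assume "(m, y) \<in> lim n \<zero>\<^bsub>E n\<^esub>"
    then obtain k where "1 \<le> m" "y \<in> carrier (E m)" "m \<le> k" "n \<le> k" "t n k \<zero>\<^bsub>E n\<^esub> = t m k y"
      by (auto simp: mem_lim rel_iff)
    then show "(m, y) \<in> zero D" using z[of n k] n by (auto simp: D_simps intro!: bexI[of _ k])
  qed
qed

lemma lim_zero_iff:
  assumes "1 \<le> n" "x \<in> carrier (E n)"
  shows "lim n x = zero D \<longleftrightarrow> (\<exists>k\<ge>n. t n k x = \<zero>\<^bsub>E k\<^esub>)"
proof
  assume "lim n x = zero D"
  then have "(n, x) \<in> zero D" using lim_self[OF assms] by simp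
  then show "\<exists>k\<ge>n. t n k x = \<zero>\<^bsub>E k\<^esub>" by (auto simp: D_simps)
next
  assume "\<exists>k\<ge>n. t n k x = \<zero>\<^bsub>E k\<^esub>"
  then obtain k where k: "k \<ge> n" "t n k x = \<zero>\<^bsub>E k\<^esub>" by auto
  then show "lim n x = zero D" using lim_step[OF assms(1) k(1) assms(2)] zero_D[of k] assms by simp
qed

text \<open>The union that defines the sum ranges over all representatives; far enough in the system, any two
choices give the same element.\<close>

lemma lim_add:
  assumes n: "1 \<le> n" and x: "x \<in> carrier (E n)" and y: "y \<in> carrier (E n)"
  shows "lim n x \<oplus>\<^bsub>D\<^esub> lim n y = lim n (x \<oplus>\<^bsub>E n\<^esub> y)"
proof -
  have aux: "lim (max n' m') (t n' (max n' m') x' \<oplus>\<^bsub>E (max n' m')\<^esub> t m' (max n' m') y') = lim n (x \<oplus>\<^bsub>E n\<^esub> y)"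
    if a: "(n', x') \<in> lim n x" "(m', y') \<in> lim n y" for n' x' m' y'
  proof -
    obtain k k' where k: "n \<le> k" "n' \<le> k" "t n k x = t n' k x'" "n \<le> k'" "m' \<le> k'" "t n k' y = t m' k' y'"
      and c: "1 \<le> n'" "1 \<le> m'" "x' \<in> carrier (E n')" "y' \<in> carrier (E m')"
      using a by (auto simp: mem_lim rel_iff)
    let ?l = "max k k'" and ?m = "max n' m'"
    have ml: "?m \<le> ?l" "1 \<le> ?m" "n' \<le> ?m" "m' \<le> ?m" "n \<le> ?l" using k c by auto
    have 1: "t n ?l x = t n' ?l x'" using agree_later[OF n c(1) x c(3) k(1,2,3)] by simp
    have 2: "t n ?l y = t m' ?l y'" using agree_later[OF n c(2) y c(4) k(4,5,6)] by simp
    interpret Em: module R "E ?m" by (rule mod[OF ml(2)])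
    interpret En: module R "E n" by (rule mod[OF n])
    have tc: "t n' ?m x' \<in> carrier (E ?m)" "t m' ?m y' \<in> carrier (E ?m)" using t_closed c ml by auto
    have "t ?m ?l (t n' ?m x' \<oplus>\<^bsub>E ?m\<^esub> t m' ?m y') = t ?m ?l (t n' ?m x') \<oplus>\<^bsub>E ?l\<^esub> t ?m ?l (t m' ?m y')"
      by (rule mod_homD(2)[OF hom[OF ml(2,1)] tc])
    also have "\<dots> = t n' ?l x' \<oplus>\<^bsub>E ?l\<^esub> t m' ?l y'"
      using comp[OF c(1) ml(3,1) c(3)] comp[OF c(2) ml(4,1) c(4)] by simp
    also have "\<dots> = t n ?l (x \<oplus>\<^bsub>E n\<^esub> y)" using mod_homD(2)[OF hom[OF n ml(5)] x y] 1 2 by simp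
    finally show ?thesis
      using ml n tc x y by (subst lim_eq_iff) (auto intro!: exI[of _ ?l])
  qed
  show ?thesis
    unfolding D_simps
  proof (intro equalityI subsetI)
    fix p assume "p \<in> (\<Union>(n', x')\<in>lim n x. \<Union>(m, y')\<in>lim n y. lim (max n' m) (t n' (max n' m) x' \<oplus>\<^bsub>E (max n' m)\<^esub> t m (max n' m) y'))"
    then show "p \<in> lim n (x \<oplus>\<^bsub>E n\<^esub> y)" using aux by fast
  next
    fix p assume "p \<in> lim n (x \<oplus>\<^bsub>E n\<^esub> y)"
    then have "p \<in> lim (max n n) (t n (max n n) x \<oplus>\<^bsub>E (max n n)\<^esub> t n (max n n) y)"
      using aux[OF lim_self[OF n x] lim_self[OF n y]] by simp
    then show "p \<in> (\<Union>(n', x')\<in>lim n x. \<Union>(m, y')\<in>lim n y. lim (max n' m) (t n' (max n' m) x' \<oplus>\<^bsub>E (max n' m)\<^esub> t m (max n' m) y'))"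
      using lim_self[OF n x] lim_self[OF n y] by fast
  qed
qed

lemma lim_smult:
  assumes n: "1 \<le> n" and x: "x \<in> carrier (E n)" and r: "r \<in> carrier R"
  shows "r \<odot>\<^bsub>D\<^esub> lim n x = lim n (r \<odot>\<^bsub>E n\<^esub> x)"
proof -
  have "lim n' (r \<odot>\<^bsub>E n'\<^esub> x') = lim n (r \<odot>\<^bsub>E n\<^esub> x)" if a: "(n', x') \<in> lim n x" for n' x'
  proof -
    obtain k where k: "n \<le> k" "n' \<le> k" "t n k x = t n' k x'" and c: "1 \<le> n'" "x' \<in> carrier (E n')"
      using a by (auto simp: mem_lim rel_iff)
    interpret E': module R "E n'" by (rule mod[OF c(1)])
    interpret En: module R "E n" by (rule mod[OF n])
    have "t n' k (r \<odot>\<^bsub>E n'\<^esub> x') = t n k (r \<odot>\<^bsub>E n\<^esub> x)"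
      using mod_homD(3)[OF hom[OF n k(1)] r x] mod_homD(3)[OF hom[OF c(1) k(2)] r c(2)] k(3) by simp
    then show ?thesis using c n k x r by (subst lim_eq_iff) (auto intro!: exI[of _ k])
  qed
  then show ?thesis unfolding D_simps using lim_self[OF n x] by fast
qed

lemma common_rep:
  assumes "X \<in> carrier D" "Y \<in> carrier D"
  obtains n x y where "1 \<le> n" "x \<in> carrier (E n)" "y \<in> carrier (E n)" "X = lim n x" "Y = lim n y"
proof -
  obtain n x m y where *: "1 \<le> n" "x \<in> carrier (E n)" "X = lim n x" "1 \<le> m" "y \<in> carrier (E m)" "Y = lim m y"
    using assms by (auto simp: carrier_D)
  show thesis
    by (rule that[of "max n m" "t n (max n m) x" "t m (max n m) y"])
      (use * in \<open>auto simp: lim_step t_closed\<close>)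
qed

lemma module_D: "module R D"
proof -
  have lc: "lim n x \<in> carrier D" if "1 \<le> n" "x \<in> carrier (E n)" for n x using that by (auto simp: carrier_D)
  show ?thesis
  proof (rule moduleI)
    show "cring R" by (rule cring)
    show "abelian_group D"
    proof (rule abelian_groupI)
      fix X Y assume "X \<in> carrier D" "Y \<in> carrier D"
      then obtain n x y where *: "1 \<le> n" "x \<in> carrier (E n)" "y \<in> carrier (E n)" "X = lim n x" "Y = lim n y"
        by (rule common_rep)
      interpret En: module R "E n" by (rule mod[OF *(1)])
      show "X \<oplus>\<^bsub>D\<^esub> Y \<in> carrier D" using * by (simp add: lim_add lc)
      show "X \<oplus>\<^bsub>D\<^esub> Y = Y \<oplus>\<^bsub>D\<^esub> X" using * by (simp add: lim_add En.M.a_comm)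
    next
      interpret E1: module R "E 1" by (rule mod) simp
      show "\<zero>\<^bsub>D\<^esub> \<in> carrier D" using zero_D[of 1] lc[OF order_refl E1.M.zero_closed] by simp
    next
      fix X Y Z assume XYZ: "X \<in> carrier D" "Y \<in> carrier D" "Z \<in> carrier D"
      obtain n x y where *: "1 \<le> n" "x \<in> carrier (E n)" "y \<in> carrier (E n)" "X = lim n x" "Y = lim n y"
        using common_rep[OF XYZ(1,2)] .
      obtain m z where z: "1 \<le> m" "z \<in> carrier (E m)" "Z = lim m z" using XYZ(3) by (auto simp: carrier_D)
      let ?k = "max n m"
      interpret Ek: module R "E ?k" by (rule mod) (use * in auto)
      have k: "1 \<le> ?k" "t n ?k x \<in> carrier (E ?k)" "t n ?k y \<in> carrier (E ?k)" "t m ?k z \<in> carrier (E ?k)"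
        "X = lim ?k (t n ?k x)" "Y = lim ?k (t n ?k y)" "Z = lim ?k (t m ?k z)"
        using * z by (auto simp: t_closed lim_step)
      show "X \<oplus>\<^bsub>D\<^esub> Y \<oplus>\<^bsub>D\<^esub> Z = X \<oplus>\<^bsub>D\<^esub> (Y \<oplus>\<^bsub>D\<^esub> Z)"
        unfolding k(5,6,7) using k(1-4) by (simp add: lim_add Ek.M.a_assoc)
    next
      fix X assume "X \<in> carrier D"
      then obtain n x where *: "1 \<le> n" "x \<in> carrier (E n)" "X = lim n x" by (auto simp: carrier_D)
      interpret En: module R "E n" by (rule mod[OF *(1)])
      show "\<zero>\<^bsub>D\<^esub> \<oplus>\<^bsub>D\<^esub> X = X" using * zero_D[OF *(1)] by (simp add: lim_add)
      show "\<exists>Y\<in>carrier D. Y \<oplus>\<^bsub>D\<^esub> X = \<zero>\<^bsub>D\<^esub>"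
        using * zero_D[OF *(1)] by (intro bexI[of _ "lim n (\<ominus>\<^bsub>E n\<^esub> x)"]) (simp_all add: lim_add lc En.M.l_neg)
    qed
  next
    fix r X assume r: "r \<in> carrier R" and "X \<in> carrier D"
    then obtain n x where *: "1 \<le> n" "x \<in> carrier (E n)" "X = lim n x" by (auto simp: carrier_D)
    interpret En: module R "E n" by (rule mod[OF *(1)])
    show "r \<odot>\<^bsub>D\<^esub> X \<in> carrier D" using * r by (simp add: lim_smult lc)
  next
    fix r s X assume r: "r \<in> carrier R" "s \<in> carrier R" and "X \<in> carrier D"
    then obtain n x where *: "1 \<le> n" "x \<in> carrier (E n)" "X = lim n x" by (auto simp: carrier_D)
    interpret En: module R "E n" by (rule mod[OF *(1)])
    show "(r \<oplus>\<^bsub>R\<^esub> s) \<odot>\<^bsub>D\<^esub> X = r \<odot>\<^bsub>D\<^esub> X \<oplus>\<^bsub>D\<^esub> s \<odot>\<^bsub>D\<^esub> X" using * r by (simp add: lim_smult lim_add En.smult_l_distr)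
    show "(r \<otimes>\<^bsub>R\<^esub> s) \<odot>\<^bsub>D\<^esub> X = r \<odot>\<^bsub>D\<^esub> (s \<odot>\<^bsub>D\<^esub> X)" using * r by (simp add: lim_smult En.smult_assoc1)
  next
    fix r X Y assume r: "r \<in> carrier R" and XY: "X \<in> carrier D" "Y \<in> carrier D"
    obtain n x y where *: "1 \<le> n" "x \<in> carrier (E n)" "y \<in> carrier (E n)" "X = lim n x" "Y = lim n y"
      using common_rep[OF XY] .
    interpret En: module R "E n" by (rule mod[OF *(1)])
    show "r \<odot>\<^bsub>D\<^esub> (X \<oplus>\<^bsub>D\<^esub> Y) = r \<odot>\<^bsub>D\<^esub> X \<oplus>\<^bsub>D\<^esub> r \<odot>\<^bsub>D\<^esub> Y" using * r by (simp add: lim_smult lim_add En.smult_r_distr)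
  next
    fix X assume "X \<in> carrier D"
    then obtain n x where *: "1 \<le> n" "x \<in> carrier (E n)" "X = lim n x" by (auto simp: carrier_D)
    interpret En: module R "E n" by (rule mod[OF *(1)])
    show "\<one>\<^bsub>R\<^esub> \<odot>\<^bsub>D\<^esub> X = X" using * by (simp add: lim_smult)
  qed
qed

end

section \<open>Local cohomology in terms of cocycles\<close>

context noetherian_module_ideal begin

abbreviation HE :: "nat \<Rightarrow> nat \<Rightarrow> ('a, ((('a, 'a set) syz \<Rightarrow> 'a) \<Rightarrow> 'c) set) module"
  where "HE i n \<equiv> Ext R i (Q n) M"

abbreviation Ht where "Ht i n m \<equiv> Ext_map R i (proj R \<aa> n) (Q m) M"

abbreviation Zc where "Zc i n \<equiv> cocyc R M (Q n) (carrier M) {\<zero>\<^bsub>M\<^esub>} i"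

lemma pull_Zc: "n \<le> m \<Longrightarrow> \<phi> \<in> Zc i n \<Longrightarrow> pull n i \<phi> \<in> Zc i m"
  by (rule pull_cocycQ[OF _ carrier_is_submodule submodule_zero_set])

lemma Ht_Ext_class: "n \<le> m \<Longrightarrow> \<phi> \<in> Zc i n \<Longrightarrow> Ht i n m (Ext_class (Q n) i \<phi>) = Ext_class (Q m) i (pull n i \<phi>)"
  by (rule Ext_map_Ext_class[OF modQ modQ projQ])

text \<open>Strict functoriality of the standard resolution makes the \<open>Ext\<close> modules a directed system.\<close>

lemma Ext_system: "directed_system R (HE i) (Ht i)"
proof (rule directed_system.intro)
  note Z = submodule_zero_set and MM = carrier_is_submodule
  show "cring R" by (rule R.is_cring)
  show "module R (HE i n)" for n by (rule module_Ext[OF modQ])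
  fix n m :: nat assume nm: "n \<le> m"
  show "Ht i n m \<in> mod_hom R (HE i n) (HE i m)"
  proof (rule mod_homI)
    fix X assume "X \<in> carrier (HE i n)"
    then obtain \<phi> where \<phi>: "\<phi> \<in> Zc i n" "X = Ext_class (Q n) i \<phi>" by (auto simp: Ext_carrier[OF modQ])
    then show "Ht i n m X \<in> carrier (HE i m)"
      using Ht_Ext_class[OF nm] pull_Zc[OF nm] by (auto simp: Ext_carrier[OF modQ])
    { fix Y assume "Y \<in> carrier (HE i n)"
      then obtain \<psi> where \<psi>: "\<psi> \<in> Zc i n" "Y = Ext_class (Q n) i \<psi>" by (auto simp: Ext_carrier[OF modQ])
      show "Ht i n m (X \<oplus>\<^bsub>HE i n\<^esub> Y) = Ht i n m X \<oplus>\<^bsub>HE i m\<^esub> Ht i n m Y"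
        using \<phi> \<psi> cocyc_add[OF MM Z \<phi>(1) \<psi>(1)]
        by (simp add: Ext_class_add[OF modQ] Ht_Ext_class[OF nm] pull_Zc[OF nm]) }
    { fix r assume r: "r \<in> carrier R"
      show "Ht i n m (r \<odot>\<^bsub>HE i n\<^esub> X) = r \<odot>\<^bsub>HE i m\<^esub> Ht i n m X"
        using \<phi> r cocyc_smult[OF MM Z r \<phi>(1)]
        by (simp add: Ext_class_smult[OF modQ] Ht_Ext_class[OF nm] pull_Zc[OF nm]) }
  qed
next
  fix n m k :: nat and X assume nmk: "n \<le> m" "m \<le> k" and "X \<in> carrier (HE i n)"
  then obtain \<phi> where \<phi>: "\<phi> \<in> Zc i n" "X = Ext_class (Q n) i \<phi>" by (auto simp: Ext_carrier[OF modQ])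
  have nk: "n \<le> k" using nmk by simp
  note cM = CzD[OF modQ pull_Zc[OF nmk(2) pull_Zc[OF nmk(1) \<phi>(1)]]]
  have "cochain_of (Q k) i (pull m i (pull n i \<phi>)) = cochain_of (Q k) i (pull n i \<phi>)"
    by (subst cochain_of_eq_iff[OF modQ cM CzD[OF modQ pull_Zc[OF nk \<phi>(1)]]])
      (simp add: basis_map_comp[OF nmk, symmetric])
  then have "Ext_class (Q k) i (pull m i (pull n i \<phi>)) = Ext_class (Q k) i (pull n i \<phi>)" by (simp add: Ext_class_def)
  then show "Ht i m k (Ht i n m X) = Ht i n k X"
    unfolding \<phi>(2) Ht_Ext_class[OF nmk(1) \<phi>(1)] Ht_Ext_class[OF nk \<phi>(1)] Ht_Ext_class[OF nmk(2) pull_Zc[OF nmk(1) \<phi>(1)]] .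
qed

definition lc_class where "lc_class i n \<phi> = directed_system.lim (HE i) (Ht i) n (Ext_class (Q n) i \<phi>)"

lemma local_cohomology_D: "local_cohomology R \<aa> i M = directed_system.D (HE i) (Ht i)"
  by (simp add: local_cohomology_def directed_system.D_def[OF Ext_system])

lemma module_local_cohomology: "module R (local_cohomology R \<aa> i M)"
  unfolding local_cohomology_D by (rule directed_system.module_D[OF Ext_system])

lemma Ext_class_carrier: "\<phi> \<in> Zc i n \<Longrightarrow> Ext_class (Q n) i \<phi> \<in> carrier (HE i n)"
  by (auto simp: Ext_carrier[OF modQ])

lemma local_cohomology_carrier:
  "carrier (local_cohomology R \<aa> i M) = {lc_class i n \<phi> | n \<phi>. 1 \<le> n \<and> \<phi> \<in> Zc i n}"
  unfolding local_cohomology_D directed_system.carrier_D[OF Ext_system]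
  by (auto simp: lc_class_def Ext_carrier[OF modQ])

lemma lc_class_pull: "1 \<le> n \<Longrightarrow> n \<le> m \<Longrightarrow> \<phi> \<in> Zc i n \<Longrightarrow> lc_class i m (pull n i \<phi>) = lc_class i n \<phi>"
  unfolding lc_class_def using directed_system.lim_step[OF Ext_system _ _ Ext_class_carrier, of n m \<phi> i] Ht_Ext_class[of n m \<phi> i] by simp

lemma lc_class_zero_iff:
  assumes "1 \<le> n" "\<phi> \<in> Zc i n"
  shows "lc_class i n \<phi> = \<zero>\<^bsub>local_cohomology R \<aa> i M\<^esub> \<longleftrightarrow>
    (\<exists>m\<ge>n. pull n i \<phi> \<in> cobd R M (Q m) (carrier M) {\<zero>\<^bsub>M\<^esub>} i)"
  unfolding lc_class_def local_cohomology_D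
    directed_system.lim_zero_iff[OF Ext_system assms(1) Ext_class_carrier[OF assms(2)]]
  using Ext_class_zero_iff[OF modQ pull_Zc[OF _ assms(2)]] Ht_Ext_class[OF _ assms(2)] by metis

lemma lc_class_add:
  assumes "1 \<le> n" "\<phi> \<in> Zc i n" "\<psi> \<in> Zc i n"
  shows "lc_class i n \<phi> \<oplus>\<^bsub>local_cohomology R \<aa> i M\<^esub> lc_class i n \<psi> = lc_class i n (\<lambda>s. \<phi> s \<oplus>\<^bsub>M\<^esub> \<psi> s)"
  unfolding lc_class_def local_cohomology_D
    directed_system.lim_add[OF Ext_system assms(1) Ext_class_carrier[OF assms(2)] Ext_class_carrier[OF assms(3)]]
    Ext_class_add[OF modQ assms(2,3)] ..

lemma lc_class_smult:
  assumes "1 \<le> n" "\<phi> \<in> Zc i n" "r \<in> carrier R"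
  shows "r \<odot>\<^bsub>local_cohomology R \<aa> i M\<^esub> lc_class i n \<phi> = lc_class i n (\<lambda>s. r \<odot>\<^bsub>M\<^esub> \<phi> s)"
  unfolding lc_class_def local_cohomology_D
    directed_system.lim_smult[OF Ext_system assms(1) Ext_class_carrier[OF assms(2)] assms(3)]
    Ext_class_smult[OF modQ assms(2,3)] ..

lemma lc_class_cong:
  assumes "\<phi> \<in> Zc i n" "\<psi> \<in> Zc i n" "\<And>s. s \<in> res_basis R (Q n) i \<Longrightarrow> \<phi> s = \<psi> s"
  shows "lc_class i n \<phi> = lc_class i n \<psi>"
  unfolding lc_class_def Ext_class_def
  using cochain_of_eq_iff[OF modQ CzD[OF modQ assms(1)] CzD[OF modQ assms(2)]] assms(3) by simp

lemma local_cohomology_zero_iff: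
  "carrier (local_cohomology R \<aa> i M) = {\<zero>\<^bsub>local_cohomology R \<aa> i M\<^esub>} \<longleftrightarrow> lc_vanishes R \<aa> M i (carrier M) {\<zero>\<^bsub>M\<^esub>}"
proof -
  interpret H: module R "local_cohomology R \<aa> i M" by (rule module_local_cohomology)
  have "carrier (local_cohomology R \<aa> i M) = {\<zero>\<^bsub>local_cohomology R \<aa> i M\<^esub>}
    \<longleftrightarrow> (\<forall>n\<ge>1. \<forall>\<phi>\<in>Zc i n. lc_class i n \<phi> = \<zero>\<^bsub>local_cohomology R \<aa> i M\<^esub>)"
    using H.M.zero_closed unfolding local_cohomology_carrier by blast
  then show ?thesis using lc_class_zero_iff by (auto simp: lc_vanishes_def)
qed

end

section \<open>Local cohomology of a quotient module\<close>

context noetherian_module_ideal begin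

text \<open>Choosing representatives turns cochains with values in the quotient module into cochains modulo \<open>B\<close>; no
condition has to be respected, since cochains are arbitrary functions on bases.\<close>

lemma vanishing_quotient_iff:
  assumes B: "submodule B R M"
  shows "lc_vanishes R \<aa> (quot_module M B) i (carrier (quot_module M B)) {\<zero>\<^bsub>quot_module M B\<^esub>}
    \<longleftrightarrow> lc_vanishes R \<aa> M i (carrier M) B"
proof -
  let ?N = "quot_module M B" and ?\<pi> = "\<lambda>x. B +>\<^bsub>M\<^esub> x"
  have N: "module R ?N" by (rule module_quot[OF B])
  interpret N: noetherian_module_ideal R ?N \<aa>
    by (intro noetherian_module_ideal.intro noetherian_module.intro N noetherian_ring_axioms noetherian_ideal_axioms)
  have \<pi>: "?\<pi> \<in> mod_hom R M ?N" by (rule proj_hom[OF B])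
  have \<pi>0: "?\<pi> x = \<zero>\<^bsub>?N\<^esub> \<longleftrightarrow> x \<in> B" if "x \<in> carrier M" for x
    unfolding quot_zero[OF B] by (rule rcos_eq_self_iff[OF B that])
  have lift: "\<exists>\<psi>. \<psi> \<in> S \<rightarrow> carrier M \<and> (\<forall>s\<in>S. \<psi>' s = ?\<pi> (\<psi> s))" if "\<psi>' \<in> S \<rightarrow> carrier ?N"
    for \<psi>' and S :: "('a, 'a set) syz set"
  proof -
    have "\<forall>s\<in>S. \<exists>x. x \<in> carrier M \<and> \<psi>' s = ?\<pi> x" using that by (auto simp: quot_carrier[OF B] Pi_def image_iff)
    then obtain \<psi> where "\<forall>s\<in>S. \<psi> s \<in> carrier M \<and> \<psi>' s = ?\<pi> (\<psi> s)" by (rule bchoice[THEN exE])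
    then show ?thesis by (intro exI[of _ \<psi>]) auto
  qed
  have hM: "?\<pi> x \<in> carrier ?N" if "x \<in> carrier M" for x using mod_homD(1)[OF \<pi> that] .
  show ?thesis
  proof
    assume vN: "lc_vanishes R \<aa> ?N i (carrier ?N) {\<zero>\<^bsub>?N\<^esub>}"
    show "lc_vanishes R \<aa> M i (carrier M) B"
      unfolding lc_vanishes_def
    proof (intro allI impI ballI)
      fix n \<phi> assume n: "1 \<le> (n::nat)" and \<phi>: "\<phi> \<in> cocyc R M (Q n) (carrier M) B i"
      note \<phi>M = cocyc_carrier[OF carrier_is_submodule \<phi>]
      have "(\<lambda>s. ?\<pi> (\<phi> s)) \<in> cocyc R ?N (Q n) (carrier ?N) {\<zero>\<^bsub>?N\<^esub>} i"
        using \<phi> \<phi>M hM N.dif_hom[OF module_axioms \<pi> \<phi>M] \<pi>0 dif_closed[OF \<phi>M carrier_is_submodule]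
        by (auto simp: cocyc_def)
      from vN[unfolded lc_vanishes_def, rule_format, OF n this]
      obtain m where m: "m \<ge> n" "(\<lambda>s. ?\<pi> (pull n i \<phi> s)) \<in> cobd R ?N (Q m) (carrier ?N) {\<zero>\<^bsub>?N\<^esub>} i"
        by blast
      note pM = pull_carrier[OF m(1) \<phi>M]
      have "pull n i \<phi> \<in> cobd R M (Q m) (carrier M) B i"
      proof (cases i)
        case 0
        then have "\<forall>s\<in>res_basis R (Q m) 0. ?\<pi> (pull n i \<phi> s) = \<zero>\<^bsub>?N\<^esub>" using m(2) by simp
        then show ?thesis using 0 \<pi>0 pM by (auto simp: Pi_def)
      next
        case (Suc j)
        then obtain \<psi>' where \<psi>': "\<psi>' \<in> res_basis R (Q m) j \<rightarrow> carrier ?N"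
          "\<And>s. s \<in> res_basis R (Q m) i \<Longrightarrow> ?\<pi> (pull n i \<phi> s) \<ominus>\<^bsub>?N\<^esub> dif R ?N \<psi>' s = \<zero>\<^bsub>?N\<^esub>" using m(2) by auto
        obtain \<psi> where \<psi>: "\<psi> \<in> res_basis R (Q m) j \<rightarrow> carrier M" "\<And>s. s \<in> res_basis R (Q m) j \<Longrightarrow> \<psi>' s = ?\<pi> (\<psi> s)"
          using lift[OF \<psi>'(1)] by blast
        have "pull n i \<phi> s \<ominus>\<^bsub>M\<^esub> dif R M \<psi> s \<in> B" if s: "s \<in> res_basis R (Q m) i" for s
        proof -
          have s': "s \<in> res_basis R (Q m) (Suc j)" using s Suc by simp
          have c: "pull n i \<phi> s \<in> carrier M" "dif R M \<psi> s \<in> carrier M"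
            using pM s dif_closed[OF \<psi>(1) carrier_is_submodule s'] by auto
          have "dif R ?N \<psi>' s = ?\<pi> (dif R M \<psi> s)"
            using N.dif_cong[OF \<psi>'(1) \<psi>(2) s'] N.dif_hom[OF module_axioms \<pi> \<psi>(1) s'] by simp
          then have "?\<pi> (pull n i \<phi> s \<ominus>\<^bsub>M\<^esub> dif R M \<psi> s) = \<zero>\<^bsub>?N\<^esub>"
            using \<psi>'(2)[OF s] mod_hom_minus[OF module_axioms N \<pi> c] by simp
          then show ?thesis using \<pi>0[of "pull n i \<phi> s \<ominus>\<^bsub>M\<^esub> dif R M \<psi> s"] c by simp
        qed
        then show ?thesis using \<psi>(1) Suc by auto
      qed
      then show "\<exists>m\<ge>n. pull n i \<phi> \<in> cobd R M (Q m) (carrier M) B i" using m(1) by blast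
    qed
  next
    assume vM: "lc_vanishes R \<aa> M i (carrier M) B"
    show "lc_vanishes R \<aa> ?N i (carrier ?N) {\<zero>\<^bsub>?N\<^esub>}"
      unfolding lc_vanishes_def
    proof (intro allI impI ballI)
      fix n \<phi>' assume n: "1 \<le> (n::nat)" and \<phi>': "\<phi>' \<in> cocyc R ?N (Q n) (carrier ?N) {\<zero>\<^bsub>?N\<^esub>} i"
      note \<phi>'N = N.cocyc_carrier[OF N.carrier_is_submodule \<phi>']
      obtain \<phi> where \<phi>: "\<phi> \<in> res_basis R (Q n) i \<rightarrow> carrier M" "\<And>s. s \<in> res_basis R (Q n) i \<Longrightarrow> \<phi>' s = ?\<pi> (\<phi> s)"
        using lift[OF \<phi>'N] by blast
      have "dif R M \<phi> s \<in> B" if s: "s \<in> res_basis R (Q n) (Suc i)" for s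
      proof -
        have "?\<pi> (dif R M \<phi> s) = dif R ?N \<phi>' s"
          using N.dif_cong[OF \<phi>'N \<phi>(2) s] N.dif_hom[OF module_axioms \<pi> \<phi>(1) s] by simp
        then show ?thesis using \<phi>' s \<pi>0[OF dif_closed[OF \<phi>(1) carrier_is_submodule s]] by (auto simp: cocyc_def)
      qed
      then have "\<phi> \<in> cocyc R M (Q n) (carrier M) B i" using \<phi>(1) by (simp add: cocyc_def)
      then obtain m where m: "m \<ge> n" "pull n i \<phi> \<in> cobd R M (Q m) (carrier M) B i"
        using vM n unfolding lc_vanishes_def by blast
      have "(\<lambda>s. ?\<pi> (pull n i \<phi> s)) \<in> cobd R ?N (Q m) (carrier ?N) {\<zero>\<^bsub>?N\<^esub>} i"
        by (rule N.cobd_hom[OF module_axioms \<pi> carrier_is_submodule pull_carrier[OF m(1) \<phi>(1)] m(2)])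
          (use hM \<pi>0 submodule_sub[OF B] in auto)
      then have "N.pull n i \<phi>' \<in> cobd R ?N (Q m) (carrier ?N) {\<zero>\<^bsub>?N\<^esub>} i"
        by (rule N.cobd_cong) (use \<phi>(2)[OF basis_map[OF m(1)]] in simp)
      then show "\<exists>m\<ge>n. N.pull n i \<phi>' \<in> cobd R ?N (Q m) (carrier ?N) {\<zero>\<^bsub>?N\<^esub>} i" using m(1) by blast
    qed
  qed
qed

text \<open>If \<open>H\<^sup>i(M/pM) = 0\<close>, every class of \<open>H\<^sup>i(M)\<close> comes from \<open>pM\<close> after a correction by a coboundary,
so \<open>classes_of_multiples\<close> applies with \<open>P\<close> as membership in \<open>S\<close>, for a finite generating set of \<open>p\<close>.\<close>

lemma local_cohomology_generated_by_multiples: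
  assumes top: "\<And>K. submodule K R M \<Longrightarrow> lc_vanishes R \<aa> M (Suc i) K {\<zero>\<^bsub>M\<^esub>}"
    and p: "ideal p R" and van_p: "lc_vanishes R \<aa> M i (carrier M) (imul R M p (carrier M))"
    and S: "submodule S R (local_cohomology R \<aa> i M)"
    and pS: "\<And>r h. r \<in> p \<Longrightarrow> h \<in> carrier (local_cohomology R \<aa> i M) \<Longrightarrow> r \<odot>\<^bsub>local_cohomology R \<aa> i M\<^esub> h \<in> S"
  shows "S = carrier (local_cohomology R \<aa> i M)"
proof -
  let ?H = "local_cohomology R \<aa> i M" and ?pM = "imul R M p (carrier M)"
  interpret H: module R ?H by (rule module_local_cohomology)
  interpret RM: module R "ring_module R" by (rule module_ring_module)
  note Z = submodule_zero_set and MM = carrier_is_submodule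
  have pR: "p \<subseteq> carrier R" using ideal.Icarr[OF p] by auto
  have pM: "submodule ?pM R M" by (rule multiples_submodule[OF pR])
  obtain G where G: "G \<subseteq> carrier R" "finite G" "p = Idl G" using finetely_gen[OF p] by blast
  have Gp: "G \<subseteq> p" using G genideal_self by auto
  let ?GM = "imul R M G (carrier M)"
  have GM: "submodule ?GM R M" by (rule multiples_submodule[OF G(1)])
  have "?pM \<subseteq> ?GM"
  proof (rule imul_least[OF GM])
    let ?I = "{r \<in> carrier R. \<forall>y\<in>carrier M. r \<odot>\<^bsub>M\<^esub> y \<in> ?GM}"
    have "ideal ?I R"
      unfolding ideal_iff_submodule
      by (rule RM.submodule_test)
        (auto simp: smult_l_distr smult_assoc1 submodule_zero[OF GM]
          intro: submodule_add[OF GM] submodule_smult[OF GM])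
    moreover have "G \<subseteq> ?I" using G(1) by (auto intro: imul_base)
    ultimately have "p \<subseteq> ?I" unfolding G(3) by (rule genideal_minimal)
    then show "a \<odot>\<^bsub>M\<^esub> w \<in> ?GM" if "a \<in> p" "w \<in> carrier M" for a w using that by auto
  qed
  note pG = this
  have ec: "lc_class i n \<phi> \<in> carrier ?H" if "1 \<le> n" "\<phi> \<in> Zc i n" for n \<phi> using that local_cohomology_carrier by blast
  have Scobd: "lc_class i n \<phi> \<in> S" if "1 \<le> n" "\<phi> \<in> Zc i n" "\<phi> \<in> cobd R M (Q n) (carrier M) {\<zero>\<^bsub>M\<^esub>} i" for n \<phi>
    using lc_class_zero_iff[OF that(1,2)] pull_self_cobd[OF MM Z CzD[OF modQ that(2)] that(3)] H.submodule_zero[OF S]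
    by (metis order_refl)
  have Sadd: "lc_class i n \<phi>'' \<in> S" if "1 \<le> n" "\<phi> \<in> Zc i n" "\<phi>' \<in> Zc i n" "\<phi>'' \<in> Zc i n" "lc_class i n \<phi> \<in> S" "lc_class i n \<phi>' \<in> S"
    "\<And>s. s \<in> res_basis R (Q n) i \<Longrightarrow> \<phi>'' s = \<phi> s \<oplus>\<^bsub>M\<^esub> \<phi>' s" for n \<phi> \<phi>' \<phi>''
    using lc_class_cong[OF that(4) cocyc_add[OF MM Z that(2,3)]] that(7)
      lc_class_add[OF that(1-3)] H.submodule_add[OF S that(5,6)] by simp
  have Ssmult: "lc_class i n (\<lambda>s. g \<odot>\<^bsub>M\<^esub> \<phi> s) \<in> S" if "1 \<le> n" "\<phi> \<in> Zc i n" "g \<in> p" for n \<phi> g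
    using lc_class_smult[OF that(1,2), of g] pS[OF that(3) ec[OF that(1,2)]] pR that(3) by auto
  have Spull: "lc_class i n \<phi> \<in> S" if "1 \<le> n" "n \<le> m" "\<phi> \<in> Zc i n" "lc_class i m (pull n i \<phi>) \<in> S" for n m \<phi>
    using that lc_class_pull[OF that(1-3)] by simp
  have "lc_class i n \<phi> \<in> S" if n: "1 \<le> n" and \<phi>: "\<phi> \<in> Zc i n" for n \<phi>
  proof -
    have "\<phi> \<in> cocyc R M (Q n) (carrier M) ?pM i"
      using \<phi> submodule_zero[OF pM] by (auto simp: cocyc_def)
    then obtain m where m: "m \<ge> n" "pull n i \<phi> \<in> cobd R M (Q m) (carrier M) ?pM i"
      using van_p n unfolding lc_vanishes_def by blast
    have m1: "1 \<le> m" using n m(1) by simp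
    have p\<phi>: "pull n i \<phi> \<in> Zc i m" by (rule pull_Zc[OF m(1) \<phi>])
    note p\<phi>M = CzD[OF modQ p\<phi>]
    obtain \<delta> where \<delta>: "\<delta> \<in> Zc i m" "\<delta> \<in> cobd R M (Q m) (carrier M) {\<zero>\<^bsub>M\<^esub>} i"
      "\<forall>s\<in>res_basis R (Q m) i. pull n i \<phi> s \<ominus>\<^bsub>M\<^esub> \<delta> s \<in> ?pM"
      using cobd_split[OF MM Z m(2) p\<phi>M] by blast
    let ?\<theta> = "\<lambda>s. pull n i \<phi> s \<ominus>\<^bsub>M\<^esub> \<delta> s"
    have \<theta>: "?\<theta> \<in> Zc i m" by (rule cocyc_minus[OF MM Z p\<phi> \<delta>(1)])
    have \<theta>G: "?\<theta> \<in> res_basis R (Q m) i \<rightarrow> ?GM" using \<delta>(3) pG by auto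
    have "lc_class i m ?\<theta> \<in> S"
      by (rule classes_of_multiples[where P = "\<lambda>n \<phi>. lc_class i n \<phi> \<in> S", OF top Spull Scobd Sadd Ssmult pR G(2) Gp m1 \<theta> \<theta>G])
    then have "lc_class i m (pull n i \<phi>) \<in> S"
    proof (rule Sadd[OF m1 \<theta> \<delta>(1) p\<phi> _ Scobd[OF m1 \<delta>(1,2)]])
      fix s assume "s \<in> res_basis R (Q m) i"
      then show "pull n i \<phi> s = ?\<theta> s \<oplus>\<^bsub>M\<^esub> \<delta> s"
        using p\<phi>M CzD[OF modQ \<delta>(1)] by (intro minus_conv) auto
    qed
    then show ?thesis by (rule Spull[OF n m(1) \<phi>])
  qed
  then show ?thesis using H.submodule_sub[OF S] unfolding local_cohomology_carrier by blast
qed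

end

section \<open>Attached primes of the top local cohomology\<close>

lemma prime_chain_bound:
  assumes "prime_chain R n P" "krull_dim R = ereal (real d)"
  shows "n \<le> d"
proof -
  have "ereal (real n) \<le> chain_dim {p. primeideal p R}"
    unfolding chain_dim_def by (rule Sup_upper) (use assms(1) in \<open>auto simp: prime_chain_def\<close>)
  then show ?thesis using assms(2) by (simp add: krull_dim_def)
qed

theorem theorem1p3:
  fixes R :: "('r, 'c) ring_scheme" and M :: "('r, 'm, 'd) module_scheme"
    and \<aa> :: "'r set" and d :: nat
  assumes "cring R" and "noetherian_ring R" and "\<one>\<^bsub>R\<^esub> \<noteq> \<zero>\<^bsub>R\<^esub>"
    and "ideal \<aa> R"
    and "module R M"
    and "module_dim R M = krull_dim R" and "module_dim R M = ereal (real d)"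
  shows "Att R (local_cohomology R \<aa> d M) \<subseteq>
    {\<pp> \<in> Ass R M. cd R \<aa> (quot_module (ring_module R) \<pp>) = module_dim R M}"
proof
  interpret noetherian_module_ideal R M \<aa>
    by (intro noetherian_module_ideal.intro noetherian_module.intro noetherian_ideal.intro
        noetherian_cring.intro noetherian_ideal_axioms.intro assms)
  interpret RM: noetherian_module_ideal R "ring_module R" \<aa> by (rule ring_as_module)
  let ?H = "local_cohomology R \<aa> d M"
  interpret H: module R ?H by (rule module_local_cohomology)
  have dim: "n \<le> d" if "prime_chain R n P" for n P
    using prime_chain_bound[OF that] assms(6,7) by simp
  fix \<pp> assume "\<pp> \<in> Att R ?H"
  then obtain S where \<pp>: "primeideal \<pp> R" and S: "submodule S R ?H"
    and ann: "\<pp> = annihilator R (quot_module ?H S)" by (auto simp: Att_def)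
  interpret \<pp>: primeideal \<pp> R by (rule \<pp>)
  have \<pp>sub: "submodule \<pp> R (ring_module R)" using \<pp>.is_ideal by (simp add: ideal_iff_submodule)
  have pS: "r \<odot>\<^bsub>?H\<^esub> h \<in> S" if "r \<in> \<pp>" "h \<in> carrier ?H" for r h
  proof -
    have r: "r \<in> carrier R" using that(1) \<pp>.Icarr by simp
    have "r \<in> annihilator R (quot_module ?H S)" using that(1) by (simp only: ann[symmetric])
    then have "r \<odot>\<^bsub>quot_module ?H S\<^esub> (S +>\<^bsub>?H\<^esub> h) = S"
      using that(2) by (simp add: annihilator_def H.quot_carrier[OF S] H.quot_zero[OF S])
    then show ?thesis
      using H.quot_smult[OF S r that(2)] H.rcos_eq_self_iff[OF S] r that(2) by simp
  qed
  have "S \<noteq> carrier ?H"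
  proof
    assume "S = carrier ?H"
    then have "S +>\<^bsub>?H\<^esub> h = S" if "h \<in> carrier ?H" for h using H.rcos_eq_self_iff[OF S] that by simp
    then have "\<one>\<^bsub>R\<^esub> \<in> annihilator R (quot_module ?H S)"
      using H.quot_smult[OF S] by (auto simp: annihilator_def H.quot_carrier[OF S] H.quot_zero[OF S])
    then have "\<one>\<^bsub>R\<^esub> \<in> \<pp>" by (simp only: ann[symmetric])
    then show False using \<pp>.one_imp_carrier \<pp>.I_notcarr by simp
  qed
  have top: "lc_vanishes R \<aa> M (Suc d) K {\<zero>\<^bsub>M\<^esub>}" if K: "submodule K R M" for K
  proof (rule vanishing_of_primes[OF K submodule_zero_set])
    show "{\<zero>\<^bsub>M\<^esub>} \<subseteq> K" using submodule_zero[OF K] by simp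
    show "lc_vanishes R \<aa> (ring_module R) (Suc d) (carrier R) q" if "primeideal q R" for q
      by (rule vanishing_above_coheight[OF that]) (use dim[of "Suc d"] in auto)
  qed
  let ?pM = "imul R M \<pp> (carrier M)"
  have \<pp>R: "\<pp> \<subseteq> carrier R" using \<pp>.Icarr by auto
  have pM: "submodule ?pM R M" by (rule multiples_submodule[OF \<pp>R])
  \<comment> \<open>otherwise the submodule \<open>S\<close>, which contains \<open>\<pp>H\<close>, would be all of \<open>H\<close>\<close>
  have "\<not> lc_vanishes R \<aa> M d (carrier M) ?pM"
    using local_cohomology_generated_by_multiples[OF top \<pp>.is_ideal _ S pS] \<open>S \<noteq> carrier ?H\<close> by blast
  then obtain x q where x: "x \<in> carrier M" and q: "primeideal q R"
    and xq: "{r \<in> carrier R. r \<odot>\<^bsub>M\<^esub> x \<in> ?pM} \<subseteq> q" and vq: "\<not> lc_vanishes R \<aa> (ring_module R) d (carrier R) q"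
    using vanishing_of_primes[OF carrier_is_submodule pM, of d] submodule_sub[OF pM] by blast
  have pq: "\<pp> \<subseteq> q" using xq \<pp>R x by (auto intro: imul_base)
  obtain P where P: "prime_chain R d P" "P 0 = q" using vanishing_above_coheight[OF q] vq by blast
  \<comment> \<open>\<open>q\<close> is a minimal prime: a prime strictly below it would prolong the chain \<open>P\<close> beyond \<open>d\<close>\<close>
  have maximal: "\<not> q' \<subset> q" if "primeideal q' R" for q'
    using prime_chain_Cons[OF P(1) that] P(2) dim by fastforce
  have eq: "q = \<pp>" using maximal[OF \<pp>] pq by blast
  have "\<pp> \<in> Ass R M"
  proof (rule minimal_prime_associated[OF \<pp> _ x])
    show "q' = \<pp>" if "primeideal q' R" "q' \<subseteq> \<pp>" for q' using maximal[OF that(1)] that(2) eq by blast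
    show "{r \<in> carrier R. r \<odot>\<^bsub>M\<^esub> x = \<zero>\<^bsub>M\<^esub>} \<subseteq> \<pp>" using xq submodule_zero[OF pM] eq by auto
  qed
  moreover have "cd R \<aa> (quot_module (ring_module R) \<pp>) = module_dim R M"
  proof -
    let ?N = "quot_module (ring_module R) \<pp>"
    interpret N: noetherian_module_ideal R ?N \<aa>
      by (intro noetherian_module_ideal.intro noetherian_module.intro module_quot_ideal[OF \<pp>.is_ideal]
          noetherian_ring_axioms noetherian_ideal_axioms)
    have iff: "carrier (local_cohomology R \<aa> i ?N) = {\<zero>\<^bsub>local_cohomology R \<aa> i ?N\<^esub>}
      \<longleftrightarrow> lc_vanishes R \<aa> (ring_module R) i (carrier R) \<pp>" for i
      unfolding N.local_cohomology_zero_iff using RM.vanishing_quotient_iff[OF \<pp>sub] by simp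
    have "Sup {ereal (real i) | i. carrier (local_cohomology R \<aa> i ?N) \<noteq> {\<zero>\<^bsub>local_cohomology R \<aa> i ?N\<^esub>}} = ereal (real d)"
    proof (rule antisym)
      show "Sup {ereal (real i) | i. carrier (local_cohomology R \<aa> i ?N) \<noteq> {\<zero>\<^bsub>local_cohomology R \<aa> i ?N\<^esub>}} \<le> ereal (real d)"
      proof (rule Sup_least)
        fix u assume "u \<in> {ereal (real i) | i. carrier (local_cohomology R \<aa> i ?N) \<noteq> {\<zero>\<^bsub>local_cohomology R \<aa> i ?N\<^esub>}}"
        then obtain i where i: "u = ereal (real i)" "\<not> lc_vanishes R \<aa> (ring_module R) i (carrier R) \<pp>"
          unfolding iff by auto
        then obtain P where "prime_chain R i P" using vanishing_above_coheight[OF \<pp>] by blast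
        then show "u \<le> ereal (real d)" using dim i(1) by simp
      qed
      show "ereal (real d) \<le> Sup {ereal (real i) | i. carrier (local_cohomology R \<aa> i ?N) \<noteq> {\<zero>\<^bsub>local_cohomology R \<aa> i ?N\<^esub>}}"
        by (rule Sup_upper) (use vq eq iff in auto)
    qed
    then show ?thesis unfolding cd_def assms(7) .
  qed
  ultimately show "\<pp> \<in> {\<pp> \<in> Ass R M. cd R \<aa> (quot_module (ring_module R) \<pp>) = module_dim R M}" by simp
qed

end
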